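(* Consider the stochastic energy exchange model $\mathbf{E}_t$ on $\mathbb{R}^N_+$ with transition kernel $P^t$ described in the context. For any $\gamma>0$ there exists $\eta>0$ such that for any $\mu\in\mathcal{M}_\eta$ and any $\xi,\zeta\in L^\infty(\mathbb{R}^N_+)$, $$\left|\int (P^t\zeta)(\mathbf{E})\,\xi(\mathbf{E})\,\mu(d\mathbf{E})-\int (P^t\zeta)(\mathbf{E})\,\mu(d\mathbf{E})\int\xi(\mathbf{E})\,\mu(d\mathbf{E})\right| = O\!\left(t^{-(2-\gamma)}\right)\quad\text{as } t\to\infty.$$
   Context: Fix an integer $N\ge1$, bath temperatures $T_L,T_R>0$ and a sufficiently large constant $K$ ($K\gg T_L,T_R$). Let $R(a,b)=\min\{K,\sqrt{\min(a,b)}\}$. The stochastic energy exchange model is the Markov jump process $\mathbf{E}_t=(E_1(t),\dots,E_N(t))$ on $\mathbb{R}^N_+$ defined as follows: for each $i=1,\dots,N-1$ an exponential clock with rate $R(E_i,E_{i+1})$ is attached to sites $i,i+1$; when it rings, $(E_i,E_{i+1})$ is replaced by $(p(E_i+E_{i+1}),(1-p)(E_i+E_{i+1}))$ with $p$ uniform on $(0,1)$. A clock of rate $R(T_L,E_1)$ (resp. $R(E_N,T_R)$) is attached to site $1$ and the left bath (resp. site $N$ and the right bath); when it rings, $E_1$ is replaced by $p(E_1+X_L)$ (resp. $E_N$ by $p(E_N+X_R)$), with $p$ uniform on $(0,1)$ and $X_L$ (resp. $X_R$) exponential with mean $T_L$ (resp. $T_R$). All clocks and random variables are independent. $P^t$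 is its transition kernel and $(P^t\zeta)(\mathbf{E})=\int P^t(\mathbf{E},d\mathbf{x})\zeta(\mathbf{x})$. Let $W(\mathbf{E})=\sum_{i=1}^N E_i$, $a_m=1-\frac{2^{m-1}-1}{2^N-1}$ for $m=1,\dots,N$, and for $0<\eta\ll1$ let $V_\eta(\mathbf{E})=\sum_{m=1}^N\sum_{i=1}^{N-m+1}\big(\sum_{j=0}^{m-1}E_{i+j}\big)^{a_m\eta-1}$. $\mathcal{M}_\eta$ is the set of probability measures $\mu$ on $\mathbb{R}^N_+$ with $\int (W+V_\eta)\,d\mu<\infty$. *)

theory Defs
  imports "HOL-Probability.Probability" "HOL-Library.Landau_Symbols"
begin

(* States E = (E_1,...,E_N) are represented 0-indexed as functions nat => real,
   E i = E_{i+1} for i < N, on the product measurable space below. *)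
definition state_space :: "nat \<Rightarrow> (nat \<Rightarrow> real) measure" where
  "state_space N = PiM {..<N} (\<lambda>_. borel)"

definition pos_orthant :: "nat \<Rightarrow> (nat \<Rightarrow> real) set" where
  "pos_orthant N = PiE {..<N} (\<lambda>_. {0..})"

definition rate :: "real \<Rightarrow> real \<Rightarrow> real \<Rightarrow> real" where
  "rate K a b = min K (sqrt (min a b))"

definition unif01 :: "real measure" where
  "unif01 = uniform_measure lborel {0<..<1}"

definition expo :: "real \<Rightarrow> real measure" where
  "expo T = density lborel (exponential_density (1 / T))"

(* total jump rate bound used for uniformization: N+1 clocks, each of rate <= K *)
definition unif_rate :: "nat \<Rightarrow> real \<Rightarrow> real" where
  "unif_rate N K = real (N + 1) * K"

definition total_rate :: "nat \<Rightarrow> real \<Rightarrow> real \<Rightarrow> real \<Rightarrow> (nat \<Rightarrow> real) \<Rightarrow> real" where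
  "total_rate N K TL TR E =
     (\<Sum>i<N - 1. rate K (E i) (E (Suc i))) + rate K TL (E 0) + rate K (E (N - 1)) TR"

definition generator ::
  "nat \<Rightarrow> real \<Rightarrow> real \<Rightarrow> real \<Rightarrow> ((nat \<Rightarrow> real) \<Rightarrow> real) \<Rightarrow> (nat \<Rightarrow> real) \<Rightarrow> real" where
  "generator N K TL TR f E =
     (\<Sum>i<N - 1. rate K (E i) (E (Suc i)) *
        ((\<integral>p. f (E(i := p * (E i + E (Suc i)), Suc i := (1 - p) * (E i + E (Suc i)))) \<partial>unif01) - f E))
   + rate K TL (E 0) *
        ((\<integral>p. (\<integral>x. f (E(0 := p * (E 0 + x))) \<partial>expo TL) \<partial>unif01) - f E)
   + rate K (E (N - 1)) TR *
        ((\<integral>p. (\<integral>x. f (E(N - 1 := p * (E (N - 1) + x))) \<partial>expo TR) \<partial>unif01) - f E)"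

definition jump_op ::
  "nat \<Rightarrow> real \<Rightarrow> real \<Rightarrow> real \<Rightarrow> ((nat \<Rightarrow> real) \<Rightarrow> real) \<Rightarrow> (nat \<Rightarrow> real) \<Rightarrow> real" where
  "jump_op N K TL TR f E = f E + generator N K TL TR f E / unif_rate N K"

(* Transition semigroup (P^t zeta)(E) = E_E[zeta(E_t)] of the bounded-rate jump process,
   given by uniformization: P^t = sum_n e^{-lambda t} (lambda t)^n / n! J^n *)
definition Pt ::
  "nat \<Rightarrow> real \<Rightarrow> real \<Rightarrow> real \<Rightarrow> real \<Rightarrow> ((nat \<Rightarrow> real) \<Rightarrow> real) \<Rightarrow> (nat \<Rightarrow> real) \<Rightarrow> real" where
  "Pt N K TL TR t f E =
     (\<Sum>n. exp (- unif_rate N K * t) * (unif_rate N K * t) ^ n / fact n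
            * ((jump_op N K TL TR ^^ n) f) E)"

definition W :: "nat \<Rightarrow> (nat \<Rightarrow> real) \<Rightarrow> real" where
  "W N E = (\<Sum>i<N. E i)"

definition a_coef :: "nat \<Rightarrow> nat \<Rightarrow> real" where
  "a_coef N m = 1 - (2 ^ (m - 1) - 1) / (2 ^ N - 1)"

definition negpow :: "real \<Rightarrow> real \<Rightarrow> ennreal" where
  "negpow s q = (if s > 0 then ennreal (s powr q) else \<infinity>)"

definition V :: "nat \<Rightarrow> real \<Rightarrow> (nat \<Rightarrow> real) \<Rightarrow> ennreal" where
  "V N \<eta> E = (\<Sum>m\<in>{1..N}. \<Sum>i\<in>{0..N - m}.
                 negpow (\<Sum>j<m. E (i + j)) (a_coef N m * \<eta> - 1))"

definition Mclass :: "nat \<Rightarrow> real \<Rightarrow> (nat \<Rightarrow> real) measure set" where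
  "Mclass N \<eta> = {\<mu>. prob_space \<mu> \<and> sets \<mu> = sets (state_space N)
                    \<and> emeasure \<mu> (pos_orthant N) = 1
                    \<and> (\<integral>\<^sup>+ E. ennreal (W N E) + V N \<eta> E \<partial>\<mu>) < \<infinity>}"

definition Linf :: "nat \<Rightarrow> ((nat \<Rightarrow> real) \<Rightarrow> real) set" where
  "Linf N = {f. f \<in> borel_measurable (state_space N) \<and> (\<exists>B. \<forall>E. \<bar>f E\<bar> \<le> B)}"

end

(*
  Let J be the jump chain of the uniformized process. For two copies of J started at x and y,
  |J^n zeta(x) - J^n zeta(y)| is shown to be O((1 + V + W)(x) + (1 + V + W)(y)) n^(-2q) for every q < 1; the
  correlation is an average of such differences against mu, and V + W is mu-integrable for eta = 1 - q.
  Only site energies near 0 slow the chain down: leaving E_i = e takes time of order e^(-1/2), so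
  V ~ e^(-q) satisfies J V <= V - c V^(1 - 1/(2q)) + b. For this V must contain the powers of the energies of
  all blocks of neighbouring sites, with weights growing fast in the block length: inside a block of
  comparable tiny energies an exchange may increase E_i^(-q), and the enlarged block absorbs this increase.
  Once all energies are bounded below, W contracts geometrically, and a single sweep of the clocks from left
  to right minorizes J^N on compact sets of energies.
  These ingredients are combined without constructing a coupling: the weights
  ((V x + V y)^(1/(2q)) + C ln (W x + W y + g) + A + c k)^(2q) are concave in (V, W), so their tangent planes
  show that each step of the chain turns a bound of z(x) - z(y) by the weight k+1 into one by the weight k.
*)
theory Submission
  imports Defs
begin

section \<open>Abstract polynomial contraction\<close>

text \<open>Only first powers of \<open>V\<close> and \<open>W\<close> are integrable against
  \<open>\<mu>\<close>, so a time raised to the power \<open>2q\<close> has to end up linear in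
  both. The drift makes \<open>V^(1/(2q))\<close> fall at constant speed, and \<open>ln W\<close>
  falls by a constant when \<open>W\<close> contracts by a factor; both are thus measured in units
  of time, and the term \<open>c k\<close> lets the weight spend a fixed amount per step. The
  logarithm also tames the growth of \<open>W\<close> while \<open>V\<close> is large: an increment
  \<open>d\<close> changes it by about \<open>d / g\<close>. The tangent plane separates variables.
  The weight couples \<open>x\<close> and \<open>y\<close>, but its tangent plane is a constant plus
  a function of \<open>x\<close> plus the same function of \<open>y\<close>, and each of these is
  averaged by the one-copy operator. Minorization acts on the constant term, which is why
  \<open>A\<close> must be large compared with \<open>1 / \<epsilon>\<close>. The bound
  \<open>q < 1\<close> is forced by integrability of \<open>p^(-q)\<close> on \<open>(0,1)\<close>;
  \<open>q > 1/2\<close> makes the exponent of the drift positive and lets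
  \<open>h^(1/2 - q)\<close> blow up at \<open>0\<close>, on which the choice of the block weights
  rests. Contraction of \<open>W\<close> and minorization take \<open>N\<close> jumps, so the
  abstract argument runs on the \<open>N\<close>-th iterate of the jump operator.\<close>

lemma powr_tangent_ge:
  fixes x x0 b :: real
  assumes "b \<ge> 1" "x \<ge> 0" "x0 > 0"
  shows "x0 powr b + b * x0 powr (b - 1) * (x - x0) \<le> x powr b"
proof (cases "x = 0")
  case True
  have "x0 powr b = x0 powr (b - 1) * x0" using assms by (simp add: powr_diff)
  then have "x0 powr b + b * x0 powr (b - 1) * (x - x0) = (1 - b) * (x0 powr (b-1) * x0)"
    using True by (simp add: algebra_simps)
  also have "\<dots> \<le> 0" using assms by (intro mult_nonpos_nonneg) auto
  finally show ?thesis using True by simp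
next
  case False
  then have x: "x > 0" using assms by simp
  have cv: "convex_on {0<..} (\<lambda>x::real. x powr b)"
    by (rule powr_convex) (use assms in auto)
  have "b * x0 powr (b - 1) * (x - x0) \<le> x powr b - x0 powr b"
  proof (rule convex_on_imp_above_tangent[OF cv])
    show "((\<lambda>x. x powr b) has_real_derivative b * x0 powr (b - 1)) (at x0 within {0<..})"
      using assms by (auto intro!: derivative_eq_intros)
    show "x0 \<in> interior {0<..}" using assms by (simp add: interior_open)
  qed (use x in auto)
  then show ?thesis by simp
qed

text \<open>Concavity is read off from the convexity of the inverse power: the tangent at 1 of the
  exponent \<open>1/t\<close>, evaluated at \<open>z powr t\<close>.\<close>

lemma powr_le_tangent:
  fixes z :: real
  assumes "0 \<le> t" "t \<le> 1" "0 < z"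
  shows "z powr t \<le> 1 + t * (z - 1)"
proof (cases "t = 0")
  case False
  then have t: "t > 0" using assms by simp
  have "1 powr (1/t) + (1/t) * 1 powr (1/t - 1) * (z powr t - 1) \<le> (z powr t) powr (1/t)"
    by (rule powr_tangent_ge) (use assms t in auto)
  then have "1 + (z powr t - 1) / t \<le> z" using t assms by (simp add: powr_powr)
  then show ?thesis using t by (simp add: field_simps)
qed (use assms in auto)

text \<open>The function \<^term>\<open>(v powr (1/b) + C * ln g + a) powr b\<close> is jointly concave in
  \<^term>\<open>(v, g)\<close> as soon as \<^term>\<open>C * ln g + a \<ge> b * C\<close>; this is its tangent plane.\<close>

lemma powr_log_tangent_plane:
  fixes v v0 g g0 C a b :: real
  assumes b: "b \<ge> 1" and v: "v \<ge> 0" "v0 > 0" and g: "g > 0" "g0 > 0" and C: "C > 0"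
    and b0: "C * ln g0 + a \<ge> b * C" and b1: "C * ln g + a \<ge> 0"
  defines "f0 \<equiv> v0 powr (1/b) + (C * ln g0 + a)"
  shows "(v powr (1/b) + (C * ln g + a)) powr b
      \<le> f0 powr (b - 1) * (v0 powr (1/b - 1) * v + (C * ln g0 + a) + b * C * (g / g0 - 1))"
proof -
  define x where "x = v powr (1/b)"
  define x0 where "x0 = v0 powr (1/b)"
  define y where "y = C * ln g + a"
  define y0 where "y0 = C * ln g0 + a"
  have x: "x \<ge> 0" and x0: "x0 > 0" using v by (auto simp: x_def x0_def)
  have y: "y \<ge> 0" using b1 by (simp add: y_def)
  have "b * C > 0" using b C by simp
  then have y0: "y0 > 0" using b0 by (simp add: y0_def)
  have f0: "f0 = x0 + y0" by (simp add: f0_def x0_def y0_def)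
  have f0p: "f0 > 0" using x0 y0 f0 by simp
  have "(x + y) powr b \<le> f0 powr b * ((y0 / f0) * (y / y0) powr b + (x0 / f0) * (x / x0) powr b)"
  proof (cases "x + y = 0")
    case True
    then have "x = 0" "y = 0" using x y by auto
    then show ?thesis by simp
  next
    case False
    \<comment> \<open>Jensen by hand: \<open>s\<close> is the mean of \<open>y / y0\<close> and
      \<open>x / x0\<close> with weights \<open>y0 / f0\<close> and \<open>x0 / f0\<close>, and the
      tangent of \<open>powr b\<close> at \<open>s\<close> lies below both values.\<close>
    define s where "s = (x + y) / f0"
    have s: "s > 0" using False x y f0p by (simp add: s_def)
    define d where "d = b * s powr (b - 1)"
    have "s powr b = (y0/f0 + x0/f0) * s powr b + d * ((y + x)/f0 - s * (y0/f0 + x0/f0))"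
      using f0 f0p by (simp add: s_def add_divide_distrib[symmetric] add.commute)
    also have "\<dots> = (y0 / f0) * (s powr b + d * (y / y0 - s)) + (x0 / f0) * (s powr b + d * (x / x0 - s))"
      using f0p x0 y0 by (simp add: field_simps)
    also have "\<dots> \<le> (y0 / f0) * (y / y0) powr b + (x0 / f0) * (x / x0) powr b"
      unfolding d_def using f0p x0 y0 x y s b
      by (intro add_mono mult_left_mono powr_tangent_ge) auto
    finally have "s powr b \<le> \<dots>" .
    then have "f0 powr b * s powr b \<le> f0 powr b * \<dots>" by (intro mult_left_mono) auto
    also have "f0 powr b * s powr b = (x + y) powr b"
      using f0p x y by (simp add: s_def powr_divide)
    finally show ?thesis .
  qed
  also have "\<dots> = f0 powr (b-1) * (y0 * (y / y0) powr b + x0 * (x / x0) powr b)"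
    using f0p by (simp add: powr_diff field_simps)
  also have "\<dots> \<le> f0 powr (b-1) * ((y0 + b * C * (g / g0 - 1)) + v0 powr (1/b - 1) * v)"
  proof (intro mult_left_mono add_mono)
    have "(x / x0) powr b = v / v0"
      using v b by (simp add: x_def x0_def powr_divide powr_powr)
    then have "x0 * (x / x0) powr b = v0 powr (1/b) * v / v0" by (simp add: x0_def)
    also have "\<dots> = v0 powr (1/b - 1) * v" using v by (simp add: powr_diff)
    finally show "x0 * (x / x0) powr b \<le> v0 powr (1/b - 1) * v" by simp
    show "y0 * (y / y0) powr b \<le> y0 + b * C * (g / g0 - 1)"
    proof -
      \<comment> \<open>The logarithm turns \<open>exp e\<close> into a power of
        \<open>g / g0\<close>. Its exponent after raising to \<open>b\<close> is
        \<open>b * C / y0\<close>, which \<open>b0\<close> keeps at most 1, so that concavity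
        applies.\<close>
      define e where "e = C * ln (g/g0) / y0"
      have ey: "y / y0 = 1 + e" using y0 g by (simp add: e_def y_def y0_def field_simps ln_div)
      have ge: "0 \<le> 1 + e" using ey y y0 by (metis divide_nonneg_pos)
      have "(1 + e) powr b \<le> exp e powr b"
        by (rule powr_mono2) (use ge b exp_ge_add_one_self[of e] in auto)
      also have "exp e powr b = (g/g0) powr (b * C / y0)"
        using g by (simp add: powr_def e_def ac_simps)
      also have "\<dots> \<le> 1 + (b * C / y0) * (g/g0 - 1)"
        by (rule powr_le_tangent) (use b C y0 b0 g in \<open>auto simp: y0_def\<close>)
      finally have "y0 * (y / y0) powr b \<le> y0 * (1 + (b * C / y0) * (g/g0 - 1))"
        using y0 unfolding ey by (intro mult_left_mono) auto
      also have "\<dots> = y0 + b * C * (g / g0 - 1)" using y0 by (simp add: field_simps)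
      finally show ?thesis .
    qed
  qed auto
  finally show ?thesis by (simp add: x_def y_def y0_def algebra_simps)
qed

text \<open>Stands for integration against a measure of total mass \<open>\<epsilon>\<close>. Finite
  additivity, monotonicity and the mass suffice for a minorizing functional, since no limit is ever
  taken inside it.\<close>

definition functional_of_mass :: "'a measure \<Rightarrow> real \<Rightarrow> (('a \<Rightarrow> ennreal) \<Rightarrow> ennreal) \<Rightarrow> bool" where
  "functional_of_mass S \<epsilon> \<nu> \<longleftrightarrow>
     (\<forall>f\<in>borel_measurable S. \<forall>g\<in>borel_measurable S. \<nu> (\<lambda>y. f y + g y) = \<nu> f + \<nu> g) \<and>
     (\<forall>f\<in>borel_measurable S. \<forall>g\<in>borel_measurable S. (\<forall>y\<in>space S. f y \<le> g y) \<longrightarrow> \<nu> f \<le> \<nu> g) \<and>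
     (\<forall>c. \<nu> (\<lambda>_. c) = ennreal \<epsilon> * c)"

text \<open>Abstract form of averaging against a Markov kernel. Values in \<open>ennreal\<close>
  avoid all integrability conditions and allow \<open>\<top>\<close> as a marker for forbidden
  states; continuity along monotone sequences is not part of the interface.\<close>

locale markov_operator =
  fixes S :: "'a measure" and T :: "('a \<Rightarrow> ennreal) \<Rightarrow> 'a \<Rightarrow> ennreal"
  assumes meas[measurable]: "f \<in> borel_measurable S \<Longrightarrow> T f \<in> borel_measurable S"
    and add: "\<lbrakk>f \<in> borel_measurable S; g \<in> borel_measurable S; x \<in> space S\<rbrakk>
      \<Longrightarrow> T (\<lambda>y. f y + g y) x = T f x + T g x"
    and cmult: "\<lbrakk>f \<in> borel_measurable S; x \<in> space S\<rbrakk> \<Longrightarrow> T (\<lambda>y. c * f y) x = c * T f x"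
    and mono: "\<lbrakk>f \<in> borel_measurable S; g \<in> borel_measurable S; \<And>y. y \<in> space S \<Longrightarrow> f y \<le> g y;
      x \<in> space S\<rbrakk> \<Longrightarrow> T f x \<le> T g x"
    and one: "x \<in> space S \<Longrightarrow> T (\<lambda>_. 1) x = 1"
begin

lemma const: "x \<in> space S \<Longrightarrow> T (\<lambda>_. c) x = c"
  using cmult[of "\<lambda>_. 1" x c] one by simp

lemma iterate: "markov_operator S (T ^^ n)"
proof (induction n)
  case 0
  show ?case by unfold_locales auto
next
  case (Suc n)
  then interpret n: markov_operator S "T ^^ n" .
  show ?case
  proof unfold_locales
    fix f g :: "'a \<Rightarrow> ennreal" and x and c :: ennreal
    assume f[measurable]: "f \<in> borel_measurable S"
    show "(T ^^ Suc n) f \<in> borel_measurable S" by simp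
    assume x: "x \<in> space S"
    have "(T ^^ Suc n) (\<lambda>y. c * f y) x = T (\<lambda>y. c * (T ^^ n) f y) x"
      using x n.cmult[OF f, of _ c] by (auto intro!: antisym mono simp: n.meas)
    then show "(T ^^ Suc n) (\<lambda>y. c * f y) x = c * (T ^^ Suc n) f x"
      by (simp add: cmult x)
    assume g[measurable]: "g \<in> borel_measurable S"
    have "(T ^^ Suc n) (\<lambda>y. f y + g y) x = T (\<lambda>y. (T ^^ n) f y + (T ^^ n) g y) x"
      using x n.add[OF f g] by (auto intro!: antisym mono simp: n.meas)
    then show "(T ^^ Suc n) (\<lambda>y. f y + g y) x = (T ^^ Suc n) f x + (T ^^ Suc n) g x"
      by (simp add: add x)
    assume "\<And>y. y \<in> space S \<Longrightarrow> f y \<le> g y"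
    then show "(T ^^ Suc n) f x \<le> (T ^^ Suc n) g x"
      using x by (auto intro!: mono n.mono)
  next
    fix x assume x: "x \<in> space S"
    have "(T ^^ Suc n) (\<lambda>_. 1) x = T (\<lambda>_. 1) x"
      using x n.one by (auto intro!: antisym mono)
    then show "(T ^^ Suc n) (\<lambda>_. 1) x = 1" by (simp add: one x)
  qed
qed

lemma iterate_meas[measurable]:
  "f \<in> borel_measurable S \<Longrightarrow> (T ^^ n) f \<in> borel_measurable S"
  using markov_operator.meas[OF iterate] .

text \<open>The bound separates into a part in \<open>x\<close> and a part in \<open>y\<close>, so
  \<open>T\<close> can be applied in \<open>x\<close> with the other point frozen, and then in
  \<open>y\<close>. This is what an independent coupling would give.\<close>

lemma contract:
  assumes [measurable]: "z \<in> borel_measurable S" "U \<in> borel_measurable S"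
    and le: "\<And>x y. x \<in> space S \<Longrightarrow> y \<in> space S \<Longrightarrow> z x \<le> z y + P + U x + U y"
    and x: "x \<in> space S" and y: "y \<in> space S"
  shows "T z x \<le> T z y + P + T U x + T U y"
proof -
  have 1: "T z x \<le> (z y' + P + U y') + T U x" if y': "y' \<in> space S" for y'
  proof -
    have "T z x \<le> T (\<lambda>x'. (z y' + P + U y') + U x') x"
      by (rule mono) (use le y' x in \<open>auto simp: ac_simps\<close>)
    then show ?thesis using x by (simp add: add const)
  qed
  have "T z x = T (\<lambda>_. T z x) y" using y by (simp add: const)
  also have "\<dots> \<le> T (\<lambda>y'. (z y' + U y') + (P + T U x)) y"
    by (rule mono) (use 1 y in \<open>auto simp: ac_simps\<close>)
  also have "\<dots> = T z y + T U y + (P + T U x)" using y by (simp add: add const)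
  finally show ?thesis by (simp add: ac_simps)
qed

text \<open>A dual version of coupling on a common component: \<open>P + s + U - z\<close> and
  \<open>z + U - s\<close> are both nonnegative, the minorization bounds the first from below at
  \<open>x\<close> and the second at \<open>y\<close>, and in the sum of the two bounds
  \<open>\<nu> z\<close> cancels while \<open>\<epsilon> * P\<close> survives. The bound
  \<open>z \<le> 1\<close> keeps the cancelled quantities finite.\<close>

lemma contract_minorized:
  assumes zm[measurable]: "z \<in> borel_measurable S" and um[measurable]: "U \<in> borel_measurable S"
    and z1: "\<And>x. x \<in> space S \<Longrightarrow> z x \<le> 1"
    and le: "\<And>x y. x \<in> space S \<Longrightarrow> y \<in> space S \<Longrightarrow> z x \<le> z y + ennreal P + U x + U y"
    and P: "P \<ge> 0"
    and x: "x \<in> space S" and y: "y \<in> space S"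
    and nu: "functional_of_mass S \<epsilon> \<nu>" and eps: "0 \<le> \<epsilon>"
    and nux: "\<And>f. f \<in> borel_measurable S \<Longrightarrow> \<nu> f \<le> T f x"
    and nuy: "\<And>f. f \<in> borel_measurable S \<Longrightarrow> \<nu> f \<le> T f y"
  shows "T z x + ennreal (\<epsilon> * P) \<le> T z y + ennreal P + T U x + T U y"
proof (cases "T U x = \<top> \<or> T U y = \<top>")
  case False
  then have fin: "T U x < \<top>" "T U y < \<top>" by (auto simp: top.not_eq_extremum)
  \<comment> \<open>Guarantees that the infimum \<open>s\<close> below is finite.\<close>
  have "\<exists>x0\<in>space S. U x0 < \<top>"
  proof (rule ccontr)
    assume "\<not> ?thesis"
    then have "\<And>x0. x0 \<in> space S \<Longrightarrow> U x0 = \<top>" using top.not_eq_extremum by blast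
    then have "T (\<lambda>_. \<top>) x \<le> T U x" using x by (intro mono) auto
    then show False using x fin by (simp add: const top_unique)
  qed
  then obtain x0 where x0: "x0 \<in> space S" "U x0 < \<top>" by blast
  \<comment> \<open>The largest constant for which \<open>z + U - s\<close> is nonnegative; the
    hypothesis \<open>le\<close> says exactly that it also makes \<open>P + s + U - z\<close>
    nonnegative.\<close>
  define s where "s = (INF y\<in>space S. z y + U y)"
  have "s \<le> z x0 + U x0" unfolding s_def by (rule INF_lower[OF x0(1)])
  also have "\<dots> < \<top>" using x0 order_le_less_trans[OF z1[OF x0(1)] ennreal_one_less_top] by simp
  finally have s_fin: "s < \<top>" .
  define f1 where "f1 = (\<lambda>y. (ennreal P + s + U y) - z y)"
  define f2 where "f2 = (\<lambda>y. (z y + U y) - s)"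
  have [measurable]: "f1 \<in> borel_measurable S" "f2 \<in> borel_measurable S"
    unfolding f1_def f2_def by measurable
  have zle: "z x' \<le> ennreal P + s + U x'" if "x' \<in> space S" for x'
  proof -
    have "z x' - (ennreal P + U x') \<le> s"
      unfolding s_def
    proof (rule INF_greatest)
      fix y' assume "y' \<in> space S"
      then have "z x' \<le> (ennreal P + U x') + (z y' + U y')"
        using le[OF that, of y'] by (simp add: ac_simps)
      then show "z x' - (ennreal P + U x') \<le> z y' + U y'"
        using order_le_less_trans[OF z1[OF that] ennreal_one_less_top]
        by (auto simp: ennreal_minus_le_iff)
    qed
    then show ?thesis
      by (metis (no_types) ennreal_minus_le_iff add.assoc add.commute ennreal_add_eq_top top_greatest)
  qed
  have e1: "f1 x' + z x' = ennreal P + s + U x'" if "x' \<in> space S" for x'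
    unfolding f1_def using zle[OF that] by (simp add: diff_add_cancel_ennreal)
  have e2: "f2 x' + s = z x' + U x'" if "x' \<in> space S" for x'
    unfolding f2_def s_def using INF_lower[OF that, of "\<lambda>y. z y + U y"] by (simp add: diff_add_cancel_ennreal)
  have cong: "T f w = T g w" if "f \<in> borel_measurable S" "g \<in> borel_measurable S"
      "\<And>y. y \<in> space S \<Longrightarrow> f y = g y" "w \<in> space S" for f g w
    using that by (intro antisym mono) auto
  have A1: "T f1 x + T z x = ennreal P + s + T U x"
  proof -
    have "T f1 x + T z x = T (\<lambda>y. f1 y + z y) x" using x by (simp add: add)
    also have "\<dots> = T (\<lambda>y. (ennreal P + s) + U y) x" by (rule cong) (use e1 x in auto)
    finally show ?thesis using x by (simp add: add const)
  qed
  have A2: "T f2 y + s = T z y + T U y"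
  proof -
    have "T f2 y + s = T (\<lambda>y. f2 y + s) y" using y by (simp add: add const)
    also have "\<dots> = T (\<lambda>y. z y + U y) y" by (rule cong) (use e2 y in auto)
    finally show ?thesis using y by (simp add: add)
  qed
  have nu_add: "\<nu> (\<lambda>y. f y + g y) = \<nu> f + \<nu> g" if "f \<in> borel_measurable S" "g \<in> borel_measurable S" for f g
    using nu that by (simp add: functional_of_mass_def)
  have nu_const: "\<nu> (\<lambda>_. c) = ennreal \<epsilon> * c" for c
    using nu by (simp add: functional_of_mass_def)
  have nu_cong: "\<nu> f = \<nu> g" if "f \<in> borel_measurable S" "g \<in> borel_measurable S"
      "\<And>y. y \<in> space S \<Longrightarrow> f y = g y" for f g
    using nu that by (intro antisym) (auto simp: functional_of_mass_def)
  have B1: "\<nu> f1 + \<nu> z = ennreal \<epsilon> * (ennreal P + s) + \<nu> U"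
  proof -
    have "\<nu> f1 + \<nu> z = \<nu> (\<lambda>y. f1 y + z y)" by (simp add: nu_add)
    also have "\<dots> = \<nu> (\<lambda>y. (ennreal P + s) + U y)" by (rule nu_cong) (use e1 in auto)
    finally show ?thesis by (simp add: nu_add nu_const)
  qed
  have B2: "\<nu> f2 + ennreal \<epsilon> * s = \<nu> z + \<nu> U"
  proof -
    have "\<nu> f2 + ennreal \<epsilon> * s = \<nu> (\<lambda>y. f2 y + s)" by (simp add: nu_add nu_const)
    also have "\<dots> = \<nu> (\<lambda>y. z y + U y)" by (rule nu_cong) (use e2 in auto)
    finally show ?thesis by (simp add: nu_add)
  qed
  have Tz: "T z w < \<top>" if "w \<in> space S" for w
  proof -
    have "T z w \<le> T (\<lambda>_. 1) w" using z1 that by (intro mono) auto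
    then show ?thesis using that by (simp add: const order_le_less_trans)
  qed
  have fin1: "T f1 x < \<top>"
    using A1 fin s_fin by (metis ennreal_add_less_top ennreal_less_top infinity_ennreal_def)
  have fin2: "T f2 y < \<top>"
    using A2 fin Tz[OF y] by (metis ennreal_add_less_top)
  have fin3: "\<nu> f1 < \<top>" "\<nu> f2 < \<top>" "\<nu> z < \<top>" "\<nu> U < \<top>"
    using nux[of f1] nuy[of f2] nux[of z] nux[of U] fin1 fin2 fin Tz[OF x] by (auto intro: order_le_less_trans)
  have real: "\<exists>r\<ge>0. u = ennreal r" if "u < \<top>" for u
    using that by (intro exI[of _ "enn2real u"]) auto
  obtain a1 where a1: "T f1 x = ennreal a1" "a1 \<ge> 0" using real[OF fin1] by blast
  obtain a2 where a2: "T f2 y = ennreal a2" "a2 \<ge> 0" using real[OF fin2] by blast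
  obtain b1 where b1: "T z x = ennreal b1" "b1 \<ge> 0" using real[OF Tz[OF x]] by blast
  obtain b2 where b2: "T z y = ennreal b2" "b2 \<ge> 0" using real[OF Tz[OF y]] by blast
  obtain n1 where n1: "\<nu> f1 = ennreal n1" "n1 \<ge> 0" using real[OF fin3(1)] by blast
  obtain n2 where n2: "\<nu> f2 = ennreal n2" "n2 \<ge> 0" using real[OF fin3(2)] by blast
  obtain s' where s': "s = ennreal s'" "s' \<ge> 0" using real[OF s_fin] by blast
  obtain u1 where u1: "T U x = ennreal u1" "u1 \<ge> 0" using real[OF fin(1)] by blast
  obtain u2 where u2: "T U y = ennreal u2" "u2 \<ge> 0" using real[OF fin(2)] by blast
  obtain nz where nz: "\<nu> z = ennreal nz" "nz \<ge> 0" using real[OF fin3(3)] by blast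
  obtain nU where nU: "\<nu> U = ennreal nU" "nU \<ge> 0" using real[OF fin3(4)] by blast
  note eqs = a1(1) a2(1) b1(1) b2(1) n1(1) n2(1) s'(1) u1(1) u2(1) nz(1) nU(1)
  note nn = a1(2) a2(2) b1(2) b2(2) n1(2) n2(2) s'(2) u1(2) u2(2) nz(2) nU(2)
  have "a1 + b1 = P + s' + u1"
    using A1 nn P unfolding eqs by (simp flip: ennreal_plus)
  moreover have "a2 + s' = b2 + u2"
    using A2 nn P unfolding eqs by (simp flip: ennreal_plus)
  moreover have "n1 + nz = \<epsilon> * (P + s') + nU"
    using B1 nn P eps unfolding eqs by (simp flip: ennreal_plus ennreal_mult)
  moreover have "n2 + \<epsilon> * s' = nz + nU"
    using B2 nn P eps unfolding eqs by (simp flip: ennreal_plus ennreal_mult)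
  moreover have "n1 \<le> a1" "n2 \<le> a2"
    using nux[of f1] nuy[of f2] nn unfolding eqs by auto
  \<comment> \<open>Adding the two lower bounds cancels \<open>nz\<close> and
    \<open>\<epsilon> * s'\<close>; a remainder of twice \<open>nU\<close> is nonnegative and is
    discarded.\<close>
  ultimately have "b1 + \<epsilon> * P \<le> b2 + P + u1 + u2" using nn by (simp add: algebra_simps)
  then show ?thesis unfolding eqs using nn P eps by (simp flip: ennreal_plus)
qed auto

end

section \<open>Subgeometric drift, minorization and the resulting polynomial contraction\<close>

lemma powr_sum3_le:
  fixes a b c p :: real
  assumes "a \<ge> 0" "b \<ge> 0" "c \<ge> 0" "p \<ge> 0"
  shows "(a + b + c) powr p \<le> 3 powr p * (a powr p + b powr p + c powr p)"
proof -
  define m where "m = Max {a, b, c}"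
  have m: "a \<le> m" "b \<le> m" "c \<le> m" "m \<in> {a, b, c}"
    unfolding m_def using Max_in[of "{a, b, c}"] by (auto simp del: Max_insert intro: Max_ge)
  have "(a + b + c) powr p \<le> (3 * m) powr p"
    using m assms by (intro powr_mono2) auto
  also have "\<dots> = 3 powr p * m powr p"
    using m assms by (subst powr_mult) auto
  also have "\<dots> \<le> 3 powr p * (a powr p + b powr p + c powr p)"
    using m(4) by (intro mult_left_mono) auto
  finally show ?thesis .
qed

text \<open>The power \<open>1 - 1/\<beta>\<close> is the one for which
  \<open>V powr (1/\<beta>)\<close> decreases at constant speed. Since \<open>V\<close> is read as
  \<open>\<top>\<close> off \<open>\<Omega>\<close>, \<open>drift_V\<close> also says that
  \<open>T\<close> gives no weight to the complement of \<open>\<Omega>\<close>. In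
  \<open>drift_W\<close> and \<open>minorization\<close> the level \<open>R\<close> is free, so
  \<open>\<rho>\<close>, \<open>\<epsilon>\<close> and \<open>\<nu>\<close> may depend on
  it.\<close>

locale subgeometric_drift = markov_operator +
  fixes \<Omega> :: "'a set" and V W :: "'a \<Rightarrow> real" and \<beta> c b d :: real
  assumes Omega_sub: "\<Omega> \<subseteq> space S"
    and V_meas: "(\<lambda>x. if x \<in> \<Omega> then ennreal (V x) else \<top>) \<in> borel_measurable S"
    and W_meas: "(\<lambda>x. ennreal (W x)) \<in> borel_measurable S"
    and V_ge_1: "x \<in> \<Omega> \<Longrightarrow> V x \<ge> 1"
    and W_ge_0: "x \<in> \<Omega> \<Longrightarrow> W x \<ge> 0"
    and beta: "\<beta> > 1" and c: "c > 0" and b: "b \<ge> 0" and d: "d \<ge> 0"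
    and drift_V: "x \<in> \<Omega> \<Longrightarrow> T (\<lambda>x. if x \<in> \<Omega> then ennreal (V x) else \<top>) x
      \<le> ennreal (V x - c * V x powr (1 - 1/\<beta>) + b)"
    and growth_W: "x \<in> \<Omega> \<Longrightarrow> T (\<lambda>x. ennreal (W x)) x \<le> ennreal (W x + d)"
    and drift_W: "\<exists>\<rho>>0. \<rho> \<le> 1 \<and> (\<forall>x\<in>\<Omega>. V x \<le> R \<longrightarrow>
      T (\<lambda>x. ennreal (W x)) x \<le> ennreal ((1 - \<rho>) * W x + d))"
    and minorization: "\<exists>\<epsilon>>0. \<exists>\<nu>. functional_of_mass S \<epsilon> \<nu> \<and>
      (\<forall>x\<in>\<Omega>. V x \<le> R \<longrightarrow> W x \<le> R \<longrightarrow> (\<forall>f\<in>borel_measurable S. \<nu> f \<le> T f x))"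
begin

abbreviation Vinf :: "'a \<Rightarrow> ennreal" where
  "Vinf \<equiv> \<lambda>x. if x \<in> \<Omega> then ennreal (V x) else \<top>"

text \<open>The contraction runs along the weights \<^term>\<open>F k x y powr \<beta>\<close>, where
  \<open>F\<^sub>k = (V x + V y)\<^bsup>1/\<beta>\<^esup> + C ln (G x + G y) + A + ck\<close> and \<open>G = W + g\<close>; the quantity \<open>F\<^sub>0\<close> is, up to constants,
  an upper bound for the time that two copies of the chain need to meet.\<close>

theorem polynomial_contraction:
  obtains C where "C \<ge> 0" "\<And>n z x y. z \<in> borel_measurable S \<Longrightarrow> (\<And>x. x \<in> space S \<Longrightarrow> z x \<le> 1) \<Longrightarrow> x \<in> \<Omega> \<Longrightarrow> y \<in> \<Omega> \<Longrightarrow>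
    (T ^^ n) z x \<le> (T ^^ n) z y + ennreal (C * (1 + V x + W x + V y + W y) * (real n + 1) powr (- \<beta>))"
proof -
  define \<kappa> where "\<kappa> = 1 - 1/\<beta>"
  have kap: "0 < \<kappa>" "\<kappa> < 1" using beta by (auto simp: \<kappa>_def)
  have kap': "1/\<beta> - 1 = - \<kappa>" by (simp add: \<kappa>_def)
  \<comment> \<open>Above \<open>R\<close> the two constants \<open>b\<close>, scaled by the slope
    \<open>v powr (- \<kappa>)\<close> of the weight in \<open>V\<close>, use up at most half of
    \<open>c\<close>.\<close>
  define R where "R = 2 + (4 * b / c) powr (1 / \<kappa>)"
  have R2: "R \<ge> 2" by (simp add: R_def)
  have Rp: "2 * b * v powr (- \<kappa>) \<le> c / 2" if "v \<ge> R" for v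
  proof -
    have v: "v > 0" using that R2 by simp
    have "4 * b / c = ((4 * b / c) powr (1 / \<kappa>)) powr \<kappa>" using kap b c by (simp add: powr_powr)
    also have "\<dots> \<le> v powr \<kappa>" using that kap by (intro powr_mono2) (auto simp: R_def)
    finally have "4 * b / c \<le> v powr \<kappa>" .
    then show ?thesis using v c by (simp add: powr_minus field_simps)
  qed
  obtain \<rho> where rho: "\<rho> > 0" "\<rho> \<le> 1" and rhoW: "\<And>x. x \<in> \<Omega> \<Longrightarrow> V x \<le> R \<Longrightarrow>
      T (\<lambda>x. ennreal (W x)) x \<le> ennreal ((1 - \<rho>) * W x + d)"
    using drift_W[of R] by blast
  \<comment> \<open>\<open>F\<close> is to fall by \<open>h\<close> per step, which costs
    \<open>\<beta> * h = c / 4\<close>. Of the rest of \<open>c\<close>, one half is reserved for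
    \<open>b\<close> and one quarter for the growth of \<open>W\<close>.\<close>
  define h where "h = c / (4 * \<beta>)"
  have h: "h > 0" using c beta by (simp add: h_def)
  \<comment> \<open>Where \<open>V\<close> is bounded and \<open>W\<close> is large, the halved
    contraction rate \<open>\<rho> / 2\<close>, multiplied by \<open>\<beta> * C\<close>, has to pay
    for \<open>2 * b\<close> and \<open>\<beta> * h\<close>.\<close>
  define C where "C = 2 * (2 * b + \<beta> * h + 1) / (\<beta> * \<rho>)"
  have C: "C > 0" using b beta h rho by (auto simp: C_def intro!: divide_pos_pos mult_pos_pos add_nonneg_pos)
  have C': "2 * b + \<beta> * h \<le> \<beta> * C * \<rho> / 2" using rho beta by (simp add: C_def)
  \<comment> \<open>The summand \<open>exp \<beta>\<close> ensures
    \<open>ln g0 \<ge> \<beta>\<close>, the condition for the tangent plane to dominate the weight;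
    the next one makes the growth \<open>d\<close> of \<open>W\<close> cost at most
    \<open>c / 4\<close>.\<close>
  define g where "g = exp \<beta> + 4 * \<beta> * C * d / c + 1"
  have g: "g \<ge> exp \<beta>" "g \<ge> 1" using C d c beta by (auto simp: g_def)
  have g': "\<beta> * C * (2 * d) / (2 * g) \<le> c / 4"
  proof -
    have "4 * \<beta> * C * d / c \<le> g" by (simp add: g_def)
    then show ?thesis using c g by (simp add: field_simps)
  qed
  \<comment> \<open>Once \<open>G x + G y\<close> reaches \<open>R'\<close>, the additive terms
    \<open>2 * \<rho> * g + 2 * d\<close> use up at most half of the relative gain
    \<open>\<rho>\<close>.\<close>
  define R' where "R' = 2 * (2 * \<rho> * g + 2 * d) / \<rho>"
  have R'0: "R' \<ge> 0" using rho g d by (simp add: R'_def)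
  define Rm where "Rm = max R R'"
  obtain \<epsilon> \<nu> where eps: "\<epsilon> > 0" and nu: "functional_of_mass S \<epsilon> \<nu>" and nule:
      "\<And>x f. x \<in> \<Omega> \<Longrightarrow> V x \<le> Rm \<Longrightarrow> W x \<le> Rm \<Longrightarrow> f \<in> borel_measurable S \<Longrightarrow> \<nu> f \<le> T f x"
    using minorization[of Rm] by blast
  define B where "B = 2 * b + \<beta> * C * d"
  have B: "B \<ge> 0" using b beta C d by (simp add: B_def)
  \<comment> \<open>Where \<open>V\<close> and \<open>W\<close> are both bounded, the minorization
    gain \<open>\<epsilon> * A\<close> is made to pay for \<open>B\<close>, which collects the
    increments of both drifts, and for \<open>\<beta> * h\<close>.\<close>
  define A where "A = (B + \<beta> * h) / \<epsilon> + 1"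
  have A: "A \<ge> 0" "\<epsilon> * A \<ge> B + \<beta> * h" using B beta h eps by (auto simp: A_def field_simps)
  define G where "G x = W x + g" for x
  define F where "F k x y = (V x + V y) powr (1/\<beta>) + (C * ln (G x + G y) + (A + h * real k))" for k x y
  have Fpos: "F k x y \<ge> h * real k" "F k x y \<ge> A" "F k x y > 0" if "x \<in> \<Omega>" "y \<in> \<Omega>" for k x y
  proof -
    have "G x + G y \<ge> 1" using W_ge_0[of x] W_ge_0[of y] that g by (simp add: G_def)
    then have *: "C * ln (G x + G y) \<ge> 0" using C by simp
    have "(V x + V y) powr (1/\<beta>) > 0" using V_ge_1[of x] V_ge_1[of y] that by simp
    with * A(1) h show "F k x y \<ge> h * real k" "F k x y \<ge> A" "F k x y > 0"
      by (auto simp: F_def intro!: add_nonneg_nonneg add_pos_nonneg)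
  qed
  note [measurable] = V_meas W_meas
  have step: "T z x \<le> T z y + ennreal (l * F k x y powr \<beta>)"
    if z[measurable]: "z \<in> borel_measurable S" and z1: "\<And>x. x \<in> space S \<Longrightarrow> z x \<le> 1" and l: "l > 0"
      and zz: "\<And>x y. x \<in> \<Omega> \<Longrightarrow> y \<in> \<Omega> \<Longrightarrow> z x \<le> z y + ennreal (l * F (Suc k) x y powr \<beta>)"
      and x: "x \<in> \<Omega>" and y: "y \<in> \<Omega>" for z l k x y
  proof -
    define v0 where "v0 = V x + V y"
    define g0 where "g0 = G x + G y"
    define a where "a = A + h * real (Suc k)"
    define f0 where "f0 = v0 powr (1/\<beta>) + (C * ln g0 + a)"
    have f0F: "f0 = F (Suc k) x y" "F k x y = f0 - h"
      by (simp_all add: f0_def F_def v0_def g0_def a_def algebra_simps)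
    have xS: "x \<in> space S" and yS: "y \<in> space S" using x y Omega_sub by auto
    have a0: "a \<ge> 0" using A h by (simp add: a_def)
    have v0: "v0 \<ge> 2" using V_ge_1[OF x] V_ge_1[OF y] by (simp add: v0_def)
    have g0: "g0 \<ge> 2 * g" "g0 \<ge> exp \<beta>" "g0 \<ge> 2" using W_ge_0[OF x] W_ge_0[OF y] g by (auto simp: g0_def G_def)
    have lng0: "ln g0 \<ge> \<beta>" using g0 by (metis exp_gt_zero ln_exp ln_mono order_less_le_trans)
    have b0: "C * ln g0 + a \<ge> \<beta> * C" using lng0 C a0 by (simp add: mult.commute add_increasing2)
    \<comment> \<open>Constant term and slopes in \<open>V\<close> and in \<open>G\<close> of the
      tangent plane at \<open>(v0, g0)\<close>.\<close>
    define p where "p = f0 powr (\<beta> - 1) * (C * ln g0 + a - \<beta> * C)"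
    define qV where "qV = f0 powr (\<beta> - 1) * v0 powr (- \<kappa>)"
    define qG where "qG = f0 powr (\<beta> - 1) * (\<beta> * C / g0)"
    have f0p: "f0 > 0" using Fpos(3)[OF x y] f0F by simp
    have p: "p \<ge> 0" using b0 by (simp add: p_def)
    have qV: "qV > 0" using f0p v0 by (simp add: qV_def)
    have qG: "qG \<ge> 0" using g0 beta C by (simp add: qG_def)
    \<comment> \<open>One-copy part of the plane. As \<open>qV > 0\<close>, it is infinite off
      \<open>\<Omega>\<close>, so the inequality \<open>zU\<close> is trivial as soon as one of the
      two points lies outside.\<close>
    define U where "U w = ennreal (l * qV) * Vinf w + ennreal (l * qG) * (ennreal (W w) + ennreal g)" for w
    have U[measurable]: "U \<in> borel_measurable S" unfolding U_def by measurable
    have zU: "z x' \<le> z y' + ennreal (l * p) + U x' + U y'" if x': "x' \<in> space S" and y': "y' \<in> space S" for x' y'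
    proof (cases "x' \<in> \<Omega> \<and> y' \<in> \<Omega>")
      case True
      then have W0: "W x' \<ge> 0" "W y' \<ge> 0" and V1: "V x' \<ge> 1" "V y' \<ge> 1" using W_ge_0 V_ge_1 by auto
      have "F (Suc k) x' y' powr \<beta> \<le> f0 powr (\<beta> - 1) * (v0 powr (1/\<beta> - 1) * (V x' + V y') + (C * ln g0 + a)
          + \<beta> * C * ((G x' + G y') / g0 - 1))"
        unfolding F_def f0_def a_def[symmetric]
      proof (rule powr_log_tangent_plane)
        have "G x' + G y' \<ge> 1" using W0 g by (simp add: G_def)
        then show "C * ln (G x' + G y') + a \<ge> 0" "G x' + G y' > 0" using C a0 by auto
      qed (use beta V1 v0 g0 C b0 in auto)
      also have "\<dots> = p + qV * (V x' + V y') + qG * (G x' + G y')"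
        using g0 unfolding kap' by (simp add: p_def qV_def qG_def field_simps)
      finally have "l * F (Suc k) x' y' powr \<beta> \<le> l * (p + qV * (V x' + V y') + qG * (G x' + G y'))"
        using l by (intro mult_left_mono) auto
      also have "\<dots> = l * p + (l * qV * V x' + l * qG * (W x' + g)) + (l * qV * V y' + l * qG * (W y' + g))"
        by (simp add: G_def algebra_simps)
      finally have "ennreal (l * F (Suc k) x' y' powr \<beta>) \<le> ennreal \<dots>" by (rule ennreal_leI)
      also have "\<dots> = ennreal (l * p) + U x' + U y'"
        using True l p qV qG W0 V1 g
        by (simp add: U_def flip: ennreal_plus ennreal_mult)
      finally show ?thesis using zz[of x' y'] True
        by (metis (no_types, lifting) add.assoc add_left_mono order_trans)
    next
      case False
      then have "U x' = \<top> \<or> U y' = \<top>" using l qV by (auto simp: U_def ennreal_mult_top)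
      then show ?thesis by auto
    qed
    have TU: "T U w = ennreal (l * qV) * T Vinf w + ennreal (l * qG) * (T (\<lambda>x. ennreal (W x)) w + ennreal g)"
      if "w \<in> space S" for w
      unfolding U_def using that by (simp add: add cmult const)
    define EV where "EV w = V w - c * V w powr \<kappa> + b" for w
    have EV: "T Vinf w \<le> ennreal (EV w)" "EV w \<ge> 0" if w: "w \<in> \<Omega>" for w
    proof -
      show *: "T Vinf w \<le> ennreal (EV w)"
        using drift_V[OF w] by (simp add: EV_def \<kappa>_def)
      have "1 = T (\<lambda>_. 1) w" using one[of w] w Omega_sub by auto
      also have "\<dots> \<le> T Vinf w"
        using w Omega_sub V_ge_1 by (intro mono) (auto simp flip: ennreal_1 intro!: ennreal_leI)
      finally have "1 \<le> ennreal (EV w)" using * by (rule order_trans)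
      then show "EV w \<ge> 0" using ennreal_neg[of "EV w"] by (cases "EV w \<ge> 0") auto
    qed
    \<comment> \<open>The two drifts add up because concave powers are subadditive:
      \<open>v0 powr \<kappa> \<le> V x powr \<kappa> + V y powr \<kappa>\<close>.\<close>
    have EVsum: "EV x + EV y \<le> v0 - c * v0 powr \<kappa> + 2 * b"
    proof -
      have *: "v * v0 powr (\<kappa> - 1) \<le> v powr \<kappa>" if "v \<ge> 1" "v \<le> v0" for v
      proof -
        have "v * v0 powr (\<kappa> - 1) \<le> v * v powr (\<kappa> - 1)"
          using that kap by (intro mult_left_mono powr_mono2') auto
        then show ?thesis using that by (simp add: powr_diff)
      qed
      have "v0 powr \<kappa> = V x * v0 powr (\<kappa> - 1) + V y * v0 powr (\<kappa> - 1)"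
        using v0 by (simp add: powr_diff add_divide_distrib[symmetric] ring_distribs(2)[symmetric] flip: v0_def)
      also have "\<dots> \<le> V x powr \<kappa> + V y powr \<kappa>"
        using V_ge_1[OF x] V_ge_1[OF y] by (intro add_mono *) (auto simp: v0_def)
      finally have "c * v0 powr \<kappa> \<le> c * (V x powr \<kappa> + V y powr \<kappa>)" using c by (intro mult_left_mono) auto
      then show ?thesis by (simp add: EV_def v0_def algebra_simps)
    qed
    have TU_le: "T U w \<le> ennreal (l * qV * EV w + l * qG * (e + g))"
      if w: "w \<in> \<Omega>" and e: "T (\<lambda>x. ennreal (W x)) w \<le> ennreal e" "e \<ge> 0" for w e
    proof -
      have "T U w \<le> ennreal (l * qV) * ennreal (EV w) + ennreal (l * qG) * (ennreal e + ennreal g)"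
        using w Omega_sub EV[OF w] e by (subst TU) (auto intro!: add_mono mult_left_mono)
      also have "\<dots> = ennreal (l * qV * EV w + l * qG * (e + g))"
        using EV[OF w] e g l qV qG by (simp flip: ennreal_plus ennreal_mult)
      finally show ?thesis .
    qed
    \<comment> \<open>Common end of the three cases below. \<open>ex\<close> and \<open>ey\<close>
      bound the averages of \<open>W\<close>, and \<open>e\<close> is the minorized mass, put to 0
      when minorization is not invoked. After division by \<open>f0 powr (\<beta> - 1)\<close>,
      \<open>neg\<close> collects every change of the plane and asks for a net loss of
      \<open>\<beta> * h\<close>.\<close>
    have final: "T z x \<le> T z y + ennreal (l * F k x y powr \<beta>)"
      if ex: "T (\<lambda>x. ennreal (W x)) x \<le> ennreal ex" "ex \<ge> 0"
        and ey: "T (\<lambda>x. ennreal (W x)) y \<le> ennreal ey" "ey \<ge> 0"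
        and e: "0 \<le> e" "e \<le> 1" "T z x + ennreal (e * (l * p)) \<le> T z y + ennreal (l * p) + T U x + T U y"
        and neg: "- (e * A) - c + 2 * b * v0 powr (- \<kappa>) + \<beta> * C * ((ex + ey + 2 * g) / g0 - 1) \<le> - (\<beta> * h)"
      for ex ey e
    proof -
      define t where "t = (1 - e) * p + qV * (EV x + EV y) + qG * (ex + ey + 2 * g)"
      have t0: "t \<ge> 0" using e p qV qG EV[OF x] EV[OF y] ex ey g by (simp add: t_def)
      have "T z x + ennreal (e * (l * p)) \<le> T z y + ennreal (l * p) + T U x + T U y" by (rule e)
      also have "\<dots> \<le> T z y + ennreal (l * p) + ennreal (l * qV * EV x + l * qG * (ex + g)) + ennreal (l * qV * EV y + l * qG * (ey + g))"
        using TU_le[OF x ex] TU_le[OF y ey] by (intro add_mono) auto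
      also have "\<dots> = (T z y + ennreal (l * t)) + ennreal (e * (l * p))"
      proof -
        have eq: "l * p + (l * qV * EV x + l * qG * (ex + g)) + (l * qV * EV y + l * qG * (ey + g)) = l * t + e * (l * p)"
          by (simp add: t_def algebra_simps)
        show ?thesis
          using l p qV qG EV[OF x] EV[OF y] ex ey g e t0
          by (simp add: add.assoc flip: ennreal_plus) (simp add: eq[symmetric] add.assoc)
      qed
      finally have "T z x \<le> T z y + ennreal (l * t)"
        by (simp add: ennreal_add_left_cancel_le add.commute[of _ "ennreal (e * (l * p))"])
      also have "t \<le> F k x y powr \<beta>"
      proof -
        have "t = f0 powr (\<beta> - 1) * ((1 - e) * (C * ln g0 + a - \<beta> * C) + v0 powr (- \<kappa>) * (EV x + EV y) + \<beta> * C * (ex + ey + 2 * g) / g0)"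
          by (simp add: t_def p_def qV_def qG_def algebra_simps)
        also have "\<dots> \<le> f0 powr (\<beta> - 1) * (f0 - \<beta> * h)"
        proof (rule mult_left_mono)
          have 1: "v0 powr (- \<kappa>) * (EV x + EV y) \<le> v0 powr (1/\<beta>) - c + 2 * b * v0 powr (- \<kappa>)"
          proof -
            have "v0 powr (- \<kappa>) * (EV x + EV y) \<le> v0 powr (- \<kappa>) * (v0 - c * v0 powr \<kappa> + 2 * b)"
              using EVsum by (intro mult_left_mono) auto
            also have "\<dots> = v0 powr (- \<kappa>) * v0 - c * (v0 powr (- \<kappa>) * v0 powr \<kappa>) + 2 * b * v0 powr (- \<kappa>)"
              by (simp add: algebra_simps)
            also have "v0 powr (- \<kappa>) * v0 = v0 powr (1/\<beta>)"
              using v0 by (simp add: powr_diff flip: kap')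
            also have "v0 powr (- \<kappa>) * v0 powr \<kappa> = 1" using v0 by (simp flip: powr_add)
            finally show ?thesis by simp
          qed
          have "e * A \<le> e * (C * ln g0 + a - \<beta> * C)"
          proof (rule mult_left_mono)
            have "C * ln g0 \<ge> \<beta> * C" using lng0 C by (simp add: mult.commute)
            moreover have "a \<ge> A" using h by (simp add: a_def)
            ultimately show "A \<le> C * ln g0 + a - \<beta> * C" by simp
          qed (use e in auto)
          with 1 neg show "(1 - e) * (C * ln g0 + a - \<beta> * C) + v0 powr (- \<kappa>) * (EV x + EV y) + \<beta> * C * (ex + ey + 2 * g) / g0
              \<le> f0 - \<beta> * h"
            by (simp add: f0_def algebra_simps)
        qed auto
        \<comment> \<open>This is the tangent of \<open>powr \<beta>\<close> at \<open>f0\<close>,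
          evaluated at \<open>F k x y = f0 - h\<close>; by convexity it lies below the new
          weight.\<close>
        also have "\<dots> = f0 powr \<beta> + \<beta> * f0 powr (\<beta> - 1) * (F k x y - f0)"
          using f0p by (simp add: f0F(2) powr_diff field_simps)
        also have "\<dots> \<le> F k x y powr \<beta>"
          using beta f0p Fpos(3)[OF x y, of k] by (intro powr_tangent_ge) auto
        finally show ?thesis .
      qed
      then have "ennreal (l * t) \<le> ennreal (l * F k x y powr \<beta>)"
        using l by (intro ennreal_leI mult_left_mono) auto
      finally show ?thesis by (simp add: add_left_mono)
    qed
    have ctr: "T z x + ennreal (0 * (l * p)) \<le> T z y + ennreal (l * p) + T U x + T U y"
      using contract[OF z U zU xS yS] by simp
    have Wx: "W x \<ge> 0" "W y \<ge> 0" using W_ge_0 x y by auto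
    have g0_eq: "g0 = W x + W y + 2 * g" by (simp add: g0_def G_def)
    have small_b: "2 * b * v0 powr (- \<kappa>) \<le> 2 * b"
      using b v0 kap powr_mono[of "- \<kappa>" 0 v0] by (intro mult_left_le) auto
    have up: "\<beta> * C * ((W x + d + (W y + d) + 2 * g) / g0 - 1) \<le> \<beta> * C * (2 * d) / (2 * g)"
    proof -
      have "(W x + d + (W y + d) + 2 * g) / g0 - 1 = 2 * d / g0"
        using g0 g0_eq by (simp add: field_simps)
      also have "\<dots> \<le> 2 * d / (2 * g)" using g0 g d by (intro divide_left_mono) auto
      finally have "\<beta> * C * ((W x + d + (W y + d) + 2 * g) / g0 - 1) \<le> \<beta> * C * (2 * d / (2 * g))"
        using beta C by (intro mult_left_mono) auto
      then show ?thesis by simp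
    qed
    have h4: "\<beta> * h = c / 4" using beta by (simp add: h_def)
    \<comment> \<open>Each region has its own source of decrease: the drift of \<open>V\<close>, the
      contraction of \<open>W\<close>, or the minorization.\<close>
    consider "v0 \<ge> R" | "v0 < R" "g0 \<ge> R'" | "v0 < R" "g0 < R'" by linarith
    then show ?thesis
    proof cases
      case 1
      show ?thesis
      proof (rule final[OF growth_W[OF x] _ growth_W[OF y] _ _ _ ctr])
        show "- (0 * A) - c + 2 * b * v0 powr (- \<kappa>)
            + \<beta> * C * ((W x + d + (W y + d) + 2 * g) / g0 - 1) \<le> - (\<beta> * h)"
          using up Rp[OF 1] g' h4 by linarith
      qed (use Wx d in auto)
    next
      case 2
      have VR: "V x \<le> R" "V y \<le> R" using 2 V_ge_1[OF x] V_ge_1[OF y] by (auto simp: v0_def)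
      show ?thesis
      proof (rule final[OF rhoW[OF x VR(1)] _ rhoW[OF y VR(2)] _ _ _ ctr])
        have "((1 - \<rho>) * W x + d + ((1 - \<rho>) * W y + d) + 2 * g) / g0 - 1 = - \<rho> + (2 * \<rho> * g + 2 * d) / g0"
        proof -
          have "(1 - \<rho>) * W x + d + ((1 - \<rho>) * W y + d) + 2 * g = (1 - \<rho>) * g0 + (2 * \<rho> * g + 2 * d)"
            by (simp add: g0_eq algebra_simps)
          then have "((1 - \<rho>) * W x + d + ((1 - \<rho>) * W y + d) + 2 * g) / g0 = (1 - \<rho>) + (2 * \<rho> * g + 2 * d) / g0"
            using g0 by (simp only: add_divide_distrib) simp
          then show ?thesis by linarith
        qed
        also have "\<dots> \<le> - \<rho> / 2"
        proof -
          have "2 * (2 * \<rho> * g + 2 * d) \<le> \<rho> * g0" using 2(2) rho by (simp add: R'_def pos_divide_le_eq mult.commute)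
          then have "(2 * \<rho> * g + 2 * d) / g0 \<le> \<rho> / 2" using g0 by (simp add: pos_divide_le_eq)
          then show ?thesis by linarith
        qed
        finally have "\<beta> * C * (((1 - \<rho>) * W x + d + ((1 - \<rho>) * W y + d) + 2 * g) / g0 - 1) \<le> \<beta> * C * (- \<rho> / 2)"
          using beta C by (intro mult_left_mono) auto
        then show "- (0 * A) - c + 2 * b * v0 powr (- \<kappa>)
            + \<beta> * C * (((1 - \<rho>) * W x + d + ((1 - \<rho>) * W y + d) + 2 * g) / g0 - 1) \<le> - (\<beta> * h)"
          using small_b C' c by linarith
      qed (use rho(2) Wx d in \<open>simp_all only: zero_le_one order_refl add_nonneg_nonneg mult_nonneg_nonneg diff_ge_0_iff_ge\<close>)
    next
      case 3
      have VR: "V x \<le> Rm" "V y \<le> Rm" using 3 V_ge_1[OF x] V_ge_1[OF y] by (auto simp: v0_def Rm_def)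
      have WR: "W x \<le> Rm" "W y \<le> Rm" using 3 Wx g by (auto simp: g0_eq Rm_def)
      have "ennreal \<epsilon> * 1 \<le> T (\<lambda>_. 1) x"
        using nule[OF x VR(1) WR(1), of "\<lambda>_. 1"] nu by (simp add: functional_of_mass_def)
      then have eps1: "\<epsilon> \<le> 1" unfolding one[OF xS] by simp
      have e3: "T z x + ennreal (\<epsilon> * (l * p)) \<le> T z y + ennreal (l * p) + T U x + T U y"
        by (rule contract_minorized[OF z U z1 zU _ xS yS nu])
           (use l p eps nule[OF x VR(1) WR(1)] nule[OF y VR(2) WR(2)] in auto)
      show ?thesis
      proof (rule final[OF growth_W[OF x] _ growth_W[OF y] _ _ eps1 e3])
        have "\<beta> * C * (2 * d) / (2 * g) \<le> \<beta> * C * d"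
        proof -
          have "\<beta> * C * (2 * d) / (2 * g) = \<beta> * C * d * (1 / g)" by simp
          also have "\<dots> \<le> \<beta> * C * d" using g beta C d by (intro mult_left_le) auto
          finally show ?thesis .
        qed
        then show "- (\<epsilon> * A) - c + 2 * b * v0 powr (- \<kappa>)
            + \<beta> * C * ((W x + d + (W y + d) + 2 * g) / g0 - 1) \<le> - (\<beta> * h)"
          using up A(2) small_b c unfolding B_def by linarith
      qed (use eps Wx d in auto)
    qed
  qed
  have iter: "(T ^^ n) z x \<le> (T ^^ n) z y + ennreal (l * F k x y powr \<beta>)"
    if z: "z \<in> borel_measurable S" "\<And>x. x \<in> space S \<Longrightarrow> z x \<le> 1" and l: "l > 0"
      and zz: "\<And>x y. x \<in> \<Omega> \<Longrightarrow> y \<in> \<Omega> \<Longrightarrow> z x \<le> z y + ennreal (l * F (n + k) x y powr \<beta>)"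
      and xy: "x \<in> \<Omega>" "y \<in> \<Omega>" for z l n k x y
    using that
  proof (induction n arbitrary: k x y)
    case (Suc n)
    interpret n: markov_operator S "T ^^ n" by (rule iterate)
    have "(T ^^ n) z u \<le> (T ^^ n) z w + ennreal (l * F (Suc k) u w powr \<beta>)" if "u \<in> \<Omega>" "w \<in> \<Omega>" for u w
      using Suc.IH[of "Suc k" u w] Suc.prems that by simp
    moreover have "(T ^^ n) z u \<le> 1" if "u \<in> space S" for u
      using n.mono[of z "\<lambda>_. 1" u] n.one[OF that] that z by simp
    ultimately show ?case
      using step[of "(T ^^ n) z" l k x y] Suc.prems by simp
  qed simp
  define M where "M = 3 powr \<beta> * (1 + (C * \<beta>) powr \<beta> * (1 + 2 * g) + A powr \<beta>)"
  have M: "M \<ge> 0" using g by (simp add: M_def)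
  have F0: "F 0 x y powr \<beta> \<le> M * (1 + V x + W x + V y + W y)" (is "_ \<le> M * ?u") if x: "x \<in> \<Omega>" and y: "y \<in> \<Omega>" for x y
  proof -
    have nn: "V x \<ge> 1" "V y \<ge> 1" "W x \<ge> 0" "W y \<ge> 0" using x y V_ge_1 W_ge_0 by auto
    define G2 where "G2 = G x + G y"
    have G2: "G2 \<ge> 1" using nn g by (simp add: G2_def G_def)
    have "F 0 x y powr \<beta> \<le> 3 powr \<beta> * (((V x + V y) powr (1/\<beta>)) powr \<beta> + (C * ln G2) powr \<beta> + A powr \<beta>)"
      unfolding F_def G2_def[symmetric] using powr_sum3_le[of "(V x + V y) powr (1/\<beta>)" "C * ln G2" A \<beta>] G2 C A beta
      by (simp add: add.assoc)
    also have "\<dots> \<le> 3 powr \<beta> * (1 * ?u + ((C * \<beta>) powr \<beta> * (1 + 2 * g)) * ?u + A powr \<beta> * ?u)"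
    proof (intro mult_left_mono add_mono)
      show "((V x + V y) powr (1/\<beta>)) powr \<beta> \<le> 1 * ?u" using nn beta by (simp add: powr_powr)
      show "A powr \<beta> \<le> A powr \<beta> * ?u" using nn by (simp add: mult_le_cancel_left1)
      \<comment> \<open>Bounding the logarithm by the power \<open>1/\<beta>\<close> makes its
        \<open>\<beta>\<close>-th power linear in \<open>G2\<close>, hence in
        \<open>W\<close>.\<close>
      have "ln G2 = \<beta> * ln (G2 powr (1/\<beta>))" using beta G2 by (simp add: ln_powr)
      also have "\<dots> \<le> \<beta> * G2 powr (1/\<beta>)"
        using beta G2 ln_bound[of "G2 powr (1/\<beta>)"] by (intro mult_left_mono) auto
      finally have "C * ln G2 \<le> (C * \<beta>) * G2 powr (1/\<beta>)" using C by simp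
      then have "(C * ln G2) powr \<beta> \<le> ((C * \<beta>) * G2 powr (1/\<beta>)) powr \<beta>"
        using C G2 beta by (intro powr_mono2) auto
      also have "\<dots> = (C * \<beta>) powr \<beta> * G2" using C beta G2 by (simp add: powr_mult powr_powr)
      also have "\<dots> \<le> (C * \<beta>) powr \<beta> * ((1 + 2 * g) * ?u)"
      proof (rule mult_left_mono)
        have "0 \<le> g * (V x + W x + V y + W y)" using g nn by simp
        then show "G2 \<le> (1 + 2 * g) * ?u" using nn by (simp add: G2_def G_def algebra_simps)
      qed simp
      finally show "(C * ln G2) powr \<beta> \<le> ((C * \<beta>) powr \<beta> * (1 + 2 * g)) * ?u" by (simp add: mult.assoc)
    qed auto
    finally show ?thesis by (simp add: M_def algebra_simps)
  qed
  define K where "K = max 1 ((h / 2) powr (- \<beta>) * M)"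
  have K: "K \<ge> 0" "K \<ge> 1" "K \<ge> (h / 2) powr (- \<beta>) * M" by (auto simp: K_def)
  show ?thesis
  proof (rule that[OF K(1)])
    fix n :: nat and z :: "'a \<Rightarrow> ennreal" and x y
    assume z: "z \<in> borel_measurable S" "\<And>x. x \<in> space S \<Longrightarrow> z x \<le> 1" and x: "x \<in> \<Omega>" and y: "y \<in> \<Omega>"
    define u where "u = 1 + V x + W x + V y + W y"
    have u: "u \<ge> 1" using V_ge_1[OF x] V_ge_1[OF y] W_ge_0[OF x] W_ge_0[OF y] by (simp add: u_def)
    have "(T ^^ n) z x \<le> (T ^^ n) z y + ennreal (K * u * (real n + 1) powr (- \<beta>))"
    \<comment> \<open>Separate because \<open>0 powr (- \<beta>)\<close> is 0, so the factor
      \<open>l\<close> of the other case would vanish.\<close>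
    proof (cases "n = 0")
      case True
      have "(T ^^ n) z x \<le> ennreal 1" using True z x Omega_sub by auto
      also have "\<dots> \<le> ennreal (K * u * (real n + 1) powr (- \<beta>))"
        using True K u mult_mono[of 1 K 1 u] by (intro ennreal_leI) simp
      also have "\<dots> \<le> (T ^^ n) z y + \<dots>" by simp
      finally show ?thesis .
    next
      case False
      \<comment> \<open>Since the weight at index \<open>n\<close> is at least \<open>h * n\<close>,
        this \<open>l\<close> turns the trivial bound \<open>z \<le> 1\<close> into the hypothesis
        at index \<open>n\<close>; \<open>n\<close> steps then bring the index down to 0.\<close>
      define l where "l = (h * real n) powr (- \<beta>)"
      have hn: "h * real n > 0" using False h by simp
      have l: "l > 0" unfolding l_def using hn by (metis powr_gt_zero less_irrefl)
      have "(T ^^ n) z x \<le> (T ^^ n) z y + ennreal (l * F 0 x y powr \<beta>)"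
      proof (rule iter[where n = n and k = 0 and z = z and l = l and x = x and y = y, OF z l _ x y])
        fix u w assume uw: "u \<in> \<Omega>" "w \<in> \<Omega>"
        have "(h * real n) powr \<beta> \<le> F (n + 0) u w powr \<beta>"
          using Fpos(1)[OF uw, of n] hn beta by (intro powr_mono2) auto
        then have "1 \<le> l * F (n + 0) u w powr \<beta>"
          using h False by (simp add: l_def powr_minus divide_simps)
        then have "1 \<le> ennreal (l * F (n + 0) u w powr \<beta>)"
          by (simp only: ennreal_1[symmetric] ennreal_leI)
        moreover have "z u \<le> 1" using z(2) uw(1) Omega_sub by blast
        ultimately have "z u \<le> ennreal (l * F (n + 0) u w powr \<beta>)" by (rule order_trans[rotated])
        also have "\<dots> \<le> z w + \<dots>" by simp
        finally show "z u \<le> z w + ennreal (l * F (n + 0) u w powr \<beta>)" .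
      qed
      also have "ennreal (l * F 0 x y powr \<beta>) \<le> ennreal (K * u * (real n + 1) powr (- \<beta>))"
      proof (rule ennreal_leI)
        have "l \<le> (h / 2 * (real n + 1)) powr (- \<beta>)"
          unfolding l_def using False h beta by (intro powr_mono2') auto
        also have "\<dots> = (h / 2) powr (- \<beta>) * (real n + 1) powr (- \<beta>)"
          by (rule powr_mult)
        finally have "l * F 0 x y powr \<beta> \<le> ((h / 2) powr (- \<beta>) * (real n + 1) powr (- \<beta>)) * (M * u)"
          using F0[OF x y] M u by (intro mult_mono) (auto simp: u_def)
        also have "\<dots> = ((h / 2) powr (- \<beta>) * M) * (u * (real n + 1) powr (- \<beta>))" by simp
        also have "\<dots> \<le> K * (u * (real n + 1) powr (- \<beta>))"
          using K u by (intro mult_right_mono) auto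
        finally show "l * F 0 x y powr \<beta> \<le> K * u * (real n + 1) powr (- \<beta>)" by (simp add: mult.assoc)
      qed
      finally show ?thesis by (simp add: add_left_mono)
    qed
    then show "(T ^^ n) z x \<le> (T ^^ n) z y + ennreal (K * (1 + V x + W x + V y + W y) * (real n + 1) powr (- \<beta>))"
      by (simp add: u_def)
  qed
qed

end

section \<open>The jump chain as an operator on nonnegative functions\<close>

lemma prob_space_unif01: "prob_space unif01"
  unfolding unif01_def by (rule prob_space_uniform_measure) auto

lemma sets_unif01[measurable_cong, simp]: "sets unif01 = sets borel" and space_unif01[simp]: "space unif01 = UNIV"
  by (simp_all add: unif01_def)

lemma nn_integral_unif01:
  assumes "f \<in> borel_measurable borel"
  shows "(\<integral>\<^sup>+p. f p \<partial>unif01) = (\<integral>\<^sup>+p. f p * indicator {0<..<1} p \<partial>lborel)"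
  unfolding unif01_def using assms by (subst nn_integral_uniform_measure) (auto simp: divide_ennreal_def)

lemma AE_unif01: "AE p in unif01. 0 < p \<and> p < 1"
  unfolding unif01_def by (rule AE_uniform_measureI) auto

lemma prob_space_expo: "T > 0 \<Longrightarrow> prob_space (expo T)"
  unfolding expo_def by (rule prob_space_exponential_density) simp

lemma sets_expo[measurable_cong, simp]: "sets (expo T) = sets borel" and space_expo[simp]: "space (expo T) = UNIV"
  by (simp_all add: expo_def)

lemma nn_integral_expo:
  assumes "f \<in> borel_measurable borel"
  shows "(\<integral>\<^sup>+x. f x \<partial>expo T) = (\<integral>\<^sup>+x. ennreal (exponential_density (1/T) x) * f x \<partial>lborel)"
  unfolding expo_def using assms by (subst nn_integral_density) auto

lemma AE_expo: "T > 0 \<Longrightarrow> AE x in expo T. 0 < x"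
  unfolding expo_def
  by (subst AE_density) (auto simp: exponential_density_def intro!: AE_mp[OF AE_lborel_singleton[of 0] AE_I2])

definition bond_upd :: "nat \<Rightarrow> real \<Rightarrow> (nat \<Rightarrow> real) \<Rightarrow> nat \<Rightarrow> real" where
  "bond_upd i p E = E(i := p * (E i + E (Suc i)), Suc i := (1 - p) * (E i + E (Suc i)))"

definition bath_upd :: "nat \<Rightarrow> real \<Rightarrow> real \<Rightarrow> (nat \<Rightarrow> real) \<Rightarrow> nat \<Rightarrow> real" where
  "bath_upd j p x E = E(j := p * (E j + x))"

definition bond_avg :: "nat \<Rightarrow> ((nat \<Rightarrow> real) \<Rightarrow> ennreal) \<Rightarrow> (nat \<Rightarrow> real) \<Rightarrow> ennreal" where
  "bond_avg i f E = (\<integral>\<^sup>+p. f (bond_upd i p E) \<partial>unif01)"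

definition bath_avg :: "nat \<Rightarrow> real \<Rightarrow> ((nat \<Rightarrow> real) \<Rightarrow> ennreal) \<Rightarrow> (nat \<Rightarrow> real) \<Rightarrow> ennreal" where
  "bath_avg j T f E = (\<integral>\<^sup>+p. (\<integral>\<^sup>+x. f (bath_upd j p x E) \<partial>expo T) \<partial>unif01)"

lemma measurable_state_upd[measurable (raw)]:
  assumes "j < N" "f \<in> measurable M (state_space N)" "h \<in> borel_measurable M"
  shows "(\<lambda>x. (f x)(j := h x)) \<in> measurable M (state_space N)"
proof -
  have J: "{..<N} = {..<N} \<union> {j}" using assms(1) by auto
  show ?thesis
    using assms(2,3) unfolding state_space_def by (intro measurable_fun_upd[OF J]) (use assms(1) in auto)
qed

lemma measurable_state_component:
  assumes "f \<in> measurable M (state_space N)" "j < N"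
  shows "(\<lambda>x. f x j) \<in> borel_measurable M"
  by (rule measurable_compose[OF assms(1)[unfolded state_space_def] measurable_component_singleton])
     (use assms(2) in auto)

lemma space_state_upd: "E \<in> space (state_space N) \<Longrightarrow> j < N \<Longrightarrow> E(j := a) \<in> space (state_space N)"
  by (auto simp: state_space_def space_PiM PiE_def extensional_def)

lemma space_bond_upd: "E \<in> space (state_space N) \<Longrightarrow> Suc i < N \<Longrightarrow> bond_upd i p E \<in> space (state_space N)"
  by (simp add: bond_upd_def space_state_upd)

lemma space_bath_upd: "E \<in> space (state_space N) \<Longrightarrow> j < N \<Longrightarrow> bath_upd j p x E \<in> space (state_space N)"
  by (simp add: bath_upd_def space_state_upd)

lemma measurable_bond_upd[measurable (raw)]:
  assumes [measurable]: "f \<in> measurable M (state_space N)" "g \<in> borel_measurable M" and i[simp]: "Suc i < N"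
  shows "(\<lambda>x. bond_upd i (g x) (f x)) \<in> measurable M (state_space N)"
proof -
  have [simp]: "i < N" using i by (rule Suc_lessD)
  have [measurable]: "(\<lambda>x. f x i) \<in> borel_measurable M" "(\<lambda>x. f x (Suc i)) \<in> borel_measurable M"
    by (rule measurable_state_component[OF assms(1)], simp)+
  show ?thesis unfolding bond_upd_def by measurable
qed

lemma measurable_bath_upd[measurable (raw)]:
  assumes [measurable]: "f \<in> measurable M (state_space N)" "g \<in> borel_measurable M" "h \<in> borel_measurable M"
    and j[simp]: "j < N"
  shows "(\<lambda>x. bath_upd j (g x) (h x) (f x)) \<in> measurable M (state_space N)"
proof -
  have [measurable]: "(\<lambda>x. f x j) \<in> borel_measurable M"
    by (rule measurable_state_component[OF assms(1) j])
  show ?thesis unfolding bath_upd_def by measurable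
qed

lemma sigma_finite_unif01: "sigma_finite_measure unif01"
  using prob_space_unif01 by (simp add: prob_space_imp_sigma_finite)

lemma measurable_bond_avg:
  assumes [measurable]: "f \<in> borel_measurable (state_space N)" and i[simp]: "Suc i < N"
  shows "bond_avg i f \<in> borel_measurable (state_space N)"
proof -
  interpret sigma_finite_measure unif01 by (rule sigma_finite_unif01)
  show ?thesis unfolding bond_avg_def by measurable
qed

lemma measurable_bath_avg:
  assumes [measurable]: "f \<in> borel_measurable (state_space N)" and j[simp]: "j < N" and T: "T > 0"
  shows "bath_avg j T f \<in> borel_measurable (state_space N)"
proof -
  interpret u: sigma_finite_measure unif01 by (rule sigma_finite_unif01)
  interpret sigma_finite_measure "expo T" using prob_space_expo[OF T] by (simp add: prob_space_imp_sigma_finite)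
  show ?thesis unfolding bath_avg_def by measurable
qed

lemma measurable_rate[measurable (raw)]:
  "f \<in> borel_measurable M \<Longrightarrow> g \<in> borel_measurable M \<Longrightarrow> (\<lambda>x. rate k (f x) (g x)) \<in> borel_measurable M"
  unfolding rate_def by (intro borel_measurable_min borel_measurable_const measurable_compose[OF _ borel_measurable_sqrt]) auto

text \<open>\<open>K \<ge> 1\<close> yields \<open>lam \<ge> 1\<close>, and the cutoff then never
  acts on a clock whose smaller energy is below 1.\<close>

locale energy_exchange =
  fixes N :: nat and K TL TR :: real
  assumes N: "N \<ge> 1" and K: "K \<ge> 1" and TL: "TL > 0" and TR: "TR > 0"
begin

abbreviation "S \<equiv> state_space N"

text \<open>Updates with \<open>0 < p < 1\<close> and a positive bath energy preserve this open
  orthant, and the measures considered in the end are carried by it, so all estimates are made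
  here.\<close>

definition Omega :: "(nat \<Rightarrow> real) set" where
  "Omega = {E \<in> space S. \<forall>i<N. E i > 0}"

abbreviation "lam \<equiv> unif_rate N K"

abbreviation "w_bond i E \<equiv> rate K (E i) (E (Suc i)) / lam"
abbreviation "w_left E \<equiv> rate K TL (E 0) / lam"
abbreviation "w_right E \<equiv> rate K (E (N - 1)) TR / lam"
abbreviation "w_stay E \<equiv> 1 - total_rate N K TL TR E / lam"

text \<open>Outside \<^term>\<open>Omega\<close> the rates need not be nonnegative, so the chain is frozen there.\<close>

definition jump :: "((nat \<Rightarrow> real) \<Rightarrow> ennreal) \<Rightarrow> (nat \<Rightarrow> real) \<Rightarrow> ennreal" where
  "jump f E = (if E \<in> Omega then
      (\<Sum>i<N - 1. ennreal (w_bond i E) * bond_avg i f E)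
      + ennreal (w_left E) * bath_avg 0 TL f E + ennreal (w_right E) * bath_avg (N - 1) TR f E
      + ennreal (w_stay E) * f E
    else f E)"

lemma lam_pos: "lam > 0"
  using K by (simp add: unif_rate_def)

lemma component_meas: "i < N \<Longrightarrow> (\<lambda>E. E i) \<in> borel_measurable S"
  using measurable_state_component[OF measurable_ident] by simp

lemma Omega_meas[measurable]: "Omega \<in> sets S"
proof -
  note [measurable] = component_meas
  show ?thesis unfolding Omega_def by measurable
qed

lemma Omega_space: "E \<in> Omega \<Longrightarrow> E \<in> space S" by (simp add: Omega_def)

lemma Omega_pos: "E \<in> Omega \<Longrightarrow> i < N \<Longrightarrow> E i > 0" by (simp add: Omega_def)

lemma bond_upd_Omega: "E \<in> Omega \<Longrightarrow> Suc i < N \<Longrightarrow> 0 < p \<Longrightarrow> p < 1 \<Longrightarrow> bond_upd i p E \<in> Omega"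
  by (auto simp: Omega_def space_bond_upd) (auto simp: bond_upd_def intro!: mult_pos_pos add_pos_pos)

lemma bath_upd_Omega: "E \<in> Omega \<Longrightarrow> j < N \<Longrightarrow> 0 < p \<Longrightarrow> 0 < x \<Longrightarrow> bath_upd j p x E \<in> Omega"
  by (auto simp: Omega_def space_bath_upd) (auto simp: bath_upd_def intro!: mult_pos_pos add_pos_pos)

lemma w_nonneg:
  assumes "E \<in> Omega"
  shows "i < N - 1 \<Longrightarrow> 0 \<le> w_bond i E" "0 \<le> w_left E" "0 \<le> w_right E"
proof -
  have "E 0 > 0" "E (N - 1) > 0" using Omega_pos[OF assms] N by auto
  then show "0 \<le> w_left E" "0 \<le> w_right E"
    using lam_pos K TL TR by (auto simp: rate_def)
  assume "i < N - 1"
  then have "E i > 0" "E (Suc i) > 0" using Omega_pos[OF assms] by auto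
  then show "0 \<le> w_bond i E" using lam_pos K by (auto simp: rate_def)
qed

lemma w_le_1: "w_bond i E \<le> 1" "w_left E \<le> 1" "w_right E \<le> 1"
proof -
  have "rate K a b \<le> K" for a b by (simp add: rate_def)
  moreover have "K \<le> lam" using K by (simp add: unif_rate_def algebra_simps)
  ultimately have "rate K a b / lam \<le> 1" for a b using lam_pos order_trans[of "rate K a b" K lam for a b] by simp
  then show "w_bond i E \<le> 1" "w_left E \<le> 1" "w_right E \<le> 1" by blast+
qed

lemma w_sum: "(\<Sum>i<N - 1. w_bond i E) + w_left E + w_right E + w_stay E = 1"
  by (simp add: total_rate_def add_divide_distrib sum_divide_distrib)

lemma w_stay_nonneg: "0 \<le> w_stay E"
proof -
  have r: "rate K a b \<le> K" for a b by (simp add: rate_def)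
  have "total_rate N K TL TR E \<le> (\<Sum>i<N - 1. K) + K + K"
    unfolding total_rate_def by (intro add_mono sum_mono r)
  also have "\<dots> = lam" using N by (simp add: unif_rate_def of_nat_diff algebra_simps)
  finally show ?thesis using lam_pos by simp
qed

lemma N_less[simp]: "0 < N" "N - Suc 0 < N" using N by auto

lemma Suc_less_N: "i < N - Suc 0 \<Longrightarrow> Suc i < N" by simp

lemma measurable_weights[measurable]:
  "i < N - Suc 0 \<Longrightarrow> (\<lambda>E. w_bond i E) \<in> borel_measurable S" "(\<lambda>E. w_left E) \<in> borel_measurable S"
  "(\<lambda>E. w_right E) \<in> borel_measurable S" "(\<lambda>E. w_stay E) \<in> borel_measurable S"
proof -
  note [measurable] = component_meas
  have *: "(\<lambda>E. rate K (E i) (E (Suc i))) \<in> borel_measurable S" if "i < N - Suc 0" for i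
  proof -
    have [simp]: "i < N" "Suc i < N" using that by auto
    show ?thesis by measurable
  qed
  show "i < N - Suc 0 \<Longrightarrow> (\<lambda>E. w_bond i E) \<in> borel_measurable S" using *[of i] by measurable
  show "(\<lambda>E. w_left E) \<in> borel_measurable S"
    "(\<lambda>E. w_right E) \<in> borel_measurable S" by measurable
  have "(\<lambda>E. \<Sum>i<N - Suc 0. rate K (E i) (E (Suc i))) \<in> borel_measurable S"
    by (intro borel_measurable_sum *) auto
  then show "(\<lambda>E. w_stay E) \<in> borel_measurable S" unfolding total_rate_def by measurable
qed

lemma measurable_jump[measurable]:
  assumes f[measurable]: "f \<in> borel_measurable S"
  shows "jump f \<in> borel_measurable S"
proof -
  have [measurable]: "(\<lambda>E. \<Sum>i<N - 1. ennreal (w_bond i E) * bond_avg i f E) \<in> borel_measurable S"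
  proof (intro borel_measurable_sum)
    fix i assume "i \<in> {..<N - 1}"
    then have [simp]: "i < N - Suc 0" by simp
    have [measurable]: "bond_avg i f \<in> borel_measurable S" using Suc_less_N by (intro measurable_bond_avg) auto
    show "(\<lambda>E. ennreal (w_bond i E) * bond_avg i f E) \<in> borel_measurable S" by measurable
  qed
  have [measurable]: "bath_avg 0 TL f \<in> borel_measurable S" "bath_avg (N - 1) TR f \<in> borel_measurable S"
    using N TL TR by (auto intro: measurable_bath_avg)
  show ?thesis unfolding jump_def by measurable
qed

lemma bond_avg_mono:
  "(\<And>y. y \<in> Omega \<Longrightarrow> f y \<le> g y) \<Longrightarrow> E \<in> Omega \<Longrightarrow> Suc i < N \<Longrightarrow> bond_avg i f E \<le> bond_avg i g E"
  unfolding bond_avg_def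
  by (intro nn_integral_mono_AE AE_mp[OF AE_unif01 AE_I2]) (auto simp: bond_upd_Omega)

lemma bath_avg_mono:
  assumes "\<And>y. y \<in> Omega \<Longrightarrow> f y \<le> g y" "E \<in> Omega" "j < N" "T > 0"
  shows "bath_avg j T f E \<le> bath_avg j T g E"
  unfolding bath_avg_def
  by (intro nn_integral_mono_AE AE_mp[OF AE_unif01 AE_I2] impI AE_mp[OF AE_expo AE_I2] assms)
     (auto simp: assms bath_upd_Omega)

text \<open>Sharper than monotonicity on the whole space: the comparison is asked for on
  \<open>Omega\<close> only, because almost every update of a point of \<open>Omega\<close> stays
  there. Functions may thus be changed freely outside.\<close>

lemma jump_mono:
  assumes "\<And>y. y \<in> Omega \<Longrightarrow> f y \<le> g y" "E \<in> Omega"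
  shows "jump f E \<le> jump g E"
  unfolding jump_def using assms N TL TR
  by (auto intro!: add_mono sum_mono mult_left_mono bond_avg_mono bath_avg_mono)

lemma jump_le:
  assumes E: "E \<in> Omega"
    and bond: "\<And>b. b < N - 1 \<Longrightarrow> bond_avg b f E \<le> ennreal (a b) \<and> 0 \<le> a b"
    and left: "bath_avg 0 TL f E \<le> ennreal aL" "0 \<le> aL"
    and right: "bath_avg (N - 1) TR f E \<le> ennreal aR" "0 \<le> aR"
    and stay: "f E \<le> ennreal r" "0 \<le> r"
  shows "jump f E \<le> ennreal ((\<Sum>b<N - 1. w_bond b E * a b) + w_left E * aL + w_right E * aR + w_stay E * r)"
    "0 \<le> (\<Sum>b<N - 1. w_bond b E * a b) + w_left E * aL + w_right E * aR + w_stay E * r"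
proof -
  note wn = w_nonneg[OF E]
  have nn: "0 \<le> (\<Sum>b<N - 1. w_bond b E * a b)"
    using wn(1) bond by (intro sum_nonneg mult_nonneg_nonneg) auto
  have eq: "(\<Sum>b<N - 1. ennreal (w_bond b E) * ennreal (a b)) = ennreal (\<Sum>b<N - 1. w_bond b E * a b)"
  proof -
    have "(\<Sum>b<N - 1. ennreal (w_bond b E) * ennreal (a b)) = (\<Sum>b<N - 1. ennreal (w_bond b E * a b))"
      using wn(1) bond by (intro sum.cong refl ennreal_mult[symmetric]) auto
    also have "\<dots> = ennreal (\<Sum>b<N - 1. w_bond b E * a b)"
      using wn(1) bond by (intro sum_ennreal mult_nonneg_nonneg) auto
    finally show ?thesis .
  qed
  have "jump f E \<le> (\<Sum>b<N - 1. ennreal (w_bond b E) * ennreal (a b)) + ennreal (w_left E) * ennreal aL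
      + ennreal (w_right E) * ennreal aR + ennreal (w_stay E) * ennreal r"
    unfolding jump_def if_P[OF E] using bond left right stay
    by (intro add_mono sum_mono mult_left_mono) auto
  also have "\<dots> = ennreal ((\<Sum>b<N - 1. w_bond b E * a b) + w_left E * aL + w_right E * aR + w_stay E * r)"
    unfolding eq using nn wn(2,3) left right stay w_stay_nonneg[of E]
    by (simp only: ennreal_plus ennreal_mult add_nonneg_nonneg mult_nonneg_nonneg)
  finally show "jump f E \<le> ennreal ((\<Sum>b<N - 1. w_bond b E * a b) + w_left E * aL + w_right E * aR + w_stay E * r)" .
  show "0 \<le> (\<Sum>b<N - 1. w_bond b E * a b) + w_left E * aL + w_right E * aR + w_stay E * r"
    using nn wn(2,3) left right stay w_stay_nonneg[of E] by (intro add_nonneg_nonneg mult_nonneg_nonneg)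
qed

lemma measurable_bond_slice:
  "f \<in> borel_measurable S \<Longrightarrow> E \<in> space S \<Longrightarrow> Suc i < N \<Longrightarrow> (\<lambda>p. f (bond_upd i p E)) \<in> borel_measurable borel"
  by (rule measurable_compose[OF measurable_bond_upd]) auto

lemma measurable_bath_slice:
  "f \<in> borel_measurable S \<Longrightarrow> E \<in> space S \<Longrightarrow> j < N \<Longrightarrow> (\<lambda>(p, x). f (bath_upd j p x E)) \<in> borel_measurable (borel \<Otimes>\<^sub>M borel)"
  unfolding split_beta' by (rule measurable_compose[OF measurable_bath_upd]) auto

lemma bond_avg_add:
  assumes "f \<in> borel_measurable S" "g \<in> borel_measurable S" "E \<in> space S" "Suc i < N"
  shows "bond_avg i (\<lambda>y. f y + g y) E = bond_avg i f E + bond_avg i g E"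
  unfolding bond_avg_def using assms
  by (intro nn_integral_add) (simp_all add: measurable_bond_slice cong: measurable_cong_sets)

lemma bond_avg_cmult:
  assumes "f \<in> borel_measurable S" "E \<in> space S" "Suc i < N"
  shows "bond_avg i (\<lambda>y. c * f y) E = c * bond_avg i f E"
  unfolding bond_avg_def using assms
  by (intro nn_integral_cmult) (simp_all add: measurable_bond_slice cong: measurable_cong_sets)

lemma measurable_bath_inner:
  assumes "f \<in> borel_measurable S" "E \<in> space S" "j < N" "T > 0"
  shows "(\<lambda>x. f (bath_upd j p x E)) \<in> borel_measurable (expo T)"
    "(\<lambda>p. \<integral>\<^sup>+x. f (bath_upd j p x E) \<partial>expo T) \<in> borel_measurable unif01"
proof -
  interpret sigma_finite_measure "expo T" using prob_space_expo[OF assms(4)] by (simp add: prob_space_imp_sigma_finite)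
  have "(\<lambda>x. (\<lambda>(p, x). f (bath_upd j p x E)) (p, x)) \<in> borel_measurable borel"
    by (rule measurable_Pair2[OF measurable_bath_slice[OF assms(1-3)]]) simp
  then show "(\<lambda>x. f (bath_upd j p x E)) \<in> borel_measurable (expo T)"
    by (simp cong: measurable_cong_sets)
  have "(\<lambda>(p, x). f (bath_upd j p x E)) \<in> borel_measurable (unif01 \<Otimes>\<^sub>M expo T)"
    using measurable_bath_slice[OF assms(1-3)] by (simp cong: measurable_cong_sets)
  then show "(\<lambda>p. \<integral>\<^sup>+x. f (bath_upd j p x E) \<partial>expo T) \<in> borel_measurable unif01"
    by (rule borel_measurable_nn_integral)
qed

lemma bath_avg_add:
  assumes "f \<in> borel_measurable S" "g \<in> borel_measurable S" "E \<in> space S" "j < N" "T > 0"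
  shows "bath_avg j T (\<lambda>y. f y + g y) E = bath_avg j T f E + bath_avg j T g E"
  unfolding bath_avg_def using assms
  by (simp add: nn_integral_add measurable_bath_inner)

lemma bath_avg_cmult:
  assumes "f \<in> borel_measurable S" "E \<in> space S" "j < N" "T > 0"
  shows "bath_avg j T (\<lambda>y. c * f y) E = c * bath_avg j T f E"
  unfolding bath_avg_def using assms
  by (simp add: nn_integral_cmult measurable_bath_inner)

lemma bond_avg_const: "bond_avg i (\<lambda>_. c) E = c"
  unfolding bond_avg_def using prob_space.emeasure_space_1[OF prob_space_unif01] by simp

lemma bath_avg_const: "T > 0 \<Longrightarrow> bath_avg j T (\<lambda>_. c) E = c"
  unfolding bath_avg_def using prob_space.emeasure_space_1[OF prob_space_unif01]
    prob_space.emeasure_space_1[OF prob_space_expo[of T]] by simp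

lemma jump_markov: "markov_operator S jump"
proof
  fix f g :: "(nat \<Rightarrow> real) \<Rightarrow> ennreal" and E and c :: ennreal
  assume f: "f \<in> borel_measurable S"
  then show "jump f \<in> borel_measurable S" by (rule measurable_jump)
  assume E: "E \<in> space S"
  have [simp]: "i < N - Suc 0 \<Longrightarrow> Suc i < N" for i by simp
  note cm = bond_avg_cmult[OF f E] bath_avg_cmult[OF f E _ TL] bath_avg_cmult[OF f E _ TR]
  have "(\<Sum>i<N - 1. ennreal (w_bond i E) * bond_avg i (\<lambda>y. c * f y) E) = (\<Sum>i<N - 1. c * (ennreal (w_bond i E) * bond_avg i f E))"
    by (intro sum.cong refl) (simp add: cm ac_simps)
  then show "jump (\<lambda>y. c * f y) E = c * jump f E"
    unfolding jump_def by (simp add: cm distrib_left sum_distrib_left mult.left_commute)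
  assume g: "g \<in> borel_measurable S"
  note ad = bond_avg_add[OF f g E] bath_avg_add[OF f g E _ TL] bath_avg_add[OF f g E _ TR]
  have eq: "(\<Sum>i<N - 1. ennreal (w_bond i E) * bond_avg i (\<lambda>y. f y + g y) E) =
      (\<Sum>i<N - 1. ennreal (w_bond i E) * bond_avg i f E) + (\<Sum>i<N - 1. ennreal (w_bond i E) * bond_avg i g E)"
    unfolding sum.distrib[symmetric] by (intro sum.cong refl) (simp add: ad distrib_left)
  have N': "0 < N" "N - 1 < N" using N by auto
  show "jump (\<lambda>y. f y + g y) E = jump f E + jump g E"
  proof (cases "E \<in> Omega")
    case True
    then show ?thesis
      unfolding jump_def if_P[OF True] eq ad(2)[OF N'(1)] ad(3)[OF N'(2)] distrib_left by (simp only: ac_simps)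
  qed (simp add: jump_def)
  assume "\<And>y. y \<in> space S \<Longrightarrow> f y \<le> g y"
  then show "jump f E \<le> jump g E"
    using E Omega_space jump_mono[of f g E] by (cases "E \<in> Omega") (auto simp: jump_def)
next
  fix E
  show "jump (\<lambda>_. 1) E = 1"
  proof (cases "E \<in> Omega")
    case True
    have "jump (\<lambda>_. 1) E = (\<Sum>i<N - 1. ennreal (w_bond i E)) + ennreal (w_left E) + ennreal (w_right E) + ennreal (w_stay E)"
      using True TL TR by (simp add: jump_def bond_avg_const bath_avg_const)
    also have "\<dots> = ennreal ((\<Sum>i<N - 1. w_bond i E) + w_left E + w_right E + w_stay E)"
    proof -
      have "(\<Sum>i<N - 1. ennreal (w_bond i E)) = ennreal (\<Sum>i<N - 1. w_bond i E)"
        using w_nonneg(1)[OF True] by (intro sum_ennreal) auto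
      moreover have "0 \<le> (\<Sum>i<N - 1. w_bond i E)" using w_nonneg(1)[OF True] by (intro sum_nonneg) auto
      ultimately show ?thesis using w_nonneg(2,3)[OF True] w_stay_nonneg[of E] by (simp only: ennreal_plus add_nonneg_nonneg)
    qed
    finally show ?thesis unfolding w_sum by simp
  qed (simp add: jump_def)
qed

sublocale markov_operator S jump by (rule jump_markov)

end

section \<open>Drift of the negative block powers\<close>

lemma nn_integral_powr_01:
  assumes "q < 1"
  shows "(\<integral>\<^sup>+p. ennreal (p powr (- q)) * indicator {0..1} p \<partial>lborel) = ennreal (1 / (1 - q))"
proof -
  have "((\<lambda>x::real. x powr (-q)) has_integral (1 powr (-q+1) / (-q+1))) {0..1}"
    by (rule has_integral_powr_from_0) (use assms in auto)
  then have "(\<integral>\<^sup>+x. ennreal (indicator {0..1} x * x powr (-q)) \<partial>lborel) = ennreal (1 powr (-q+1) / (-q+1))"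
    by (intro nn_integral_has_integral_lebesgue) auto
  moreover have "ennreal (indicator {0..1} x * x powr (-q)) = ennreal (x powr (- q)) * indicator {0..1} x" for x :: real
    by (auto simp: indicator_def)
  ultimately show ?thesis by (simp add: add.commute)
qed

text \<open>For \<open>0 < p < 1\<close> one has
  \<open>a + p * x \<ge> p * (a + x) \<ge> p * s\<close>, and \<open>p powr (- q)\<close> has
  integral \<open>1 / (1 - q)\<close>.\<close>

lemma nn_integral_unif01_powr_le:
  assumes q: "0 < q" "q < 1" and s: "0 < s" "s \<le> a + x" and a: "0 \<le> a" and x: "0 \<le> x"
  shows "(\<integral>\<^sup>+p. ennreal ((a + p * x) powr (- q)) \<partial>unif01) \<le> ennreal (s powr (- q) / (1 - q))"
proof -
  have "(\<integral>\<^sup>+p. ennreal ((a + p * x) powr (- q)) \<partial>unif01)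
      = (\<integral>\<^sup>+p. ennreal ((a + p * x) powr (- q)) * indicator {0<..<1} p \<partial>lborel)"
    by (rule nn_integral_unif01) measurable
  also have "\<dots> \<le> (\<integral>\<^sup>+p. ennreal (s powr (- q)) * (ennreal (p powr (- q)) * indicator {0..1} p) \<partial>lborel)"
  proof (intro nn_integral_mono)
    fix p :: real
    show "ennreal ((a + p * x) powr (- q)) * indicator {0<..<1} p
        \<le> ennreal (s powr (- q)) * (ennreal (p powr (- q)) * indicator {0..1} p)"
    proof (cases "p \<in> {0<..<1}")
      case True
      have "p * s \<le> p * (a + x)" using True s by (intro mult_left_mono) auto
      also have "\<dots> \<le> a + p * x" using True a mult_right_mono[of p 1 a] by (simp add: algebra_simps)
      finally have "(a + p * x) powr (- q) \<le> (p * s) powr (- q)"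
        using True s q by (intro powr_mono2') auto
      also have "\<dots> = s powr (- q) * p powr (- q)" by (simp add: powr_mult)
      finally show ?thesis using True by (simp flip: ennreal_mult)
    qed simp
  qed
  also have "\<dots> = ennreal (s powr (- q)) * ennreal (1 / (1 - q))"
    using nn_integral_powr_01[OF q(2)] by (subst nn_integral_cmult) auto
  also have "\<dots> = ennreal (s powr (- q) / (1 - q))" using q by (simp flip: ennreal_mult)
  finally show ?thesis .
qed

lemma nn_integral_unif01_reflect:
  assumes [measurable]: "f \<in> borel_measurable borel"
  shows "(\<integral>\<^sup>+p. f (1 - p) \<partial>unif01) = (\<integral>\<^sup>+p. f p \<partial>unif01)"
proof -
  have "(\<integral>\<^sup>+p. f p \<partial>unif01) = (\<integral>\<^sup>+p. f p * indicator {0<..<1} p \<partial>lborel)"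
    by (rule nn_integral_unif01) measurable
  also have "\<dots> = (\<integral>\<^sup>+p. f (1 + (-1) * p) * indicator {0<..<1} (1 + (-1) * p) \<partial>lborel)"
    by (subst nn_integral_real_affine[where c = "-1" and t = 1]) auto
  also have "\<dots> = (\<integral>\<^sup>+p. f (1 - p) * indicator {0<..<1} p \<partial>lborel)"
    by (intro nn_integral_cong) (auto simp: indicator_def)
  also have "\<dots> = (\<integral>\<^sup>+p. f (1 - p) \<partial>unif01)" by (rule nn_integral_unif01[symmetric]) measurable
  finally show ?thesis by simp
qed

text \<open>The density is at most \<open>1 / T\<close> on the unit interval, where
  \<open>x powr (- q)\<close> is integrable, and the power is at most 1 beyond it.\<close>

lemma nn_integral_expo_powr_le:
  assumes q: "0 < q" "q < 1" and T: "0 < T"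
  shows "(\<integral>\<^sup>+x. ennreal (x powr (- q)) \<partial>expo T) \<le> ennreal (1 + 1 / (T * (1 - q)))"
proof -
  interpret prob_space "expo T" by (rule prob_space_expo[OF T])
  have d: "exponential_density (1/T) x \<le> 1/T" for x
    using T by (auto simp: exponential_density_def divide_right_mono)
  have "(\<integral>\<^sup>+x. ennreal (x powr (- q)) \<partial>expo T) \<le> (\<integral>\<^sup>+x. 1 + ennreal (x powr (- q)) * indicator {0..1} x \<partial>expo T)"
  proof (intro nn_integral_mono_AE AE_mp[OF AE_expo[OF T] AE_I2] impI)
    fix x :: real assume "0 < x"
    then have "x powr (- q) \<le> 1" if "x > 1" using that q powr_mono[of "-q" 0 x] by simp
    then show "ennreal (x powr (- q)) \<le> 1 + ennreal (x powr (- q)) * indicator {0..1} x"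
      using \<open>0 < x\<close> by (cases "x > 1") (auto simp: add_increasing)
  qed
  also have "\<dots> = 1 + (\<integral>\<^sup>+x. ennreal (x powr (- q)) * indicator {0..1} x \<partial>expo T)"
    using emeasure_space_1 by (subst nn_integral_add) auto
  also have "(\<integral>\<^sup>+x. ennreal (x powr (- q)) * indicator {0..1} x \<partial>expo T)
      = (\<integral>\<^sup>+x. ennreal (exponential_density (1/T) x) * (ennreal (x powr (- q)) * indicator {0..1} x) \<partial>lborel)"
    by (rule nn_integral_expo) measurable
  also have "\<dots> \<le> (\<integral>\<^sup>+x. ennreal (1/T) * (ennreal (x powr (- q)) * indicator {0..1} x) \<partial>lborel)"
    using d by (intro nn_integral_mono mult_right_mono ennreal_leI) auto
  also have "\<dots> = ennreal (1/T) * ennreal (1 / (1 - q))"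
    using nn_integral_powr_01[OF q(2)] by (subst nn_integral_cmult) auto
  also have "1 + \<dots> = ennreal (1 + 1 / (T * (1 - q)))"
    using q T by (simp add: divide_simps flip: ennreal_mult ennreal_plus ennreal_1)
  finally show ?thesis by (simp add: add_left_mono)
qed

section \<open>Block energies and the balance at one end of a block\<close>

definition block_sum :: "nat \<Rightarrow> nat \<Rightarrow> (nat \<Rightarrow> real) \<Rightarrow> real" where
  "block_sum i m E = (\<Sum>j<m. E (i + j))"

lemma block_sum_eq: "block_sum i m E = sum E {i..<i + m}"
  unfolding block_sum_def
  by (rule sum.reindex_bij_witness[of _ "\<lambda>k. k - i" "\<lambda>j. i + j"]) auto

lemma block_sum_upd:
  "block_sum i m (E(j := a)) = block_sum i m E + (if i \<le> j \<and> j < i + m then a - E j else 0)"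
proof (cases "i \<le> j \<and> j < i + m")
  case True
  then have j: "j \<in> {i..<i+m}" by auto
  have "sum (E(j := a)) {i..<i+m} = a + sum (E(j := a)) ({i..<i+m} - {j})"
    using j by (subst sum.remove[of _ j]) auto
  also have "sum (E(j := a)) ({i..<i+m} - {j}) = sum E ({i..<i+m} - {j})" by (intro sum.cong) auto
  also have "\<dots> = sum E {i..<i+m} - E j" using j by (simp add: sum.remove[of _ j E])
  finally show ?thesis using True by (simp add: block_sum_eq)
next
  case False
  then have "sum (E(j := a)) {i..<i+m} = sum E {i..<i+m}" by (intro sum.cong) auto
  then show ?thesis using False by (auto simp: block_sum_eq)
qed

lemma block_sum_Suc_right: "block_sum i (Suc m) E = block_sum i m E + E (i + m)"
  by (simp add: block_sum_def)

lemma block_sum_Suc_left: "block_sum i (Suc m) E = E i + block_sum (Suc i) m E"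
  by (simp add: block_sum_def sum.lessThan_Suc_shift del: sum.lessThan_Suc)

text \<open>The two cases: if the outer neighbour of a block carries much more energy than the block, an exchange
  shrinks the expected negative power of the block energy; otherwise its possible growth is controlled
  by the block enlarged by that neighbour.\<close>

lemma block_end_estimate:
  fixes q e s y w w0 :: real
  defines "\<kappa> \<equiv> (2 / (1 - q)) powr (1 / q)"
  assumes q: "1/2 < q" "q < 1" and e: "0 < e" "e \<le> s" and y: "0 < y"
    and w: "0 \<le> w0" "w0 \<le> w" "w \<le> sqrt s"
  shows "w * (max s (e + y) powr (- q) / (1 - q) - s powr (- q))
     \<le> - (w0 * s powr (- q)) / 2 + (1 / (1 - q) + 1) * (1 + \<kappa>) powr (q - 1/2) * (s + y) powr (1/2 - q)"
proof -
  have s: "s > 0" using e by simp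
  have kap: "\<kappa> > 0" using q by (simp add: \<kappa>_def)
  \<comment> \<open>The defining property of \<open>\<kappa>\<close>: sharing an energy of at least
    \<open>\<kappa> * s\<close> brings the expected negative power down to half of its
    value.\<close>
  have kq: "\<kappa> powr (- q) / (1 - q) = 1 / 2"
  proof -
    have "\<kappa> powr (- q) = (2 / (1 - q)) powr (-1)" using q by (simp add: \<kappa>_def powr_powr)
    also have "\<dots> = (1 - q) / 2" using q by (simp add: powr_minus)
    finally show ?thesis using q by simp
  qed
  have sqrt_s: "sqrt s * s powr (- q) = s powr (1/2 - q)"
    using s by (simp add: powr_half_sqrt[symmetric] powr_add[symmetric])
  show ?thesis
  proof (cases "e + y \<ge> \<kappa> * s")
    case True
    have "max s (e + y) powr (- q) \<le> (\<kappa> * s) powr (- q)"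
      using True kap s q by (intro powr_mono2') auto
    also have "\<dots> = \<kappa> powr (- q) * s powr (- q)" by (rule powr_mult)
    finally have "max s (e + y) powr (- q) / (1 - q) \<le> (\<kappa> powr (- q) / (1 - q)) * s powr (- q)"
      using q by (simp add: divide_right_mono)
    then have "max s (e + y) powr (- q) / (1 - q) - s powr (- q) \<le> - (s powr (- q)) / 2"
      unfolding kq by linarith
    then have "w * (max s (e + y) powr (- q) / (1 - q) - s powr (- q)) \<le> w * (- (s powr (- q)) / 2)"
      using w by (intro mult_left_mono) auto
    also have "\<dots> \<le> - (w0 * s powr (- q)) / 2" using w by (simp add: mult_right_mono)
    also have "\<dots> \<le> - (w0 * s powr (- q)) / 2 + (1 / (1 - q) + 1) * (1 + \<kappa>) powr (q - 1/2) * (s + y) powr (1/2 - q)"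
      using q by simp
    finally show ?thesis .
  next
    case False
    \<comment> \<open>Here \<open>s + y < (1 + \<kappa>) * s\<close>, so the enlarged block has
      comparable energy; the clock is slow, and its rate bound \<open>sqrt s\<close> softens
      \<open>s powr (- q)\<close> to \<open>u\<close>.\<close>
    define u where "u = s powr (1/2 - q)"
    have wq: "w * s powr (- q) \<le> u"
      unfolding u_def sqrt_s[symmetric] using w by (intro mult_right_mono) auto
    have w0q: "w0 * s powr (- q) \<le> w * s powr (- q)" using w by (intro mult_right_mono) auto
    have "max s (e + y) powr (- q) \<le> s powr (- q)"
      using s q by (intro powr_mono2') auto
    then have "max s (e + y) powr (- q) / (1 - q) - s powr (- q) \<le> s powr (- q) / (1 - q) - 0"
      using q by (intro diff_mono divide_right_mono) auto
    then have "w * (max s (e + y) powr (- q) / (1 - q) - s powr (- q)) \<le> w * (s powr (- q) / (1 - q))"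
      using w by (intro mult_left_mono) auto
    also have "\<dots> \<le> u / (1 - q)" using divide_right_mono[OF wq, of "1 - q"] q by simp
    also have "\<dots> \<le> - (w0 * s powr (- q)) / 2 + (1 / (1 - q) + 1) * u"
    proof -
      have "w0 * s powr (- q) / 2 \<le> u" using w0q wq w by (smt (verit) field_sum_of_halves mult_nonneg_nonneg powr_ge_zero)
      then show ?thesis by (simp add: algebra_simps)
    qed
    also have "\<dots> \<le> - (w0 * s powr (- q)) / 2 + (1 / (1 - q) + 1) * ((1 + \<kappa>) powr (q - 1/2) * (s + y) powr (1/2 - q))"
    proof (intro add_left_mono mult_left_mono)
      have "((1 + \<kappa>) * s) powr (1/2 - q) \<le> (s + y) powr (1/2 - q)"
        using False e y s q by (intro powr_mono2') (auto simp: algebra_simps)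
      then have "(1 + \<kappa>) powr (1/2 - q) * u \<le> (s + y) powr (1/2 - q)" by (simp add: powr_mult u_def)
      then have "(1 + \<kappa>) powr (q - 1/2) * ((1 + \<kappa>) powr (1/2 - q) * u) \<le> (1 + \<kappa>) powr (q - 1/2) * (s + y) powr (1/2 - q)"
        by (intro mult_left_mono) auto
      moreover have "(1 + \<kappa>) powr (q - 1/2) * (1 + \<kappa>) powr (1/2 - q) = 1"
        using kap by (simp flip: powr_add)
      ultimately show "u \<le> (1 + \<kappa>) powr (q - 1/2) * (s + y) powr (1/2 - q)"
        by (simp flip: mult.assoc)
    qed (use q in auto)
    finally show ?thesis by (simp add: mult.assoc)
  qed
qed

text \<open>\<open>h\<close> will be the ratio of the lowest site energy to a block energy. For
  \<open>h \<le> h0\<close> the term \<open>h powr (1/2 - q)\<close> suffices alone, because it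
  blows up at 0; for \<open>h > h0\<close> the next weight is taken large enough. The weights arise
  by iterating this choice.\<close>

lemma exists_block_weights:
  fixes q M :: real
  assumes q: "1/2 < q" and M: "M > 0"
  obtains c :: "nat \<Rightarrow> real" where "\<And>m. c m \<ge> 1"
    "\<And>m h. 0 < h \<Longrightarrow> h \<le> 1 \<Longrightarrow> M * c m \<le> c (Suc m) * h powr (1/2) + h powr (1/2 - q)"
proof -
  have "\<exists>y\<ge>1. \<forall>h. 0 < h \<longrightarrow> h \<le> 1 \<longrightarrow> M * x \<le> y * h powr (1/2) + h powr (1/2 - q)" if x: "1 \<le> x" for x
  proof -
    define h0 where "h0 = (M * x) powr (- 1 / (q - 1/2))"
    have h0: "h0 > 0" using M x by (simp add: h0_def)
    have h0q: "h0 powr (1/2 - q) = M * x"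
    proof -
      have "- 1 / (q - 1/2) * (1/2 - q) = 1" using q by (simp add: field_simps)
      then show ?thesis using M x by (simp add: h0_def powr_powr)
    qed
    define y where "y = max 1 (M * x * h0 powr (- 1/2))"
    have "M * x \<le> y * h powr (1/2) + h powr (1/2 - q)" if h: "0 < h" "h \<le> 1" for h
    proof (cases "h \<le> h0")
      case True
      then have "h0 powr (1/2 - q) \<le> h powr (1/2 - q)" using h q by (intro powr_mono2') auto
      then show ?thesis using h0q by (simp add: y_def add_increasing)
    next
      case False
      have "M * x = (M * x * h0 powr (- 1/2)) * h0 powr (1/2)"
        using h0 by (simp add: mult.assoc flip: powr_add)
      also have "\<dots> \<le> y * h powr (1/2)"
        using False h0 by (intro mult_mono powr_mono2) (auto simp: y_def)
      finally show ?thesis by (simp add: add_increasing2)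
    qed
    then show "\<exists>y\<ge>1. \<forall>h. 0 < h \<longrightarrow> h \<le> 1 \<longrightarrow> M * x \<le> y * h powr (1/2) + h powr (1/2 - q)"
      by (intro exI[of _ y]) (simp add: y_def)
  qed
  then obtain g where g: "\<And>x. x \<ge> 1 \<Longrightarrow> g x \<ge> 1"
      "\<And>x h. x \<ge> 1 \<Longrightarrow> 0 < h \<Longrightarrow> h \<le> 1 \<Longrightarrow> M * x \<le> g x * h powr (1/2) + h powr (1/2 - q)"
    by metis
  define c where "c m = (g ^^ m) 1" for m
  have "c m \<ge> 1" for m by (induction m) (auto simp: c_def g)
  then show ?thesis using that[of c] g by (simp add: c_def)
qed

lemma (in markov_operator) sum:
  assumes "finite I" "\<And>i. i \<in> I \<Longrightarrow> f i \<in> borel_measurable S" "x \<in> space S"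
  shows "T (\<lambda>y. \<Sum>i\<in>I. f i y) x = (\<Sum>i\<in>I. T (f i) x)"
  using assms by (induction I rule: finite_induct) (auto simp: add const)

context energy_exchange
begin

definition tau :: real where "tau = min TL (min TR 1)"

lemma tau_pos: "tau > 0" using TL TR by (simp add: tau_def)

text \<open>A lower bound for the probabilities of all clocks at once. The cap \<open>tau\<close>
  makes it valid for the bath clocks too and keeps the square root below the cutoff
  \<open>K\<close>.\<close>

definition w_min :: "(nat \<Rightarrow> real) \<Rightarrow> real" where
  "w_min E = sqrt (min (Min (E ` {..<N})) tau) / lam"

lemma Min_site:
  assumes "E \<in> Omega"
  shows "Min (E ` {..<N}) > 0" "i < N \<Longrightarrow> Min (E ` {..<N}) \<le> E i" "\<exists>l<N. Min (E ` {..<N}) = E l"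
proof -
  have ne: "E ` {..<N} \<noteq> {}" using N by (auto simp: lessThan_empty_iff)
  show ex: "\<exists>l<N. Min (E ` {..<N}) = E l" using Min_in[OF _ ne] by auto
  then show "Min (E ` {..<N}) > 0" using Omega_pos[OF assms] by auto
  show "i < N \<Longrightarrow> Min (E ` {..<N}) \<le> E i" by auto
qed

lemma w_min_bounds:
  assumes E: "E \<in> Omega"
  shows "0 \<le> w_min E" "i < N - 1 \<Longrightarrow> w_min E \<le> w_bond i E" "w_min E \<le> w_left E" "w_min E \<le> w_right E"
proof -
  let ?e = "min (Min (E ` {..<N})) tau"
  have e: "?e > 0" using Min_site[OF E] tau_pos by simp
  then show "0 \<le> w_min E" using lam_pos by (simp add: w_min_def)
  have r: "w_min E \<le> rate K a b / lam" if "?e \<le> a" "?e \<le> b" for a b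
  proof -
    have "?e \<le> 1" by (simp add: tau_def min_le_iff_disj)
    then have "sqrt ?e \<le> 1" by (simp only: real_sqrt_le_1_iff)
    then have "sqrt ?e \<le> K" using K by linarith
    moreover have "sqrt ?e \<le> sqrt (min a b)" using that by (intro real_sqrt_le_mono) simp
    ultimately have "sqrt ?e \<le> rate K a b" by (simp add: rate_def)
    then show ?thesis using lam_pos by (simp add: w_min_def divide_right_mono)
  qed
  have "?e \<le> E i" if "i < N" for i using Min_site(2)[OF E that] by simp
  moreover have "?e \<le> TL" "?e \<le> TR" by (auto simp: tau_def)
  ultimately show "i < N - 1 \<Longrightarrow> w_min E \<le> w_bond i E" "w_min E \<le> w_left E" "w_min E \<le> w_right E"
    by (auto intro!: r)
qed

lemma lam_ge_1: "lam \<ge> 1"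
proof -
  have "1 * 1 \<le> real (N + 1) * K" using K by (intro mult_mono) auto
  then show ?thesis by (simp add: unif_rate_def)
qed

lemma w_bond_le_sqrt: "E \<in> Omega \<Longrightarrow> i < N - 1 \<Longrightarrow> w_bond i E \<le> sqrt (E i)" "E \<in> Omega \<Longrightarrow> i < N - 1 \<Longrightarrow> w_bond i E \<le> sqrt (E (Suc i))"
proof -
  assume E: "E \<in> Omega" and i: "i < N - 1"
  have "0 \<le> rate K (E i) (E (Suc i))" using w_nonneg(1)[OF E i] lam_pos by (simp add: zero_le_divide_iff)
  then have "w_bond i E \<le> rate K (E i) (E (Suc i)) / 1" using lam_ge_1 by (intro divide_left_mono) auto
  moreover have "rate K (E i) (E (Suc i)) \<le> sqrt (E i)" "rate K (E i) (E (Suc i)) \<le> sqrt (E (Suc i))"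
    by (simp_all add: rate_def min.coboundedI2)
  ultimately show "w_bond i E \<le> sqrt (E i)" "w_bond i E \<le> sqrt (E (Suc i))" by linarith+
qed

end

section \<open>One jump acting on the negative power of a single block energy\<close>

locale block_powers = energy_exchange +
  fixes q :: real
  assumes q: "1/2 < q" "q < 1"
begin

definition f_block :: "nat \<Rightarrow> nat \<Rightarrow> (nat \<Rightarrow> real) \<Rightarrow> ennreal" where
  "f_block i m E = ennreal (block_sum i m E powr (- q))"

text \<open>Bounds the mean of \<open>(p * x) powr (- q)\<close> for either bath: the outer factor
  \<open>1 / (1 - q)\<close> comes from \<open>p\<close>, the bracket from the exponential energy
  \<open>x\<close>.\<close>

definition bath_const :: real where
  "bath_const = (1 + 1 / (TL * (1 - q)) + 1 / (TR * (1 - q))) / (1 - q)"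

text \<open>The constant produced by \<open>block_end_estimate\<close>.\<close>

definition nbr_const :: real where
  "nbr_const = (1 / (1 - q) + 1) * (1 + (2 / (1 - q)) powr (1 / q)) powr (q - 1/2)"

lemma q': "0 < q" "q < 1" using q by auto

lemma bath_const_pos: "bath_const > 0"
  using q TL TR by (auto simp: bath_const_def intro!: divide_pos_pos add_pos_nonneg)

lemma nbr_const_pos: "nbr_const > 0"
proof -
  have "1 + (2 / (1 - q)) powr (1 / q) > 0" by (intro add_pos_nonneg) auto
  then show ?thesis unfolding nbr_const_def using q by (intro mult_pos_pos add_pos_pos) auto
qed

lemma block_meas: "i + m \<le> N \<Longrightarrow> (\<lambda>E. block_sum i m E) \<in> borel_measurable S"
  unfolding block_sum_def by (intro borel_measurable_sum component_meas) auto

lemma f_block_meas[measurable]: "i + m \<le> N \<Longrightarrow> f_block i m \<in> borel_measurable S"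
  unfolding f_block_def using block_meas[of i m] by measurable

lemma block_ge_site:
  assumes E: "E \<in> Omega" and "i + m \<le> N" "i \<le> j" "j < i + m"
  shows "E j \<le> block_sum i m E"
  unfolding block_sum_eq
  by (rule member_le_sum) (use assms Omega_pos[OF E] in \<open>auto intro!: less_imp_le\<close>)

text \<open>Exchanges inside or outside the block conserve its energy, so only the bonds across its
  two ends matter. There the block becomes what it keeps plus a uniform share of the energy of the
  bond.\<close>

lemma bond_avg_f_block:
  assumes E: "E \<in> Omega" and im: "i + m \<le> N" "1 \<le> m" and b: "Suc b < N"
  shows "bond_avg b (f_block i m) E \<le> ennreal (if Suc b = i \<or> Suc b = i + m
     then max (block_sum i m E) (E b + E (Suc b)) powr (- q) / (1 - q) else block_sum i m E powr (- q))"
proof -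
  define s where "s = block_sum i m E"
  define X where "X = E b + E (Suc b)"
  have pos: "E b > 0" "E (Suc b) > 0" using Omega_pos[OF E] b by auto
  have X: "X > 0" using pos by (simp add: X_def)
  have upd: "block_sum i m (bond_upd b p E) = s + (if i \<le> b \<and> b < i + m then p * X - E b else 0)
      + (if i \<le> Suc b \<and> Suc b < i + m then (1 - p) * X - E (Suc b) else 0)" for p
    unfolding bond_upd_def block_sum_upd by (simp add: s_def X_def)
  have smax: "0 < max s X" using X by simp
  have ge: "E j \<le> s" if "i \<le> j" "j < i + m" for j
    unfolding s_def using block_ge_site[OF E im(1) that] .
  consider (L) "Suc b = i" | (R) "Suc b = i + m" | (inner) "i \<le> b" "Suc b < i + m" | (outer) "Suc b < i \<or> i + m \<le> b"
    by linarith
  then show ?thesis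
  proof cases
    case L
    have "bond_avg b (f_block i m) E = (\<integral>\<^sup>+p. ennreal (((s - E (Suc b)) + (1 - p) * X) powr (- q)) \<partial>unif01)"
      unfolding bond_avg_def f_block_def upd using L im by (intro nn_integral_cong) (auto simp: algebra_simps)
    also have "\<dots> = (\<integral>\<^sup>+p. ennreal (((s - E (Suc b)) + p * X) powr (- q)) \<partial>unif01)"
      by (rule nn_integral_unif01_reflect[where f = "\<lambda>p. ennreal (((s - E (Suc b)) + p * X) powr (- q))"]) measurable
    also have "\<dots> \<le> ennreal (max s X powr (- q) / (1 - q))"
      by (rule nn_integral_unif01_powr_le) (use q' smax X ge[of "Suc b"] L im pos in \<open>auto simp: X_def\<close>)
    finally show ?thesis using L by (simp add: s_def X_def)
  next
    case R
    have "bond_avg b (f_block i m) E = (\<integral>\<^sup>+p. ennreal (((s - E b) + p * X) powr (- q)) \<partial>unif01)"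
      unfolding bond_avg_def f_block_def upd using R im by (intro nn_integral_cong) (auto simp: algebra_simps)
    also have "\<dots> \<le> ennreal (max s X powr (- q) / (1 - q))"
      by (rule nn_integral_unif01_powr_le) (use q' smax X ge[of b] R im pos in \<open>auto simp: X_def\<close>)
    finally show ?thesis using R by (simp add: s_def X_def)
  next
    case inner
    have "block_sum i m (bond_upd b p E) = s" for p
      unfolding upd using inner by (auto simp: X_def algebra_simps)
    then have "bond_avg b (f_block i m) E = ennreal (s powr (- q))"
      unfolding bond_avg_def f_block_def using prob_space.emeasure_space_1[OF prob_space_unif01] by simp
    then show ?thesis using inner by (simp add: s_def)
  next
    case outer
    have "block_sum i m (bond_upd b p E) = s" for p
      unfolding upd using outer by auto
    then have "bond_avg b (f_block i m) E = ennreal (s powr (- q))"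
      unfolding bond_avg_def f_block_def using prob_space.emeasure_space_1[OF prob_space_unif01] by simp
    moreover have "Suc b \<noteq> i" "Suc b \<noteq> i + m" using outer by auto
    ultimately show ?thesis by (simp add: s_def)
  qed
qed

text \<open>After a bath update of one of its sites the block carries at least \<open>p * x\<close>,
  whose law does not depend on \<open>E\<close>; hence a bound uniform in the old energies.\<close>

lemma bath_avg_f_block:
  assumes E: "E \<in> Omega" and im: "i + m \<le> N" "1 \<le> m" and j: "j < N" and T: "T = TL \<or> T = TR"
  shows "bath_avg j T (f_block i m) E \<le> ennreal (if i \<le> j \<and> j < i + m then bath_const else block_sum i m E powr (- q))"
proof -
  have T0: "T > 0" using T TL TR by auto
  define s where "s = block_sum i m E"
  have upd: "block_sum i m (bath_upd j p x E) = s + (if i \<le> j \<and> j < i + m then p * (E j + x) - E j else 0)" for p x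
    unfolding bath_upd_def block_sum_upd by (simp add: s_def)
  show ?thesis
  proof (cases "i \<le> j \<and> j < i + m")
    case True
    then have sj: "E j \<le> s" unfolding s_def using block_ge_site[OF E im(1)] by auto
    have Ej: "E j > 0" using Omega_pos[OF E j] .
    have "bath_avg j T (f_block i m) E \<le> (\<integral>\<^sup>+p. \<integral>\<^sup>+x. ennreal (p powr (- q)) * ennreal (x powr (- q)) \<partial>expo T \<partial>unif01)"
      unfolding bath_avg_def f_block_def upd
    proof (intro nn_integral_mono_AE AE_mp[OF AE_unif01 AE_I2] impI AE_mp[OF AE_expo[OF T0] AE_I2])
      fix p x :: real assume p: "0 < p \<and> p < 1" and x: "0 < x"
      have "p * x \<le> s + (p * (E j + x) - E j)"
      proof -
        have "0 \<le> p * E j" using p Ej by simp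
        then show ?thesis using sj by (simp only: distrib_left)
      qed
      then have "(s + (p * (E j + x) - E j)) powr (- q) \<le> (p * x) powr (- q)"
        using p x q' by (intro powr_mono2') auto
      then show "ennreal ((s + (if i \<le> j \<and> j < i + m then p * (E j + x) - E j else 0)) powr - q)
          \<le> ennreal (p powr - q) * ennreal (x powr - q)"
        using True by (simp add: powr_mult flip: ennreal_mult)
    qed
    also have "\<dots> = (\<integral>\<^sup>+p. ennreal (p powr (- q)) * (\<integral>\<^sup>+x. ennreal (x powr (- q)) \<partial>expo T) \<partial>unif01)"
      by (intro nn_integral_cong nn_integral_cmult) (simp cong: measurable_cong_sets)
    also have "\<dots> = (\<integral>\<^sup>+p. ennreal (p powr (- q)) \<partial>unif01) * (\<integral>\<^sup>+x. ennreal (x powr (- q)) \<partial>expo T)"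
      by (rule nn_integral_multc) (simp cong: measurable_cong_sets)
    also have "\<dots> \<le> ennreal (1 powr (- q) / (1 - q)) * ennreal (1 + 1 / (T * (1 - q)))"
      using nn_integral_unif01_powr_le[of q 1 0 1] nn_integral_expo_powr_le[OF q' T0] q'
      by (intro mult_mono) auto
    also have "\<dots> \<le> ennreal bath_const"
    proof -
      have "1 + 1 / (T * (1 - q)) \<le> 1 + 1 / (TL * (1 - q)) + 1 / (TR * (1 - q))"
        using T TL TR q by auto
      then have "1 / (1 - q) * (1 + 1 / (T * (1 - q))) \<le> bath_const"
        unfolding bath_const_def using q by (simp add: divide_right_mono)
      moreover have "ennreal (1 powr (- q) / (1 - q)) * ennreal (1 + 1 / (T * (1 - q)))
          = ennreal (1 / (1 - q) * (1 + 1 / (T * (1 - q))))"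
        using q T0 by (subst ennreal_mult[symmetric]) auto
      ultimately show ?thesis by (simp only: ennreal_leI)
    qed
    finally show ?thesis using True by simp
  next
    case False
    have "bath_avg j T (f_block i m) E = ennreal (s powr (- q))"
      using bath_avg_const[OF T0, of j "ennreal (s powr (- q))" E]
      unfolding bath_avg_def f_block_def upd if_not_P[OF False] by simp
    then show ?thesis unfolding if_not_P[OF False] by (simp add: s_def)
  qed
qed

text \<open>A block has two ends, each closed by a bond or by a bath, and each yields half of the
  loss \<open>w_min E * block_sum i m E powr (- q)\<close>. A bath end costs
  \<open>bath_const\<close>, a bond end costs a power of the block enlarged across that
  bond.\<close>

lemma jump_f_block:
  assumes E: "E \<in> Omega" and im: "i + m \<le> N" "1 \<le> m"
  shows "jump (f_block i m) E \<le> ennreal (block_sum i m E powr (- q) - w_min E * block_sum i m E powr (- q)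
    + 2 * bath_const + nbr_const * ((if 0 < i then block_sum (i - 1) (Suc m) E powr (1/2 - q) else 0)
      + (if i + m < N then block_sum i (Suc m) E powr (1/2 - q) else 0)))"
proof -
  define s where "s = block_sum i m E"
  define P where "P = s powr (- q)"
  define w0 where "w0 = w_min E"
  define a where "a b = (if Suc b = i \<or> Suc b = i + m then max s (E b + E (Suc b)) powr (- q) / (1 - q) else P)" for b
  define aL where "aL = (if i \<le> 0 \<and> 0 < i + m then bath_const else P)"
  define aR where "aR = (if i \<le> N - 1 \<and> N - 1 < i + m then bath_const else P)"
  define xL where "xL = (if 0 < i then block_sum (i - 1) (Suc m) E powr (1/2 - q) else 0)"
  define xR where "xR = (if i + m < N then block_sum i (Suc m) E powr (1/2 - q) else 0)"
  have P0: "P \<ge> 0" by (simp add: P_def)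
  have a0: "a b \<ge> 0" for b using P0 q by (simp add: a_def)
  have aL0: "aL \<ge> 0" and aR0: "aR \<ge> 0" using P0 bath_const_pos by (auto simp: aL_def aR_def)
  have xL0: "xL \<ge> 0" and xR0: "xR \<ge> 0" by (auto simp: xL_def xR_def)
  note w0 = w_min_bounds[OF E, folded w0_def]
  note wn = w_nonneg[OF E]
  have "jump (f_block i m) E \<le> ennreal ((\<Sum>b<N - 1. w_bond b E * a b) + w_left E * aL + w_right E * aR + w_stay E * P)"
  proof (rule jump_le[OF E])
    show "bond_avg b (f_block i m) E \<le> ennreal (a b) \<and> 0 \<le> a b" if "b < N - 1" for b
      using bond_avg_f_block[OF E im, of b] a0[of b] that unfolding a_def P_def s_def by simp
    show "bath_avg 0 TL (f_block i m) E \<le> ennreal aL"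
      unfolding aL_def P_def s_def by (rule bath_avg_f_block[OF E im]) auto
    show "bath_avg (N - 1) TR (f_block i m) E \<le> ennreal aR"
      unfolding aR_def P_def s_def by (rule bath_avg_f_block[OF E im]) auto
    show "f_block i m E \<le> ennreal P" by (simp add: f_block_def P_def s_def)
  qed (rule aL0 aR0 P0)+
  also have "\<dots> \<le> ennreal (P - w0 * P + 2 * bath_const + nbr_const * (xL + xR))"
  proof (rule ennreal_leI)
    define BL where "BL = - (w0 * P) / 2 + nbr_const * xL"
    define BR where "BR = - (w0 * P) / 2 + nbr_const * xR"
    have "(\<Sum>b<N - 1. w_bond b E * (a b - P))
        \<le> (\<Sum>b<N - 1. (if Suc b = i then BL else 0) + (if Suc b = i + m then BR else 0))"
    proof (rule sum_mono)
      fix b assume "b \<in> {..<N - 1}"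
      then have b: "b < N - 1" by simp
      have pos: "E b > 0" "E (Suc b) > 0" using Omega_pos[OF E] b by auto
      have ge: "E j \<le> s" if "i \<le> j" "j < i + m" for j
        unfolding s_def using block_ge_site[OF E im(1) that] .
      consider (L) "Suc b = i" | (R) "Suc b = i + m" | (O) "Suc b \<noteq> i" "Suc b \<noteq> i + m" by blast
      then show "w_bond b E * (a b - P) \<le> (if Suc b = i then BL else 0) + (if Suc b = i + m then BR else 0)"
      proof cases
        case L
        have "w_bond b E \<le> sqrt (E (Suc b))" by (rule w_bond_le_sqrt[OF E b])
        also have "\<dots> \<le> sqrt s" using ge[of "Suc b"] L im by simp
        finally have "w_bond b E * (max s (E (Suc b) + E b) powr (- q) / (1 - q) - s powr (- q))
          \<le> - (w0 * s powr (- q)) / 2 + nbr_const * (s + E b) powr (1/2 - q)"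
          unfolding nbr_const_def using ge[of "Suc b"] L im q pos w0(1) w0(2)[OF b]
          by (intro block_end_estimate) auto
        moreover have "s + E b = block_sum (i - 1) (Suc m) E"
          using L block_sum_Suc_left[of b m E] by (auto simp: s_def)
        ultimately show ?thesis using L im by (simp add: a_def P_def BL_def xL_def add.commute)
      next
        case R
        have "w_bond b E \<le> sqrt (E b)" by (rule w_bond_le_sqrt[OF E b])
        also have "\<dots> \<le> sqrt s" using ge[of b] R im by simp
        finally have "w_bond b E * (max s (E b + E (Suc b)) powr (- q) / (1 - q) - s powr (- q))
          \<le> - (w0 * s powr (- q)) / 2 + nbr_const * (s + E (Suc b)) powr (1/2 - q)"
          unfolding nbr_const_def using ge[of b] R im q pos w0(1) w0(2)[OF b]
          by (intro block_end_estimate) auto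
        moreover have "s + E (Suc b) = block_sum i (Suc m) E"
          using R by (simp add: block_sum_Suc_right s_def)
        moreover have "i + m < N" using R b by linarith
        ultimately show ?thesis using R im by (simp add: a_def P_def BR_def xR_def)
      qed (simp add: a_def)
    qed
    also have "\<dots> = (if 0 < i then BL else 0) + (if i + m < N then BR else 0)"
    proof -
      have "(\<Sum>b<N - 1. if Suc b = k then B else 0) = (if 0 < k \<and> k < N then B else 0)" for k and B :: real
      proof (cases k)
        case (Suc k')
        then show ?thesis by (auto simp: sum.delta)
      qed simp
      then show ?thesis using im by (simp add: sum.distrib)
    qed
    finally have bonds: "(\<Sum>b<N - 1. w_bond b E * (a b - P)) \<le> (if 0 < i then BL else 0) + (if i + m < N then BR else 0)" .
    have bath: "w * (bath_const - P) \<le> bath_const - (w0 * P) / 2" if "w0 \<le> w" "w \<le> 1" for w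
    proof -
      have "w * bath_const \<le> 1 * bath_const" using that bath_const_pos by (intro mult_right_mono) auto
      moreover have "w0 * P \<le> w * P" using that P0 by (intro mult_right_mono) auto
      moreover have "0 \<le> w0 * P" using w0(1) P0 by simp
      ultimately show ?thesis by (simp add: algebra_simps)
    qed
    have nx: "0 \<le> nbr_const * xL" "0 \<le> nbr_const * xR" using nbr_const_pos xL0 xR0 by auto
    have left: "(if 0 < i then BL else 0) + w_left E * (aL - P) \<le> - (w0 * P) / 2 + bath_const + nbr_const * xL"
      using bath[OF w0(3) w_le_1(2)[of E]] nx im bath_const_pos by (auto simp: BL_def aL_def)
    have right: "(if i + m < N then BR else 0) + w_right E * (aR - P) \<le> - (w0 * P) / 2 + bath_const + nbr_const * xR"
    proof (cases "i + m < N")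
      case True
      then show ?thesis using bath_const_pos by (auto simp: BR_def aR_def)
    next
      case False
      then show ?thesis using bath[OF w0(4) w_le_1(3)[of E]] nx im by (auto simp: aR_def)
    qed
    have "(\<Sum>b<N - 1. w_bond b E * a b) + w_left E * aL + w_right E * aR + w_stay E * P
       = (\<Sum>b<N - 1. w_bond b E * (a b - P)) + w_left E * (aL - P) + w_right E * (aR - P)
         + ((\<Sum>b<N - 1. w_bond b E) + w_left E + w_right E + w_stay E) * P"
    proof -
      have "(\<Sum>b<N - 1. w_bond b E * a b) = (\<Sum>b<N - 1. w_bond b E * (a b - P)) + (\<Sum>b<N - 1. w_bond b E) * P"
        by (simp only: sum_distrib_right right_diff_distrib sum_subtractf)
      then show ?thesis by (simp only: distrib_right right_diff_distrib)
    qed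
    also have "\<dots> \<le> P - w0 * P + 2 * bath_const + nbr_const * (xL + xR)"
      unfolding w_sum using bonds left right by (simp add: algebra_simps)
    finally show "(\<Sum>b<N - 1. w_bond b E * a b) + w_left E * aL + w_right E * aR + w_stay E * P
       \<le> P - w0 * P + 2 * bath_const + nbr_const * (xL + xR)" .
  qed
  finally show ?thesis by (simp add: P_def s_def w0_def xL_def xR_def)
qed

section \<open>The weighted sum over all blocks as Lyapunov function\<close>

definition blocks :: "(nat \<times> nat) set" where
  "blocks = {(i, m). 1 \<le> m \<and> i + m \<le> N}"

text \<open>Unlike in \<open>V\<close>, the exponent is \<open>- q\<close> for every block length;
  the dependence on the length is moved into the weights \<open>c m\<close>. The summand 1 makes
  values at least 1.\<close>

definition V_fun :: "(nat \<Rightarrow> real) \<Rightarrow> (nat \<Rightarrow> real) \<Rightarrow> real" where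
  "V_fun c E = 1 + (\<Sum>(i, m)\<in>blocks. c m * block_sum i m E powr (- q))"

lemma finite_blocks: "finite blocks"
  by (rule finite_subset[of _ "{..N} \<times> {..N}"]) (auto simp: blocks_def)

lemma V_fun_meas: "V_fun c \<in> borel_measurable S"
  unfolding V_fun_def case_prod_beta
  by (intro borel_measurable_add borel_measurable_sum borel_measurable_times borel_measurable_const
      measurable_compose[OF block_meas]) (auto simp: blocks_def)

lemma V_fun_ge_block:
  assumes "\<And>m. c m \<ge> 1" "(i, m) \<in> blocks"
  shows "c m * block_sum i m E powr (- q) \<le> V_fun c E - 1"
proof -
  have "c m' \<ge> 0" for m' using assms(1)[of m'] by simp
  then have "(\<lambda>(i, m). c m * block_sum i m E powr (- q)) (i, m) \<le> (\<Sum>(i, m)\<in>blocks. c m * block_sum i m E powr (- q))"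
    by (intro member_le_sum[OF assms(2) _ finite_blocks]) auto
  then show ?thesis by (simp add: V_fun_def)
qed

lemma V_fun_ge_site:
  assumes "\<And>m. c m \<ge> 1" "l < N"
  shows "E l powr (- q) \<le> V_fun c E - 1"
proof -
  have "1 * block_sum l 1 E powr (- q) \<le> c 1 * block_sum l 1 E powr (- q)"
    using assms(1) by (intro mult_right_mono) auto
  also have "\<dots> \<le> V_fun c E - 1" by (rule V_fun_ge_block) (use assms in \<open>auto simp: blocks_def\<close>)
  finally show ?thesis by (simp add: block_sum_def)
qed

text \<open>With \<open>Q\<close> the sum over blocks and \<open>n\<close> their number, the losses
  add up to \<open>w_min E * Q\<close>, and the at most \<open>2 * n\<close> enlarged-block terms
  cost at most half of this up to a constant. The surviving half is compared with a power of
  \<open>Q\<close> through the site of lowest energy.\<close>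

lemma V_drift:
  obtains c a b where "\<And>m. c m \<ge> 1" "a > 0" "b \<ge> 0"
    "\<And>E. E \<in> Omega \<Longrightarrow> jump (\<lambda>E. if E \<in> Omega then ennreal (V_fun c E) else \<top>) E
        \<le> ennreal (V_fun c E - a * V_fun c E powr (1 - 1/(2*q)) + b)"
proof -
  define n where "n = real (card blocks)"
  have "(0, 1) \<in> blocks" using N by (simp add: blocks_def)
  then have n: "n > 0" using finite_blocks by (auto simp: n_def card_gt_0_iff)
  \<comment> \<open>Sized so that each enlarged-block term costs at most
    \<open>w_min E * Q / (4 * n)\<close> plus a constant.\<close>
  define M where "M = 8 * n * nbr_const * lam"
  have M: "M > 0" using n nbr_const_pos lam_pos by (simp add: M_def)
  obtain c where c1: "\<And>m. c m \<ge> 1" and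
    c2: "\<And>m h. 0 < h \<Longrightarrow> h \<le> 1 \<Longrightarrow> M * c m \<le> c (Suc m) * h powr (1/2) + h powr (1/2 - q)"
    using exists_block_weights[OF q(1) M] by blast
  have c0: "c m \<ge> 0" for m using c1[of m] by simp
  define cs where "cs = (\<Sum>m\<le>N. c m)"
  have cs: "c m \<le> cs" if "m \<le> N" for m
    unfolding cs_def using that c0 by (intro member_le_sum) auto
  have cs0: "cs \<ge> 0" unfolding cs_def using c0 by (intro sum_nonneg) auto
  define D where "D = nbr_const * cs * tau powr (1/2 - q)"
  have D: "D \<ge> 0" using nbr_const_pos cs0 by (simp add: D_def)
  define b1 where "b1 = n * (cs * (2 * bath_const) + 2 * D)"
  have b1: "b1 \<ge> 0" using n cs0 bath_const_pos D by (simp add: b1_def)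
  define \<kappa> where "\<kappa> = 1 - 1/(2*q)"
  have kap: "0 < \<kappa>" "\<kappa> < 1" using q by (auto simp: \<kappa>_def field_simps)
  have ext: "c m * (nbr_const * block_sum i (Suc m) E powr (1/2 - q)) \<le> w_min E * (V_fun c E - 1) / (4 * n) + D"
    if E: "E \<in> Omega" and im: "(i, Suc m) \<in> blocks" for i m E
  proof -
    define Q where "Q = V_fun c E - 1"
    define e where "e = Min (E ` {..<N})"
    obtain l where l: "l < N" "e = E l" using Min_site(3)[OF E] by (auto simp: e_def)
    have e0: "e > 0" using Min_site(1)[OF E] by (simp add: e_def)
    have Qe: "e powr (- q) \<le> Q" using V_fun_ge_site[OF c1 l(1)] l(2) by (simp add: Q_def)
    then have Q0: "Q \<ge> 0" by (rule order_trans[rotated]) simp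
    define s where "s = block_sum i (Suc m) E"
    have im': "i + Suc m \<le> N" "i < N" using im by (auto simp: blocks_def)
    have es: "e \<le> s"
      using Min_site(2)[OF E im'(2)] block_ge_site[OF E im'(1), of i] by (simp add: e_def s_def)
    have s0: "s > 0" using es e0 by simp
    have Qs: "c (Suc m) * s powr (- q) \<le> Q" using V_fun_ge_block[OF c1 im] by (simp add: Q_def s_def)
    show ?thesis
    proof (cases "e \<le> tau")
      case True
      then have w: "lam * w_min E = e powr (1/2)"
        using lam_pos e0 by (simp add: w_min_def e_def[symmetric] powr_half_sqrt)
      \<comment> \<open>The weight inequality is used with \<open>h = e / s\<close> and multiplied
        by \<open>s powr (1/2 - q)\<close>. Both terms on the right then carry the factor
        \<open>e powr (1/2)\<close>, the lowest clock rate, times a summand controlled by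
        \<open>Q\<close>.\<close>
      have "M * c m * s powr (1/2 - q) \<le> (c (Suc m) * (e/s) powr (1/2) + (e/s) powr (1/2 - q)) * s powr (1/2 - q)"
        using c2[of "e/s" m] e0 es s0 by (intro mult_right_mono) auto
      also have "\<dots> = c (Suc m) * ((e/s) powr (1/2) * s powr (1/2 - q)) + (e/s) powr (1/2 - q) * s powr (1/2 - q)"
        by (simp add: algebra_simps)
      also have "(e/s) powr (1/2) * s powr (1/2 - q) = e powr (1/2) * s powr (- q)"
      proof -
        have eq: "s powr (1/2 - q) = s powr (1/2) * s powr (- q)" by (simp flip: powr_add)
        show ?thesis unfolding powr_divide eq using s0 by simp
      qed
      also have "(e/s) powr (1/2 - q) * s powr (1/2 - q) = e powr (1/2) * e powr (- q)"
        using e0 s0 by (simp add: powr_divide flip: powr_add)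
      also have "c (Suc m) * (e powr (1/2) * s powr (- q)) + e powr (1/2) * e powr (- q)
          = e powr (1/2) * (c (Suc m) * s powr (- q) + e powr (- q))" by (simp add: algebra_simps)
      also have "\<dots> \<le> e powr (1/2) * (Q + Q)" using Qe Qs by (intro mult_left_mono add_mono) auto
      finally have "M * c m * s powr (1/2 - q) \<le> 2 * (lam * w_min E) * Q" by (simp add: w)
      then have "8 * n * lam * (c m * (nbr_const * s powr (1/2 - q))) \<le> 2 * lam * (w_min E * Q)"
        by (simp add: M_def ac_simps)
      then have "c m * (nbr_const * s powr (1/2 - q)) \<le> w_min E * Q / (4 * n)"
        using lam_pos n by (simp add: field_simps)
      then show ?thesis using D by (simp add: s_def Q_def)
    next
      case False
      then have "s powr (1/2 - q) \<le> tau powr (1/2 - q)"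
        using es tau_pos q by (intro powr_mono2') auto
      then have "c m * (nbr_const * s powr (1/2 - q)) \<le> cs * (nbr_const * tau powr (1/2 - q))"
        using cs[of m] im' cs0 nbr_const_pos by (intro mult_mono) auto
      moreover have "0 \<le> w_min E * Q / (4 * n)" using w_min_bounds(1)[OF E] Q0 n by simp
      ultimately show ?thesis by (simp add: s_def Q_def D_def ac_simps)
    qed
  qed
  have jumpV: "jump (\<lambda>E. if E \<in> Omega then ennreal (V_fun c E) else \<top>) E
      \<le> ennreal (V_fun c E + b1 - w_min E * (V_fun c E - 1) / 2)" if E: "E \<in> Omega" for E
  proof -
    define Q where "Q = V_fun c E - 1"
    define w where "w = w_min E"
    define g where "g = (\<lambda>E. 1 + (\<Sum>(i, m)\<in>blocks. ennreal (c m) * f_block i m E))"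
    have gV: "g y = ennreal (V_fun c y)" for y
      unfolding g_def V_fun_def f_block_def case_prod_beta using c0
      by (subst ennreal_plus) (auto simp: ennreal_mult sum_nonneg simp flip: sum_ennreal)
    have fb: "f_block (fst x) (snd x) \<in> borel_measurable S" if "x \<in> blocks" for x
      using that by (auto simp: blocks_def)
    have "jump (\<lambda>E. if E \<in> Omega then ennreal (V_fun c E) else \<top>) E \<le> jump g E"
      by (rule jump_mono) (use E in \<open>auto simp: gV\<close>)
    also have "jump g E = 1 + (\<Sum>(i, m)\<in>blocks. ennreal (c m) * jump (f_block i m) E)"
      unfolding g_def case_prod_beta using fb Omega_space[OF E]
      by (simp add: add const sum[OF finite_blocks] cmult)
    also have "\<dots> \<le> 1 + (\<Sum>(i, m)\<in>blocks. ennreal (c m * (block_sum i m E powr (- q) - w * block_sum i m E powr (- q))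
         + cs * (2 * bath_const) + 2 * (w * Q / (4 * n) + D)))"
    proof (intro add_left_mono sum_mono, clarify)
      fix i m assume im: "(i, m) \<in> blocks"
      define xL where "xL = (if 0 < i then block_sum (i - 1) (Suc m) E powr (1/2 - q) else 0)"
      define xR where "xR = (if i + m < N then block_sum i (Suc m) E powr (1/2 - q) else 0)"
      have im': "i + m \<le> N" "1 \<le> m" using im by (auto simp: blocks_def)
      have wQ: "0 \<le> w * Q / (4 * n) + D"
      proof -
        have "0 \<le> Q" using order_trans[OF powr_ge_zero V_fun_ge_site[OF c1 N_less(1)]] by (simp add: Q_def)
        then show ?thesis using w_min_bounds(1)[OF E] n D by (simp add: w_def)
      qed
      have xL: "c m * (nbr_const * xL) \<le> w * Q / (4 * n) + D"
        using ext[OF E, of "i - 1" m] im wQ unfolding xL_def w_def Q_def by (auto simp: blocks_def)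
      have xR: "c m * (nbr_const * xR) \<le> w * Q / (4 * n) + D"
        using ext[OF E, of i m] im wQ unfolding xR_def w_def Q_def by (auto simp: blocks_def)
      have "ennreal (c m) * jump (f_block i m) E \<le> ennreal (c m) * ennreal (block_sum i m E powr (- q) - w * block_sum i m E powr (- q)
          + 2 * bath_const + nbr_const * (xL + xR))"
        unfolding xL_def xR_def w_def by (intro mult_left_mono jump_f_block E im') auto
      also have "\<dots> = ennreal (c m * (block_sum i m E powr (- q) - w * block_sum i m E powr (- q)
          + 2 * bath_const + nbr_const * (xL + xR)))"
        by (rule ennreal_mult'[symmetric]) (rule c0)
      also have "\<dots> \<le> ennreal (c m * (block_sum i m E powr (- q) - w * block_sum i m E powr (- q))
         + cs * (2 * bath_const) + 2 * (w * Q / (4 * n) + D))"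
      proof (rule ennreal_leI)
        have "c m * (2 * bath_const) \<le> cs * (2 * bath_const)"
          using cs[of m] im' bath_const_pos by (intro mult_right_mono) auto
        then show "c m * (block_sum i m E powr (- q) - w * block_sum i m E powr (- q) + 2 * bath_const + nbr_const * (xL + xR))
          \<le> c m * (block_sum i m E powr (- q) - w * block_sum i m E powr (- q)) + cs * (2 * bath_const) + 2 * (w * Q / (4 * n) + D)"
          using xL xR by (simp only: distrib_left)
      qed
      finally show "ennreal (c m) * jump (f_block i m) E \<le> ennreal (c m * (block_sum i m E powr (- q) - w * block_sum i m E powr (- q))
         + cs * (2 * bath_const) + 2 * (w * Q / (4 * n) + D))" .
    qed
    also have "\<dots> = ennreal (V_fun c E + b1 - w * Q / 2)"
    proof -
      have w1: "w \<le> 1" using w_min_bounds(3)[OF E] w_le_1(2)[of E] by (simp add: w_def)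
      have nn: "0 \<le> c m * (block_sum i m E powr (- q) - w * block_sum i m E powr (- q))
         + cs * (2 * bath_const) + 2 * (w * Q / (4 * n) + D)" for i m
      proof -
        have "0 \<le> Q" using order_trans[OF powr_ge_zero V_fun_ge_site[OF c1 N_less(1)]] by (simp add: Q_def)
        then have "0 \<le> w * Q / (4 * n)" using w_min_bounds(1)[OF E] n by (simp add: w_def)
        moreover have "w * block_sum i m E powr (- q) \<le> 1 * block_sum i m E powr (- q)" using w1 by (intro mult_right_mono) auto
        ultimately show ?thesis using c0[of m] cs0 bath_const_pos D by (intro add_nonneg_nonneg mult_nonneg_nonneg) auto
      qed
      have QS: "Q = (\<Sum>(i, m)\<in>blocks. c m * block_sum i m E powr (- q))" by (simp add: Q_def V_fun_def)
      have "(\<Sum>(i, m)\<in>blocks. c m * (block_sum i m E powr (- q) - w * block_sum i m E powr (- q))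
         + cs * (2 * bath_const) + 2 * (w * Q / (4 * n) + D))
         = (\<Sum>(i, m)\<in>blocks. (1 - w) * (c m * block_sum i m E powr (- q))) + n * (cs * (2 * bath_const) + 2 * (w * Q / (4 * n) + D))"
      proof -
        define r where "r = cs * (2 * bath_const) + 2 * (w * Q / (4 * n) + D)"
        have "(\<Sum>(i, m)\<in>blocks. c m * (block_sum i m E powr (- q) - w * block_sum i m E powr (- q))
            + cs * (2 * bath_const) + 2 * (w * Q / (4 * n) + D))
          = (\<Sum>(i, m)\<in>blocks. (1 - w) * (c m * block_sum i m E powr (- q)) + r)"
          by (intro sum.cong refl) (auto simp: r_def algebra_simps)
        also have "\<dots> = (\<Sum>(i, m)\<in>blocks. (1 - w) * (c m * block_sum i m E powr (- q))) + n * r"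
          unfolding case_prod_beta sum.distrib by (simp add: n_def)
        finally show ?thesis by (simp only: r_def)
      qed
      also have "(\<Sum>(i, m)\<in>blocks. (1 - w) * (c m * block_sum i m E powr (- q))) = (1 - w) * Q"
        unfolding QS by (simp add: case_prod_beta sum_distrib_left)
      also have "1 + ((1 - w) * Q + n * (cs * (2 * bath_const) + 2 * (w * Q / (4 * n) + D))) = V_fun c E + b1 - w * Q / 2"
        using n by (simp add: Q_def b1_def field_simps)
      finally have eq: "1 + (\<Sum>(i, m)\<in>blocks. c m * (block_sum i m E powr (- q) - w * block_sum i m E powr (- q))
         + cs * (2 * bath_const) + 2 * (w * Q / (4 * n) + D)) = V_fun c E + b1 - w * Q / 2" by simp
      show ?thesis
        unfolding eq[symmetric] case_prod_beta using nn
        by (subst ennreal_plus) (auto simp: sum_nonneg sum_ennreal)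
    qed
    finally show ?thesis by (simp add: w_def Q_def)
  qed
  \<comment> \<open>The smaller of the rates of loss in the two regimes below,
    \<open>e \<le> tau\<close> and \<open>e > tau\<close>.\<close>
  define a0 where "a0 = min 1 (sqrt tau) / (2 * lam)"
  have a0: "a0 > 0" using tau_pos lam_pos by (simp add: a0_def)
  have loss: "w_min E * (V_fun c E - 1) / 2 \<ge> a0 / 2 * V_fun c E powr \<kappa> - 2 * a0" if E: "E \<in> Omega" for E
  proof -
    define Q where "Q = V_fun c E - 1"
    define e where "e = Min (E ` {..<N})"
    obtain l where l: "l < N" "e = E l" using Min_site(3)[OF E] by (auto simp: e_def)
    have e0: "e > 0" using Min_site(1)[OF E] by (simp add: e_def)
    have Qe: "e powr (- q) \<le> Q" using V_fun_ge_site[OF c1 l(1)] l(2) by (simp add: Q_def)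
    have Q0: "Q > 0" using Qe e0 by (smt (verit) powr_gt_zero)
    have Qk: "Q powr \<kappa> \<le> 1 + Q"
    proof (cases "Q \<le> 1")
      case True
      then show ?thesis using Q0 powr_le1[of \<kappa> Q] kap by simp
    next
      case False
      then show ?thesis using powr_mono[of \<kappa> 1 Q] kap by simp
    qed
    have "a0 * (Q powr \<kappa> - 1) \<le> w_min E * Q / 2"
    proof (cases "e \<le> tau")
      case True
      then have w: "w_min E = e powr (1/2) / lam"
        using e0 by (simp add: w_min_def e_def[symmetric] powr_half_sqrt)
      \<comment> \<open>Source of the exponent \<open>1 - 1/(2*q)\<close>: from
        \<open>Q \<ge> e powr (- q)\<close> the lowest rate satisfies
        \<open>e powr (1/2) \<ge> Q powr (- 1/(2*q))\<close>.\<close>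
      have "Q powr (- 1/(2*q)) \<le> (e powr (- q)) powr (- 1/(2*q))"
        using Qe e0 q by (intro powr_mono2') auto
      also have "\<dots> = e powr (1/2)" using q by (simp add: powr_powr)
      finally have "Q powr (- 1/(2*q)) * Q \<le> e powr (1/2) * Q" using Q0 by (intro mult_right_mono) auto
      moreover have "Q powr \<kappa> = Q powr (- 1/(2*q)) * Q"
        using Q0 by (simp add: \<kappa>_def powr_diff powr_minus field_simps)
      ultimately have 1: "Q powr \<kappa> \<le> e powr (1/2) * Q" by simp
      have "a0 * (Q powr \<kappa> - 1) \<le> a0 * Q powr \<kappa>" using a0 by simp
      also have "\<dots> \<le> 1 / (2 * lam) * Q powr \<kappa>"
        using lam_pos by (intro mult_right_mono) (auto simp: a0_def divide_right_mono)
      also have "\<dots> \<le> 1 / (2 * lam) * (e powr (1/2) * Q)" using 1 lam_pos by (intro mult_left_mono) auto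
      finally show ?thesis by (simp add: w)
    next
      case False
      then have w: "w_min E = sqrt tau / lam" by (simp add: w_min_def e_def[symmetric])
      have "a0 * (Q powr \<kappa> - 1) \<le> a0 * Q" using a0 Qk by (intro mult_left_mono) auto
      also have "\<dots> \<le> sqrt tau / (2 * lam) * Q"
        using lam_pos Q0 by (intro mult_right_mono) (auto simp: a0_def divide_right_mono)
      finally show ?thesis by (simp add: w)
    qed
    moreover have "V_fun c E powr \<kappa> \<le> 2 * (1 + Q powr \<kappa>)"
    proof -
      define m where "m = max 1 Q"
      have "V_fun c E powr \<kappa> \<le> (2 * m) powr \<kappa>"
        using Q0 kap by (intro powr_mono2) (auto simp: Q_def m_def max_def)
      also have "\<dots> = 2 powr \<kappa> * m powr \<kappa>" by (rule powr_mult)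
      also have "\<dots> \<le> 2 * (1 + Q powr \<kappa>)"
      proof (rule mult_mono)
        show "2 powr \<kappa> \<le> 2" using powr_mono[of \<kappa> 1 2] kap by simp
        show "m powr \<kappa> \<le> 1 + Q powr \<kappa>" by (simp add: m_def max_def)
      qed auto
      finally show ?thesis .
    qed
    then have "a0 / 2 * V_fun c E powr \<kappa> \<le> a0 / 2 * (2 * (1 + Q powr \<kappa>))" using a0 by (intro mult_left_mono) auto
    ultimately show ?thesis by (simp add: Q_def algebra_simps)
  qed
  show ?thesis
  proof (rule that[of c "a0 / 2" "b1 + 2 * a0"])
    fix E assume E: "E \<in> Omega"
    have "V_fun c E + b1 - w_min E * (V_fun c E - 1) / 2 \<le> V_fun c E - a0 / 2 * V_fun c E powr (1 - 1/(2*q)) + (b1 + 2 * a0)"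
      using loss[OF E] by (simp add: \<kappa>_def)
    then show "jump (\<lambda>E. if E \<in> Omega then ennreal (V_fun c E) else \<top>) E
        \<le> ennreal (V_fun c E - a0 / 2 * V_fun c E powr (1 - 1/(2*q)) + (b1 + 2 * a0))"
      using order_trans[OF jumpV[OF E] ennreal_leI] by blast
  qed (use c1 a0 b1 in auto)
qed

end

section \<open>Drift of the total energy\<close>

lemma ennreal_add_le_imp_le_diff:
  assumes "a + ennreal y \<le> ennreal x" "0 \<le> y"
  shows "a \<le> ennreal (x - y)"
proof (cases a)
  case (real r)
  then have "ennreal (r + y) \<le> ennreal x" using assms by simp
  then have "r + y \<le> x \<or> r + y \<le> 0" by (auto simp only: ennreal_le_iff2)
  then have "r \<le> x - y \<or> r = 0" using real assms by auto
  then show ?thesis using real by (auto simp: ennreal_leI)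
qed (use assms in \<open>simp add: top_unique\<close>)

lemma nn_integral_unif01_id: "(\<integral>\<^sup>+p. ennreal p \<partial>unif01) \<le> ennreal (1/2)"
proof -
  have "(\<integral>\<^sup>+p. ennreal p \<partial>unif01) = (\<integral>\<^sup>+p. ennreal p * indicator {0<..<1} p \<partial>lborel)"
    by (rule nn_integral_unif01) measurable
  also have "\<dots> \<le> (\<integral>\<^sup>+p. ennreal (p powr (- (-1))) * indicator {0..1} p \<partial>lborel)"
    by (intro nn_integral_mono) (auto simp: indicator_def)
  also have "\<dots> = ennreal (1 / (1 - (-1)))" by (rule nn_integral_powr_01) simp
  finally show ?thesis by simp
qed

lemma nn_integral_expo_id:
  assumes "T > 0"
  shows "(\<integral>\<^sup>+x. ennreal x \<partial>expo T) \<le> ennreal T"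
proof -
  have "(\<integral>\<^sup>+x. ennreal x \<partial>expo T) = (\<integral>\<^sup>+x. ennreal (exponential_density (1/T) x) * ennreal x \<partial>lborel)"
    by (rule nn_integral_expo) measurable
  also have "\<dots> = (\<integral>\<^sup>+x. ennreal (exponential_density (1/T) x * x ^ 1) \<partial>lborel)"
    using assms by (intro nn_integral_cong) (auto simp: exponential_density_def ennreal_mult'[symmetric])
  also have "\<dots> = ennreal (fact (0 + 1) / (fact 0 * (1/T) ^ 1))"
    using assms by (subst nn_integral_erlang_ith_moment) auto
  finally show ?thesis by simp
qed

context energy_exchange
begin

definition W_inf :: "(nat \<Rightarrow> real) \<Rightarrow> ennreal" where
  "W_inf E = ennreal (W N E)"

text \<open>Mean energy that site \<open>N - 1\<close> gives up in one jump through the right bath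
  clock, since \<open>p\<close> has mean 1/2. It is 0 off \<open>Omega\<close>, where the chain is
  frozen.\<close>

definition right_flux :: "(nat \<Rightarrow> real) \<Rightarrow> ennreal" where
  "right_flux E = (if E \<in> Omega then ennreal (w_right E * E (N - 1) / 2) else 0)"

lemma W_eq_block: "W N E = block_sum 0 N E"
  by (simp add: W_def block_sum_def)

lemma W_meas: "(\<lambda>E. W N E) \<in> borel_measurable S"
  unfolding W_def by (intro borel_measurable_sum component_meas) auto

lemma W_inf_meas[measurable]: "W_inf \<in> borel_measurable S"
  unfolding W_inf_def using W_meas by measurable

lemma right_flux_meas[measurable]: "right_flux \<in> borel_measurable S"
proof -
  have [measurable]: "(\<lambda>E. E (N - 1)) \<in> borel_measurable S" by (rule component_meas) simp
  show ?thesis unfolding right_flux_def by measurable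
qed

lemma W_ge_site: "E \<in> Omega \<Longrightarrow> j < N \<Longrightarrow> E j \<le> W N E"
  unfolding W_def by (rule member_le_sum) (auto intro!: less_imp_le Omega_pos)

lemma W_nonneg: "E \<in> Omega \<Longrightarrow> 0 \<le> W N E"
  unfolding W_def by (intro sum_nonneg) (auto intro!: less_imp_le Omega_pos)

lemma bond_avg_W:
  assumes "Suc b < N"
  shows "bond_avg b W_inf E = ennreal (W N E)"
proof -
  have "W N (bond_upd b p E) = W N E" for p
    unfolding W_eq_block bond_upd_def block_sum_upd using assms by (auto simp: algebra_simps)
  then show ?thesis
    unfolding bond_avg_def W_inf_def using prob_space.emeasure_space_1[OF prob_space_unif01] by simp
qed

lemma bath_avg_W:
  assumes E: "E \<in> Omega" and j: "j < N" and T: "T > 0"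
  shows "bath_avg j T W_inf E \<le> ennreal (W N E - E j / 2 + T / 2)"
proof -
  define r where "r = W N E - E j"
  have r: "r \<ge> 0" using W_ge_site[OF E j] by (simp add: r_def)
  have Ej: "E j > 0" using Omega_pos[OF E j] .
  have "bath_avg j T W_inf E \<le> (\<integral>\<^sup>+p. (\<integral>\<^sup>+x. (ennreal r + ennreal (E j) * ennreal p) + ennreal p * ennreal x \<partial>expo T) \<partial>unif01)"
    unfolding bath_avg_def W_inf_def
  proof (intro nn_integral_mono_AE AE_mp[OF AE_unif01 AE_I2] impI AE_mp[OF AE_expo[OF T] AE_I2])
    fix p x :: real assume p: "0 < p \<and> p < 1" and x: "0 < x"
    have "W N (bath_upd j p x E) = r + E j * p + p * x"
      unfolding W_eq_block bath_upd_def block_sum_upd using j by (simp add: r_def W_eq_block algebra_simps)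
    then show "ennreal (W N (bath_upd j p x E)) \<le> ennreal r + ennreal (E j) * ennreal p + ennreal p * ennreal x"
      using p x r Ej by (simp add: ennreal_mult)
  qed
  also have "\<dots> = (\<integral>\<^sup>+p. (ennreal r + ennreal (E j) * ennreal p) + ennreal p * (\<integral>\<^sup>+x. ennreal x \<partial>expo T) \<partial>unif01)"
  proof (intro nn_integral_cong)
    fix p
    show "(\<integral>\<^sup>+x. (ennreal r + ennreal (E j) * ennreal p) + ennreal p * ennreal x \<partial>expo T)
      = (ennreal r + ennreal (E j) * ennreal p) + ennreal p * (\<integral>\<^sup>+x. ennreal x \<partial>expo T)"
      using prob_space.emeasure_space_1[OF prob_space_expo[OF T]]
      by (subst nn_integral_add) (auto simp: nn_integral_cmult)
  qed
  also have "\<dots> = ennreal r + ennreal (E j) * (\<integral>\<^sup>+p. ennreal p \<partial>unif01) + (\<integral>\<^sup>+p. ennreal p \<partial>unif01) * (\<integral>\<^sup>+x. ennreal x \<partial>expo T)"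
    using prob_space.emeasure_space_1[OF prob_space_unif01]
    by (subst nn_integral_add) (auto simp: nn_integral_add nn_integral_cmult nn_integral_multc)
  also have "\<dots> \<le> ennreal r + ennreal (E j) * ennreal (1/2) + ennreal (1/2) * ennreal T"
    using nn_integral_unif01_id nn_integral_expo_id[OF T] by (intro add_mono mult_mono order_refl) auto
  also have "\<dots> = ennreal (r + E j * (1/2) + 1/2 * T)"
  proof -
    have "(0::real) \<le> 1/2" by simp
    then show ?thesis
      using r Ej T by (simp only: ennreal_plus ennreal_mult add_nonneg_nonneg mult_nonneg_nonneg less_imp_le)
  qed
  also have "r + E j * (1/2) + 1/2 * T = W N E - E j / 2 + T / 2" by (simp add: r_def field_simps)
  finally show ?thesis .
qed

text \<open>Energy balance of one jump: bonds conserve \<open>W\<close>, a bath update halves its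
  site on average and injects half of the bath temperature. The outflow stands on the left as a
  summand because subtraction in \<open>ennreal\<close> truncates; outflow into the left bath is
  simply estimated away.\<close>

lemma jump_W:
  assumes E: "E \<in> Omega"
  shows "jump W_inf E + right_flux E \<le> ennreal (W N E + (TL + TR) / 2)"
proof -
  define w where "w = W N E"
  define aL where "aL = w - E 0 / 2 + TL / 2"
  define aR where "aR = w - E (N - 1) / 2 + TR / 2"
  have w: "w \<ge> 0" using W_nonneg[OF E] by (simp add: w_def)
  have e: "E 0 > 0" "E (N - 1) > 0" using Omega_pos[OF E] by auto
  have a0: "aL \<ge> 0" "aR \<ge> 0"
    using W_ge_site[OF E, of 0] W_ge_site[OF E, of "N - 1"] e TL TR by (auto simp: aL_def aR_def w_def)
  note wn = w_nonneg[OF E]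
  have bonds: "bond_avg b W_inf E \<le> ennreal w \<and> 0 \<le> w" if "b < N - 1" for b
    using bond_avg_W[of b E] that w by (simp add: w_def)
  have left: "bath_avg 0 TL W_inf E \<le> ennreal aL" unfolding aL_def w_def by (rule bath_avg_W[OF E _ TL]) simp
  have right: "bath_avg (N - 1) TR W_inf E \<le> ennreal aR" unfolding aR_def w_def by (rule bath_avg_W[OF E _ TR]) simp
  have stay: "W_inf E \<le> ennreal w" by (simp add: W_inf_def w_def)
  note le = jump_le[OF E bonds left a0(1) right a0(2) stay w]
  have "jump W_inf E \<le> ennreal ((\<Sum>b<N - 1. w_bond b E * w) + w_left E * aL + w_right E * aR + w_stay E * w)"
    by (rule le(1))
  then have "jump W_inf E + right_flux E \<le> ennreal ((\<Sum>b<N - 1. w_bond b E * w) + w_left E * aL + w_right E * aR + w_stay E * w)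
      + ennreal (w_right E * E (N - 1) / 2)"
    using E by (simp add: right_flux_def add_right_mono)
  also have "\<dots> = ennreal (((\<Sum>b<N - 1. w_bond b E * w) + w_left E * aL + w_right E * aR + w_stay E * w) + w_right E * E (N - 1) / 2)"
  proof (rule ennreal_plus[symmetric])
    show "0 \<le> (\<Sum>b<N - 1. w_bond b E * w) + w_left E * aL + w_right E * aR + w_stay E * w" by (rule le(2))
    show "0 \<le> w_right E * E (N - 1) / 2"
      using mult_nonneg_nonneg[OF wn(3) less_imp_le[OF e(2)]] by simp
  qed
  also have "\<dots> \<le> ennreal (w + (TL + TR) / 2)"
  proof (rule ennreal_leI)
    have "(\<Sum>b<N - 1. w_bond b E * w) = (\<Sum>b<N - 1. w_bond b E) * w" by (simp only: sum_distrib_right)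
    then have "((\<Sum>b<N - 1. w_bond b E * w) + w_left E * aL + w_right E * aR + w_stay E * w) + w_right E * E (N - 1) / 2
        = ((\<Sum>b<N - 1. w_bond b E) + w_left E + w_right E + w_stay E) * w
          + w_left E * (TL - E 0) / 2 + w_right E * TR / 2"
      unfolding aL_def aR_def by (simp only:) (simp add: algebra_simps diff_divide_distrib add_divide_distrib)
    also have "\<dots> = w + w_left E * (TL - E 0) / 2 + w_right E * TR / 2" unfolding w_sum by simp
    also have "\<dots> \<le> w + (TL + TR) / 2"
    proof -
      have "w_left E * (TL - E 0) \<le> w_left E * TL" using wn(2) e by (intro mult_left_mono) auto
      also have "\<dots> \<le> 1 * TL" using w_le_1(2)[of E] TL by (intro mult_right_mono) auto
      finally have 1: "w_left E * (TL - E 0) \<le> TL" by simp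
      have "w_right E * TR \<le> 1 * TR" using w_le_1(3)[of E] TR by (intro mult_right_mono) auto
      then have "w_right E * TR / 2 \<le> TR / 2" by (intro divide_right_mono) auto
      moreover have "w_left E * (TL - E 0) / 2 \<le> TL / 2" using 1 by (intro divide_right_mono) auto
      ultimately have "w + w_left E * (TL - E 0) / 2 + w_right E * TR / 2 \<le> w + TL / 2 + TR / 2"
        by (intro add_mono order_refl)
      then show ?thesis by (simp only: add_divide_distrib add.assoc)
    qed
    finally show "((\<Sum>b<N - 1. w_bond b E * w) + w_left E * aL + w_right E * aR + w_stay E * w) + w_right E * E (N - 1) / 2
        \<le> w + (TL + TR) / 2" .
  qed
  finally show ?thesis by (simp add: w_def)
qed

lemma jump_ge_bond:
  assumes "E \<in> Omega" "i < N - 1"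
  shows "ennreal (w_bond i E) * bond_avg i f E \<le> jump f E"
proof -
  have "ennreal (w_bond i E) * bond_avg i f E \<le> (\<Sum>i<N - 1. ennreal (w_bond i E) * bond_avg i f E)"
    by (rule member_le_sum) (use assms in auto)
  then show ?thesis using assms by (simp add: jump_def add.assoc add_increasing2)
qed

lemma jump_ge_left: "E \<in> Omega \<Longrightarrow> ennreal (w_left E) * bath_avg 0 TL f E \<le> jump f E"
  by (simp add: jump_def add.assoc add_increasing add_increasing2)

text \<open>From a configuration with all energies at least \<open>\<delta>\<close>, with positive probability a fixed fraction of
  the energy of any site travels to the right end and into the bath.\<close>

lemma iterate_right_flux:
  assumes "\<delta> > 0" "k < N"
  shows "\<exists>\<rho>>0. \<forall>E\<in>Omega. (\<forall>i<N. \<delta> \<le> E i) \<longrightarrow> ennreal (\<rho> * E (N - 1 - k)) \<le> (jump ^^ k) right_flux E"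
  using assms
proof (induction k arbitrary: \<delta>)
  case 0
  define \<rho> where "\<rho> = min K (sqrt (min \<delta> TR)) / lam / 2"
  have "\<rho> > 0" using K 0 TR lam_pos by (simp add: \<rho>_def)
  moreover have "ennreal (\<rho> * E (N - 1 - 0)) \<le> (jump ^^ 0) right_flux E" if E: "E \<in> Omega" "\<forall>i<N. \<delta> \<le> E i" for E
  proof -
    have "min K (sqrt (min \<delta> TR)) \<le> rate K (E (N - 1)) TR"
      unfolding rate_def using E(2) by (intro min.mono real_sqrt_le_mono) auto
    then have "\<rho> \<le> w_right E / 2" using lam_pos by (simp add: \<rho>_def divide_right_mono)
    then have "\<rho> * E (N - 1) \<le> w_right E / 2 * E (N - 1)"
      using Omega_pos[OF E(1), of "N - 1"] by (intro mult_right_mono) auto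
    then show ?thesis using E by (simp add: right_flux_def ennreal_leI)
  qed
  ultimately show ?case by blast
next
  case (Suc k)
  \<comment> \<open>With \<open>p\<close> between 1/4 and 3/4 both sites of the bond keep at least a
    quarter of their common energy, so the induction hypothesis is taken at
    \<open>\<delta> / 4\<close>.\<close>
  obtain r where r: "r > 0" and IH: "\<And>E. E \<in> Omega \<Longrightarrow> \<forall>i<N. \<delta> / 4 \<le> E i \<Longrightarrow>
      ennreal (r * E (N - 1 - k)) \<le> (jump ^^ k) right_flux E"
    using Suc.IH[of "\<delta> / 4"] Suc.prems by auto
  define i where "i = N - 1 - Suc k"
  have i: "Suc i = N - 1 - k" "Suc i < N" "i < N - 1" using Suc.prems by (auto simp: i_def)
  \<comment> \<open>First factor: probability that the bond is chosen. The 8 combines the quarter of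
    \<open>E i\<close> that moves on and the probability 1/2 of the window for
    \<open>p\<close>.\<close>
  define \<rho> where "\<rho> = (min K (sqrt \<delta>) / lam) * (r / 8)"
  have "\<rho> > 0" using K Suc.prems lam_pos r by (simp add: \<rho>_def)
  moreover have "ennreal (\<rho> * E (N - 1 - Suc k)) \<le> (jump ^^ Suc k) right_flux E" if E: "E \<in> Omega" "\<forall>i<N. \<delta> \<le> E i" for E
  proof -
    define X where "X = E i + E (Suc i)"
    have e: "\<delta> \<le> E i" "\<delta> \<le> E (Suc i)" using E(2) i by auto
    have ge: "ennreal (r * (E i / 4)) \<le> (jump ^^ k) right_flux (bond_upd i p E)" if p: "p \<in> {1/4..3/4}" for p
    proof -
      have pX: "X / 4 \<le> p * X" "X / 4 \<le> (1 - p) * X"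
        using p e Suc.prems mult_right_mono[of "1/4" p X] mult_right_mono[of "1/4" "1 - p" X] by (auto simp: X_def)
      have "bond_upd i p E \<in> Omega" by (rule bond_upd_Omega) (use E i p in auto)
      moreover have "\<forall>j<N. \<delta> / 4 \<le> bond_upd i p E j"
      proof -
        have "\<delta> \<le> X" using e Suc.prems(1) by (simp add: X_def)
        then have "\<delta> / 4 \<le> p * X" "\<delta> / 4 \<le> (1 - p) * X" using pX by linarith+
        moreover have "\<delta> / 4 \<le> E j" if "j < N" for j using E(2) that Suc.prems(1) by fastforce
        ultimately show ?thesis unfolding bond_upd_def X_def[symmetric] by auto
      qed
      ultimately have "ennreal (r * bond_upd i p E (N - 1 - k)) \<le> (jump ^^ k) right_flux (bond_upd i p E)"
        by (rule IH)
      moreover have "r * (E i / 4) \<le> r * bond_upd i p E (N - 1 - k)"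
      proof (rule mult_left_mono)
        have "E i / 4 \<le> X / 4" using e Suc.prems(1) by (simp add: X_def)
        also have "\<dots> \<le> (1 - p) * X" by (rule pX)
        finally show "E i / 4 \<le> bond_upd i p E (N - 1 - k)"
          unfolding i(1)[symmetric] bond_upd_def X_def[symmetric] by simp
      qed (use r in auto)
      ultimately show ?thesis by (meson ennreal_leI order_trans)
    qed
    have "ennreal (r * (E i / 4)) * emeasure unif01 {1/4..3/4} = (\<integral>\<^sup>+p. ennreal (r * (E i / 4)) * indicator {1/4..3/4} p \<partial>unif01)"
      by (rule nn_integral_cmult_indicator[symmetric]) simp
    also have "\<dots> \<le> bond_avg i ((jump ^^ k) right_flux) E"
      unfolding bond_avg_def
    proof (intro nn_integral_mono)
      fix p
      show "ennreal (r * (E i / 4)) * indicator {1/4..3/4} p \<le> (jump ^^ k) right_flux (bond_upd i p E)"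
      proof (cases "p \<in> {1/4..3/4}")
        case True
        then show ?thesis using ge[OF True] by (simp only: indicator_simps mult_1_right)
      qed simp
    qed
    also have "emeasure unif01 {1/4..3/4} = ennreal (1/2)"
    proof -
      have "{0<..<1} \<inter> {1/4..3/4} = {1/4..3/4 :: real}" by auto
      then show ?thesis unfolding unif01_def by (simp add: divide_ennreal_def)
    qed
    finally have 1: "ennreal (r * (E i / 4)) * ennreal (1/2) \<le> bond_avg i ((jump ^^ k) right_flux) E" .
    have "min K (sqrt \<delta>) \<le> rate K (E i) (E (Suc i))"
      unfolding rate_def using e by (intro min.mono real_sqrt_le_mono) auto
    then have 2: "min K (sqrt \<delta>) / lam \<le> w_bond i E" using lam_pos by (simp add: divide_right_mono)
    have "ennreal (\<rho> * E i) = ennreal (min K (sqrt \<delta>) / lam) * (ennreal (r * (E i / 4)) * ennreal (1/2))"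
    proof -
      have "0 \<le> r * (E i / 4)" "0 \<le> min K (sqrt \<delta>) / lam" using K Suc.prems lam_pos r e by auto
      then have "ennreal (min K (sqrt \<delta>) / lam) * (ennreal (r * (E i / 4)) * ennreal (1/2))
          = ennreal (min K (sqrt \<delta>) / lam * (r * (E i / 4) * (1/2)))"
        by (simp only: ennreal_mult'[symmetric])
      moreover have "\<rho> * E i = min K (sqrt \<delta>) / lam * (r * (E i / 4) * (1/2))" by (simp add: \<rho>_def)
      ultimately show ?thesis by (simp only:)
    qed
    also have "\<dots> \<le> ennreal (w_bond i E) * bond_avg i ((jump ^^ k) right_flux) E"
      using 1 2 by (intro mult_mono ennreal_leI) auto
    also have "\<dots> \<le> jump ((jump ^^ k) right_flux) E" by (rule jump_ge_bond[OF E(1) i(3)])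
    finally show ?thesis by (simp add: i_def)
  qed
  ultimately show ?case by blast
qed

text \<open>Telescopes \<open>jump_W\<close>, so that the outflow of every intermediate jump stays
  available on the left.\<close>

lemma iterate_W:
  "E \<in> space S \<Longrightarrow> (jump ^^ n) W_inf E + (\<Sum>k<n. (jump ^^ k) right_flux E) \<le> W_inf E + ennreal (n * ((TL + TR) / 2))"
proof (induction n)
  case (Suc n)
  interpret n: markov_operator S "jump ^^ n" by (rule iterate)
  define b where "b = (TL + TR) / 2"
  have b: "b \<ge> 0" using TL TR by (simp add: b_def)
  have "(jump ^^ n) (jump W_inf) E + (jump ^^ n) right_flux E = (jump ^^ n) (\<lambda>y. jump W_inf y + right_flux y) E"
    using Suc.prems by (simp add: n.add)
  also have "\<dots> \<le> (jump ^^ n) (\<lambda>y. W_inf y + ennreal b) E"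
  proof (rule n.mono)
    fix y assume "y \<in> space S"
    show "jump W_inf y + right_flux y \<le> W_inf y + ennreal b"
    proof (cases "y \<in> Omega")
      case True
      then show ?thesis using jump_W[OF True] W_nonneg[OF True] b by (simp add: W_inf_def b_def)
    qed (simp add: jump_def right_flux_def)
  qed (use Suc.prems in auto)
  also have "\<dots> = (jump ^^ n) W_inf E + ennreal b" using Suc.prems by (simp add: n.add n.const)
  finally have 1: "(jump ^^ Suc n) W_inf E + (jump ^^ n) right_flux E \<le> (jump ^^ n) W_inf E + ennreal b"
    by (simp add: funpow_swap1)
  have "(jump ^^ Suc n) W_inf E + (\<Sum>k<Suc n. (jump ^^ k) right_flux E)
      = ((jump ^^ Suc n) W_inf E + (jump ^^ n) right_flux E) + (\<Sum>k<n. (jump ^^ k) right_flux E)"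
    by (simp add: ac_simps)
  also have "\<dots> \<le> ((jump ^^ n) W_inf E + ennreal b) + (\<Sum>k<n. (jump ^^ k) right_flux E)"
    using 1 by (rule add_right_mono)
  also have "\<dots> = ((jump ^^ n) W_inf E + (\<Sum>k<n. (jump ^^ k) right_flux E)) + ennreal b" by (simp add: ac_simps)
  also have "\<dots> \<le> (W_inf E + ennreal (n * b)) + ennreal b"
    using Suc.IH[OF Suc.prems] by (intro add_right_mono) (simp add: b_def)
  also have "\<dots> = W_inf E + ennreal (Suc n * b)"
    using b by (simp add: add.assoc distrib_right flip: ennreal_plus)
  finally show ?case by (simp add: b_def)
qed simp

lemma W_growth:
  assumes "E \<in> Omega"
  shows "(jump ^^ N) W_inf E \<le> ennreal (W N E + N * ((TL + TR) / 2))"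
proof -
  have "(jump ^^ N) W_inf E \<le> (jump ^^ N) W_inf E + (\<Sum>k<N. (jump ^^ k) right_flux E)" by simp
  also have "\<dots> \<le> W_inf E + ennreal (N * ((TL + TR) / 2))" by (rule iterate_W[OF Omega_space[OF assms]])
  finally show ?thesis using W_nonneg[OF assms] TL TR by (simp add: W_inf_def)
qed

text \<open>The outflow after \<open>k\<close> jumps contains a fixed fraction of the initial energy
  of site \<open>N - 1 - k\<close>, the one at distance \<open>k\<close> from the right bath.
  Summing over \<open>k < N\<close> covers every site once and hence a fraction of
  \<open>W\<close>.\<close>

lemma W_contraction:
  assumes "\<delta> > 0"
  obtains \<rho> where "\<rho> > 0" "\<rho> \<le> 1" "\<And>E. E \<in> Omega \<Longrightarrow> \<forall>i<N. \<delta> \<le> E i \<Longrightarrow>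
    (jump ^^ N) W_inf E \<le> ennreal ((1 - \<rho>) * W N E + N * ((TL + TR) / 2))"
proof -
  obtain r where r: "\<And>k. k < N \<Longrightarrow> r k > 0"
    "\<And>k E. k < N \<Longrightarrow> E \<in> Omega \<Longrightarrow> \<forall>i<N. \<delta> \<le> E i \<Longrightarrow> ennreal (r k * E (N - 1 - k)) \<le> (jump ^^ k) right_flux E"
    using iterate_right_flux[OF assms] by metis
  define \<rho> where "\<rho> = Min (insert 1 (r ` {..<N}))"
  have rho: "\<rho> > 0" "\<rho> \<le> 1" "\<And>k. k < N \<Longrightarrow> \<rho> \<le> r k" using r(1) by (auto simp: \<rho>_def)
  show ?thesis
  proof (rule that[OF rho(1,2)])
    fix E assume E: "E \<in> Omega" "\<forall>i<N. \<delta> \<le> E i"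
    have pos: "E (N - 1 - k) > 0" if "k < N" for k using Omega_pos[OF E(1)] that by auto
    have "ennreal (\<rho> * W N E) = (\<Sum>k<N. ennreal (\<rho> * E (N - 1 - k)))"
    proof -
      have "W N E = (\<Sum>k<N. E (N - 1 - k))"
        unfolding W_def by (subst sum.nat_diff_reindex[symmetric]) simp
      then show ?thesis
        using pos rho(1) by (subst sum_ennreal) (auto simp: sum_distrib_left less_imp_le)
    qed
    also have "\<dots> \<le> (\<Sum>k<N. (jump ^^ k) right_flux E)"
    proof (rule sum_mono)
      fix k assume "k \<in> {..<N}"
      then have k: "k < N" by simp
      have "\<rho> * E (N - 1 - k) \<le> r k * E (N - 1 - k)" using rho(3)[OF k] pos[OF k] by (intro mult_right_mono) auto
      then show "ennreal (\<rho> * E (N - 1 - k)) \<le> (jump ^^ k) right_flux E"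
        using r(2)[OF k E] by (meson ennreal_leI order_trans)
    qed
    finally have "(jump ^^ N) W_inf E + ennreal (\<rho> * W N E) \<le> (jump ^^ N) W_inf E + (\<Sum>k<N. (jump ^^ k) right_flux E)"
      by (rule add_left_mono)
    also have "\<dots> \<le> W_inf E + ennreal (N * ((TL + TR) / 2))" by (rule iterate_W[OF Omega_space[OF E(1)]])
    also have "\<dots> = ennreal (W N E + N * ((TL + TR) / 2))" using W_nonneg[OF E(1)] TL TR by (simp add: W_inf_def)
    finally have "(jump ^^ N) W_inf E \<le> ennreal (W N E + N * ((TL + TR) / 2) - \<rho> * W N E)"
      by (rule ennreal_add_le_imp_le_diff) (use rho W_nonneg[OF E(1)] in auto)
    then show "(jump ^^ N) W_inf E \<le> ennreal ((1 - \<rho>) * W N E + N * ((TL + TR) / 2))"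
      by (simp add: algebra_simps)
  qed
qed

end

section \<open>Minorization on compact energy boxes\<close>

lemma nn_integral_unif01_scale:
  assumes [measurable]: "f \<in> borel_measurable borel" and X: "X > 0"
  shows "(\<integral>\<^sup>+p. f (p * X) \<partial>unif01) = ennreal (1 / X) * (\<integral>\<^sup>+u. f u * indicator {0<..<X} u \<partial>lborel)"
proof -
  have "(\<integral>\<^sup>+u. f u * indicator {0<..<X} u \<partial>lborel)
      = ennreal \<bar>X\<bar> * (\<integral>\<^sup>+p. f (0 + X * p) * indicator {0<..<X} (0 + X * p) \<partial>lborel)"
    by (rule nn_integral_real_affine) (use X in auto)
  also have "(\<integral>\<^sup>+p. f (0 + X * p) * indicator {0<..<X} (0 + X * p) \<partial>lborel) = (\<integral>\<^sup>+p. f (p * X) * indicator {0<..<1} p \<partial>lborel)"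
    using X by (intro nn_integral_cong) (auto simp: indicator_def mult.commute zero_less_mult_iff)
  also have "\<dots> = (\<integral>\<^sup>+p. f (p * X) \<partial>unif01)" by (rule nn_integral_unif01[symmetric]) measurable
  finally have "ennreal (1 / X) * (\<integral>\<^sup>+u. f u * indicator {0<..<X} u \<partial>lborel)
      = (ennreal (1 / X) * ennreal X) * (\<integral>\<^sup>+p. f (p * X) \<partial>unif01)"
    using X by (simp add: mult.assoc)
  also have "ennreal (1 / X) * ennreal X = 1" using X by (simp flip: ennreal_mult)
  finally show ?thesis by simp
qed

text \<open>Change of variables from \<open>(x, p)\<close> to \<open>u = p * (x + e)\<close> and
  \<open>v = (1 - p) * (x + e)\<close>, with density
  \<open>1 / (x + e) \<ge> 1 / (b + 3 * R)\<close>. For \<open>u\<close> in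
  \<open>[R, 2 * R]\<close>, \<open>v\<close> in \<open>[R, b]\<close> and \<open>e \<le> R\<close>,
  the preimage \<open>x = u + v - e\<close> lies in \<open>[R, b + 2 * R]\<close>.\<close>

lemma bond_smoothing:
  assumes h[measurable]: "(\<lambda>(u, v). h u v) \<in> borel_measurable (borel \<Otimes>\<^sub>M borel)"
    and e: "0 < e" "e \<le> R" and b: "0 \<le> b"
  shows "ennreal (1 / (b + 3 * R)) * (\<integral>\<^sup>+u. (\<integral>\<^sup>+v. h u v * indicator {R..b} v \<partial>lborel) * indicator {R..2*R} u \<partial>lborel)
    \<le> (\<integral>\<^sup>+x. (\<integral>\<^sup>+p. h (p * (x + e)) ((1 - p) * (x + e)) \<partial>unif01) * indicator {R..b + 2*R} x \<partial>lborel)"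
proof -
  have R: "R > 0" using e by simp
  define C where "C = ennreal (1 / (b + 3 * R))"
  define G where "G u x = h u (x + e - u) * (if 0 < u \<and> u < x + e then 1 else 0) * indicator {R..b + 2*R} x * indicator {R..2*R} u" for u x
  have hu[measurable]: "(\<lambda>v. h u v) \<in> borel_measurable borel" for u
    using measurable_Pair2[OF h, of u] by simp
  have h'[measurable]: "(\<lambda>z. h (fst z) (snd z + e - fst z)) \<in> borel_measurable (borel \<Otimes>\<^sub>M borel)"
  proof -
    have "(\<lambda>z. (\<lambda>(u, v). h u v) (fst z, snd z + e - fst z)) \<in> borel_measurable (borel \<Otimes>\<^sub>M borel)"
      by (rule measurable_compose[OF _ h]) measurable
    then show ?thesis by simp
  qed
  have G[measurable]: "(\<lambda>z. G (fst z) (snd z)) \<in> borel_measurable (borel \<Otimes>\<^sub>M borel)"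
    unfolding G_def by measurable
  have "(\<lambda>z. (\<lambda>z. G (fst z) (snd z)) (snd z, fst z)) \<in> borel_measurable (borel \<Otimes>\<^sub>M borel)"
    by (rule measurable_compose[OF _ G]) measurable
  then have G'[measurable]: "(\<lambda>z. G (snd z) (fst z)) \<in> borel_measurable (borel \<Otimes>\<^sub>M borel)" by simp
  have "C * (\<integral>\<^sup>+u. (\<integral>\<^sup>+v. h u v * indicator {R..b} v \<partial>lborel) * indicator {R..2*R} u \<partial>lborel)
    \<le> C * (\<integral>\<^sup>+u. (\<integral>\<^sup>+x. G u x \<partial>lborel) \<partial>lborel)"
  proof (intro mult_left_mono nn_integral_mono)
    fix u :: real
    show "(\<integral>\<^sup>+v. h u v * indicator {R..b} v \<partial>lborel) * indicator {R..2*R} u \<le> (\<integral>\<^sup>+x. G u x \<partial>lborel)"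
    proof (cases "u \<in> {R..2*R}")
      case True
      have "(\<integral>\<^sup>+x. G u x \<partial>lborel) = ennreal \<bar>1\<bar> * (\<integral>\<^sup>+v. G u ((u - e) + 1 * v) \<partial>lborel)"
        by (rule nn_integral_real_affine) (use measurable_Pair2[OF G, of u] in simp_all)
      also have "\<dots> \<ge> (\<integral>\<^sup>+v. h u v * indicator {R..b} v \<partial>lborel)"
        using True R e by (auto intro!: nn_integral_mono simp: indicator_def G_def)
      finally show ?thesis using True by simp
    qed simp
  qed auto
  also have "\<dots> = C * (\<integral>\<^sup>+x. (\<integral>\<^sup>+u. G u x \<partial>lborel) \<partial>lborel)"
  proof -
    have "(\<lambda>(x, u). G u x) \<in> borel_measurable (lborel \<Otimes>\<^sub>M lborel)"
      using G' by (simp add: case_prod_beta cong: measurable_cong_sets)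
    from lborel_pair.Fubini'[OF this] show ?thesis by (rule arg_cong)
  qed
  also have "\<dots> = (\<integral>\<^sup>+x. C * (\<integral>\<^sup>+u. G u x \<partial>lborel) \<partial>lborel)"
    by (rule nn_integral_cmult[symmetric]) measurable
  also have "\<dots> \<le> (\<integral>\<^sup>+x. (\<integral>\<^sup>+p. h (p * (x + e)) ((1 - p) * (x + e)) \<partial>unif01) * indicator {R..b + 2*R} x \<partial>lborel)"
  proof (intro nn_integral_mono)
    fix x :: real
    show "C * (\<integral>\<^sup>+u. G u x \<partial>lborel) \<le> (\<integral>\<^sup>+p. h (p * (x + e)) ((1 - p) * (x + e)) \<partial>unif01) * indicator {R..b + 2*R} x"
    proof (cases "x \<in> {R..b + 2*R}")
      case True
      define X where "X = x + e"
      have X: "0 < X" "X \<le> b + 3 * R" using True e R by (auto simp: X_def)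
      define f where "f u = h u (X - u)" for u
      have "(\<lambda>u. (\<lambda>(u, v). h u v) (u, X - u)) \<in> borel_measurable borel"
        by (rule measurable_compose[OF _ h]) measurable
      then have f[measurable]: "f \<in> borel_measurable borel" by (simp add: f_def[abs_def])
      have "C * (\<integral>\<^sup>+u. G u x \<partial>lborel) \<le> ennreal (1 / X) * (\<integral>\<^sup>+u. f u * indicator {0<..<X} u \<partial>lborel)"
      proof (intro mult_mono nn_integral_mono)
        show "C \<le> ennreal (1 / X)" unfolding C_def using X by (intro ennreal_leI divide_left_mono) auto
        show "G u x \<le> f u * indicator {0<..<X} u" for u
          by (auto simp: G_def f_def X_def indicator_def)
      qed auto
      also have "\<dots> = (\<integral>\<^sup>+p. f (p * X) \<partial>unif01)" by (rule nn_integral_unif01_scale[OF f X(1), symmetric])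
      also have "\<dots> = (\<integral>\<^sup>+p. h (p * (x + e)) ((1 - p) * (x + e)) \<partial>unif01)"
        by (simp add: f_def X_def algebra_simps)
      finally show ?thesis using True by simp
    next
      case False
      then have "G u x = 0" for u by (simp add: G_def)
      then show ?thesis by simp
    qed
  qed
  finally show ?thesis by (simp only: C_def)
qed

text \<open>Bath energies in \<open>[b + 1, b + 2]\<close> alone suffice: \<open>e + x\<close> then
  lies between \<open>b\<close> and \<open>R + b + 2\<close>, so \<open>p * (e + x)\<close> has
  density at least \<open>1 / (R + b + 2)\<close> on \<open>[R, b]\<close>. The remaining factor
  bounds the probability of that window.\<close>

lemma bath_smoothing:
  assumes h[measurable]: "h \<in> borel_measurable borel" and e: "0 < e" "e \<le> R" and T: "T > 0" and b: "R \<le> b"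
  shows "ennreal (exp (- (b + 2) / T) / T / (R + b + 2)) * (\<integral>\<^sup>+y. h y * indicator {R..b} y \<partial>lborel)
    \<le> (\<integral>\<^sup>+p. (\<integral>\<^sup>+x. h (p * (e + x)) \<partial>expo T) \<partial>unif01)"
proof -
  interpret u: prob_space unif01 by (rule prob_space_unif01)
  interpret x: prob_space "expo T" by (rule prob_space_expo[OF T])
  interpret pair_sigma_finite "expo T" unif01 ..
  define I where "I = (\<integral>\<^sup>+y. h y * indicator {R..b} y \<partial>lborel)"
  define A where "A = {b + 1..b + 2}"
  have R: "R > 0" using e by simp
  have "ennreal (exp (- (b + 2) / T) / T) \<le> emeasure (expo T) A"
  proof -
    have "ennreal (exp (- (b + 2) / T) / T) = (\<integral>\<^sup>+x. ennreal (exp (- (b + 2) / T) / T) * indicator A x \<partial>lborel)"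
      by (subst nn_integral_cmult_indicator) (auto simp: A_def)
    also have "\<dots> \<le> (\<integral>\<^sup>+x. ennreal (exponential_density (1/T) x) * indicator A x \<partial>lborel)"
    proof (intro nn_integral_mono)
      fix x
      have "exp (- (b + 2) / T) \<le> exp (- x / T)" if "x \<in> A"
        unfolding exp_le_cancel_iff using that T by (intro divide_right_mono) (auto simp: A_def)
      then show "ennreal (exp (- (b + 2) / T) / T) * indicator A x \<le> ennreal (exponential_density (1/T) x) * indicator A x"
        using b R T by (auto simp: A_def indicator_def exponential_density_def divide_right_mono intro!: ennreal_leI)
    qed
    also have "\<dots> = emeasure (expo T) A" unfolding expo_def by (subst emeasure_density) (auto simp: A_def)
    finally show ?thesis .
  qed
  then have "ennreal (exp (- (b + 2) / T) / T) * (ennreal (1 / (R + b + 2)) * I) \<le> emeasure (expo T) A * (ennreal (1 / (R + b + 2)) * I)"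
    by (rule mult_right_mono) simp
  also have "\<dots> = (\<integral>\<^sup>+x. (ennreal (1 / (R + b + 2)) * I) * indicator A x \<partial>expo T)"
    by (subst nn_integral_cmult_indicator) (auto simp: A_def mult.commute)
  also have "\<dots> \<le> (\<integral>\<^sup>+x. (\<integral>\<^sup>+p. h (p * (e + x)) \<partial>unif01) \<partial>expo T)"
  proof (intro nn_integral_mono)
    fix x
    show "(ennreal (1 / (R + b + 2)) * I) * indicator A x \<le> (\<integral>\<^sup>+p. h (p * (e + x)) \<partial>unif01)"
    proof (cases "x \<in> A")
      case True
      define X where "X = e + x"
      have X: "X > 0" "b < X" "X \<le> R + b + 2" using True e b R by (auto simp: A_def X_def)
      have "ennreal (1 / (R + b + 2)) * I \<le> ennreal (1 / X) * (\<integral>\<^sup>+u. h u * indicator {0<..<X} u \<partial>lborel)"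
        unfolding I_def
      proof (rule mult_mono)
        show "ennreal (1 / (R + b + 2)) \<le> ennreal (1 / X)" using X by (intro ennreal_leI divide_left_mono) auto
        show "(\<integral>\<^sup>+u. h u * indicator {R..b} u \<partial>lborel) \<le> (\<integral>\<^sup>+u. h u * indicator {0<..<X} u \<partial>lborel)"
          by (rule nn_integral_mono) (use X R in \<open>auto simp: indicator_def\<close>)
      qed auto
      also have "\<dots> = (\<integral>\<^sup>+p. h (p * (e + x)) \<partial>unif01)"
        unfolding X_def[symmetric] by (rule nn_integral_unif01_scale[OF h X(1), symmetric])
      finally show ?thesis using True by simp
    qed simp
  qed
  also have "\<dots> = (\<integral>\<^sup>+p. (\<integral>\<^sup>+x. h (p * (e + x)) \<partial>expo T) \<partial>unif01)"
    by (rule Fubini'[symmetric]) (simp add: case_prod_beta cong: measurable_cong_sets)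
  also have "ennreal (exp (- (b + 2) / T) / T) * (ennreal (1 / (R + b + 2)) * I) = ennreal (exp (- (b + 2) / T) / T / (R + b + 2)) * I"
    using T R b by (simp add: mult.assoc[symmetric] flip: ennreal_mult)
  finally show ?thesis unfolding I_def .
qed

text \<open>Lebesgue integral over \<open>[R, 2 * R]\<close> in the coordinates \<open>k\<close> to
  \<open>k + n - 1\<close>, the others being read from \<open>E\<close>. The recursion peels off the
  leftmost coordinate, in step with the induction of the sweep.\<close>

fun box_int :: "real \<Rightarrow> nat \<Rightarrow> nat \<Rightarrow> ((nat \<Rightarrow> real) \<Rightarrow> ennreal) \<Rightarrow> (nat \<Rightarrow> real) \<Rightarrow> ennreal" where
  "box_int R k 0 f E = f E"
| "box_int R k (Suc n) f E = (\<integral>\<^sup>+y. box_int R (Suc k) n f (E(k := y)) * indicator {R..2*R} y \<partial>lborel)"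

context energy_exchange
begin

lemma upd_joint_measurable:
  assumes "g \<in> borel_measurable S" "k < N"
  shows "(\<lambda>(E, y). g (E(k := y))) \<in> borel_measurable (S \<Otimes>\<^sub>M lborel)"
  unfolding case_prod_beta using assms(2)
  by (intro measurable_compose[OF _ assms(1)] measurable_state_upd) auto

lemma upd_slice_measurable:
  assumes "g \<in> borel_measurable S" "k < N" "E \<in> space S"
  shows "(\<lambda>y. g (E(k := y))) \<in> borel_measurable lborel"
  using assms(2,3) by (intro measurable_compose[OF _ assms(1)] measurable_state_upd) auto

lemma box_int_meas: "f \<in> borel_measurable S \<Longrightarrow> k + n \<le> N \<Longrightarrow> box_int R k n f \<in> borel_measurable S"
proof (induction n arbitrary: k)
  case 0
  have "box_int R k 0 f = f" by (rule ext) simp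
  then show ?case using 0 by simp
next
  case (Suc n)
  have [measurable]: "(\<lambda>(E, y). box_int R (Suc k) n f (E(k := y))) \<in> borel_measurable (S \<Otimes>\<^sub>M lborel)"
    using Suc by (intro upd_joint_measurable) auto
  have "(\<lambda>E. \<integral>\<^sup>+y. box_int R (Suc k) n f (E(k := y)) * indicator {R..2*R} y \<partial>lborel) \<in> borel_measurable S"
    by measurable
  then show ?case by simp
qed

lemma box_int_add:
  "f \<in> borel_measurable S \<Longrightarrow> g \<in> borel_measurable S \<Longrightarrow> k + n \<le> N \<Longrightarrow> E \<in> space S \<Longrightarrow>
    box_int R k n (\<lambda>y. f y + g y) E = box_int R k n f E + box_int R k n g E"
proof (induction n arbitrary: k E)
  case (Suc n)
  have m: "(\<lambda>y. box_int R (Suc k) n h (E(k := y)) * indicator {R..2*R} y) \<in> borel_measurable lborel"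
    if "h \<in> borel_measurable S" for h
    using upd_slice_measurable[OF box_int_meas[OF that, of "Suc k" n R], of k E] Suc.prems
    by (intro borel_measurable_times_ennreal) auto
  have "box_int R (Suc k) n (\<lambda>y. f y + g y) (E(k := y)) = box_int R (Suc k) n f (E(k := y)) + box_int R (Suc k) n g (E(k := y))" for y
  proof (rule Suc.IH)
    show "E(k := y) \<in> space S" by (rule space_state_upd) (use Suc.prems in auto)
  qed (use Suc.prems in auto)
  then show ?case
    using Suc.prems by (simp add: distrib_right nn_integral_add[OF m m])
qed simp

lemma box_int_mono:
  "(\<And>y. y \<in> space S \<Longrightarrow> f y \<le> g y) \<Longrightarrow> k + n \<le> N \<Longrightarrow> E \<in> space S \<Longrightarrow> box_int R k n f E \<le> box_int R k n g E"
proof (induction n arbitrary: k E)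
  case (Suc n)
  then show ?case by (auto intro!: nn_integral_mono mult_right_mono simp: space_state_upd)
qed simp

lemma box_int_const: "R > 0 \<Longrightarrow> box_int R k n (\<lambda>_. c) E = ennreal (R ^ n) * c"
proof (induction n arbitrary: k E)
  case (Suc n)
  have "box_int R k (Suc n) (\<lambda>_. c) E = (\<integral>\<^sup>+y. (ennreal (R ^ n) * c) * indicator {R..2*R} y \<partial>lborel)"
    using Suc by simp
  also have "\<dots> = (ennreal (R ^ n) * c) * ennreal R" using Suc.prems by (subst nn_integral_cmult_indicator) auto
  also have "\<dots> = ennreal (R ^ Suc n) * c" using Suc.prems by (simp add: ennreal_mult ac_simps)
  finally show ?case .
qed simp

text \<open>For \<open>k = 0\<close> and \<open>n = N\<close> nothing of the base point is left, so
  the minorizing functional does not depend on the starting state.\<close>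

lemma box_int_indep:
  "E \<in> space S \<Longrightarrow> E' \<in> space S \<Longrightarrow> (\<And>i. i < k \<or> k + n \<le> i \<Longrightarrow> E i = E' i) \<Longrightarrow> k + n \<le> N
    \<Longrightarrow> box_int R k n f E = box_int R k n f E'"
proof (induction n arbitrary: k E E')
  case 0
  have "E = E'"
  proof
    fix i
    show "E i = E' i" using 0(3)[of i] by (cases "i < k") auto
  qed
  then show ?case by simp
next
  case (Suc n)
  have "box_int R (Suc k) n f (E(k := y)) = box_int R (Suc k) n f (E'(k := y))" for y
  proof (rule Suc.IH)
    show "E(k := y) \<in> space S" "E'(k := y) \<in> space S"
      by (rule space_state_upd, use Suc.prems in auto)+
  qed (use Suc.prems in auto)
  then show ?case by simp
qed

lemma box_functional:
  assumes "E \<in> space S" "R > 0" "c > 0"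
  shows "functional_of_mass S (c * R ^ N) (\<lambda>f. ennreal c * box_int R 0 N f E)"
  using assms unfolding functional_of_mass_def
  by (auto simp: box_int_add distrib_left box_int_const mult.assoc ennreal_mult intro!: mult_left_mono box_int_mono)

text \<open>One sweep of the clocks from left to right refreshes all sites: clock \<open>k + 1\<close> turns a uniform density
  for the energy of site \<open>k\<close> into one for the sites \<open>k\<close> and \<open>k + 1\<close>.\<close>

lemma sweep:
  assumes delta: "0 < \<delta>" "\<delta> \<le> R"
  shows "n < N \<Longrightarrow> \<exists>c>0. \<exists>b\<ge>2*R. \<forall>f\<in>borel_measurable S. \<forall>E\<in>Omega. (\<forall>i<N. N - 1 - n < i \<longrightarrow> \<delta> \<le> E i \<and> E i \<le> R) \<longrightarrow>
    ennreal c * box_int R (N - 1 - n) (Suc n) f E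
      \<le> (\<integral>\<^sup>+x. (jump ^^ n) f (E(N - 1 - n := x)) * indicator {R..b} x \<partial>lborel)"
proof (induction n)
  case 0
  have "ennreal 1 * box_int R (N - 1 - 0) (Suc 0) f E
      \<le> (\<integral>\<^sup>+x. (jump ^^ 0) f (E(N - 1 - 0 := x)) * indicator {R..2*R} x \<partial>lborel)" for f E
    unfolding box_int.simps by (simp only: ennreal_1 mult_1 funpow_0 order_refl)
  then show ?case by (intro exI[of _ "1::real"] conjI zero_less_one exI[of _ "2*R"] order_refl ballI impI)
next
  case (Suc n)
  have R: "R > 0" using delta by simp
  \<comment> \<open>The induction adds a bond on the left, which is the first one to ring. Its input
    interval must be longer than the one it delivers to site \<open>Suc k\<close>, so
    \<open>b\<close> grows to \<open>b + 2 * R\<close>.\<close>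
  define k where "k = N - 1 - Suc n"
  have k: "N - 1 - n = Suc k" "Suc k < N" "k < N - 1" "k < N" using Suc.prems by (auto simp: k_def)
  obtain c b where c: "c > 0" and b: "b \<ge> 2 * R" and IH: "\<And>f E. f \<in> borel_measurable S \<Longrightarrow> E \<in> Omega \<Longrightarrow>
      (\<forall>i<N. Suc k < i \<longrightarrow> \<delta> \<le> E i \<and> E i \<le> R) \<Longrightarrow> ennreal c * box_int R (Suc k) (Suc n) f E
      \<le> (\<integral>\<^sup>+x. (jump ^^ n) f (E(Suc k := x)) * indicator {R..b} x \<partial>lborel)"
    using Suc.IH[OF Suc_lessD[OF Suc.prems]] unfolding k(1) by blast
  define w where "w = min K (sqrt \<delta>) / lam"
  have w: "w > 0" using K delta lam_pos by (simp add: w_def)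
  define c' where "c' = w * (1 / (b + 3 * R)) * c"
  have c': "c' > 0" using w c b R by (simp add: c'_def)
  have "ennreal c' * box_int R k (Suc (Suc n)) f E
      \<le> (\<integral>\<^sup>+x. (jump ^^ Suc n) f (E(k := x)) * indicator {R..b + 2*R} x \<partial>lborel)"
    if f: "f \<in> borel_measurable S" and E: "E \<in> Omega" and Ei: "\<forall>i<N. k < i \<longrightarrow> \<delta> \<le> E i \<and> E i \<le> R" for f E
  proof -
    define g where "g = (jump ^^ n) f"
    have g: "g \<in> borel_measurable S" unfolding g_def using f by (rule iterate_meas)
    define e where "e = E (Suc k)"
    have e: "\<delta> \<le> e" "e \<le> R" "0 < e" using Ei k delta by (auto simp: e_def)
    have ES: "E \<in> space S" using E by (rule Omega_space)
    have EO: "E(k := x) \<in> Omega" if "x > 0" for x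
      using E that k ES by (auto simp: Omega_def space_state_upd)
    define h where "h u v = g (E(k := u, Suc k := v))" for u v
    have h: "(\<lambda>(u, v). h u v) \<in> borel_measurable (borel \<Otimes>\<^sub>M borel)"
      unfolding h_def case_prod_beta using k ES
      by (intro measurable_compose[OF _ g] measurable_state_upd) auto
    have "ennreal c' * box_int R k (Suc (Suc n)) f E = ennreal w * (ennreal (1 / (b + 3 * R)) *
        (\<integral>\<^sup>+u. (ennreal c * box_int R (Suc k) (Suc n) f (E(k := u))) * indicator {R..2*R} u \<partial>lborel))"
    proof -
      have [measurable]: "(\<lambda>u. box_int R (Suc k) (Suc n) f (E(k := u))) \<in> borel_measurable lborel"
        using k ES f by (intro upd_slice_measurable box_int_meas) auto
      have "(\<integral>\<^sup>+u. (ennreal c * box_int R (Suc k) (Suc n) f (E(k := u))) * indicator {R..2*R} u \<partial>lborel)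
         = ennreal c * box_int R k (Suc (Suc n)) f E"
        unfolding box_int.simps(2)[of R k "Suc n"] mult.assoc by (rule nn_integral_cmult) measurable
      moreover have "ennreal c' = ennreal w * (ennreal (1 / (b + 3 * R)) * ennreal c)"
        using w b R c by (simp add: c'_def flip: ennreal_mult)
      ultimately show ?thesis by (simp only: mult.assoc)
    qed
    also have "\<dots> \<le> ennreal w * (ennreal (1 / (b + 3 * R)) *
        (\<integral>\<^sup>+u. (\<integral>\<^sup>+v. h u v * indicator {R..b} v \<partial>lborel) * indicator {R..2*R} u \<partial>lborel))"
    proof (intro mult_left_mono nn_integral_mono)
      fix u :: real
      show "(ennreal c * box_int R (Suc k) (Suc n) f (E(k := u))) * indicator {R..2*R} u
        \<le> (\<integral>\<^sup>+v. h u v * indicator {R..b} v \<partial>lborel) * indicator {R..2*R} u"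
      proof (cases "u \<in> {R..2*R}")
        case True
        then show ?thesis
          unfolding h_def g_def using IH[OF f EO, of u] Ei R k by simp
      qed simp
    qed auto
    also have "\<dots> \<le> ennreal w * (\<integral>\<^sup>+x. (\<integral>\<^sup>+p. h (p * (x + e)) ((1 - p) * (x + e)) \<partial>unif01) * indicator {R..b + 2*R} x \<partial>lborel)"
      using b R e by (intro mult_left_mono bond_smoothing[OF h]) auto
    also have "\<dots> = (\<integral>\<^sup>+x. ennreal w * ((\<integral>\<^sup>+p. h (p * (x + e)) ((1 - p) * (x + e)) \<partial>unif01) * indicator {R..b + 2*R} x) \<partial>lborel)"
    proof (rule nn_integral_cmult[symmetric])
      interpret u: sigma_finite_measure unif01 by (rule sigma_finite_unif01)
      have "(\<lambda>z. (\<lambda>(u, v). h u v) (snd z * (fst z + e), (1 - snd z) * (fst z + e))) \<in> borel_measurable (lborel \<Otimes>\<^sub>M unif01)"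
        by (rule measurable_compose[OF _ h]) measurable
      then have [measurable]: "(\<lambda>x. \<integral>\<^sup>+p. h (p * (x + e)) ((1 - p) * (x + e)) \<partial>unif01) \<in> borel_measurable lborel"
        by (intro u.borel_measurable_nn_integral) (simp add: case_prod_beta)
      show "(\<lambda>x. (\<integral>\<^sup>+p. h (p * (x + e)) ((1 - p) * (x + e)) \<partial>unif01) * indicator {R..b + 2*R} x) \<in> borel_measurable lborel"
        by measurable
    qed
    also have "\<dots> \<le> (\<integral>\<^sup>+x. (jump ^^ Suc n) f (E(k := x)) * indicator {R..b + 2*R} x \<partial>lborel)"
    proof (intro nn_integral_mono)
      fix x :: real
      show "ennreal w * ((\<integral>\<^sup>+p. h (p * (x + e)) ((1 - p) * (x + e)) \<partial>unif01) * indicator {R..b + 2*R} x)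
        \<le> (jump ^^ Suc n) f (E(k := x)) * indicator {R..b + 2*R} x"
      proof (cases "x \<in> {R..b + 2*R}")
        case True
        then have x: "x \<ge> R" "x > 0" using R by auto
        have "min K (sqrt \<delta>) \<le> rate K x e"
          unfolding rate_def using x delta e by (intro min.mono real_sqrt_le_mono) auto
        then have "w \<le> w_bond k (E(k := x))" using lam_pos by (simp add: w_def e_def divide_right_mono)
        moreover have "(\<integral>\<^sup>+p. h (p * (x + e)) ((1 - p) * (x + e)) \<partial>unif01) = bond_avg k g (E(k := x))"
          unfolding bond_avg_def h_def bond_upd_def e_def by simp
        ultimately have "ennreal w * (\<integral>\<^sup>+p. h (p * (x + e)) ((1 - p) * (x + e)) \<partial>unif01)
            \<le> ennreal (w_bond k (E(k := x))) * bond_avg k g (E(k := x))"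
          by (intro mult_mono ennreal_leI) auto
        also have "\<dots> \<le> jump g (E(k := x))" by (rule jump_ge_bond[OF EO[OF x(2)] k(3)])
        finally show ?thesis using True by (simp add: g_def)
      qed simp
    qed
    finally show ?thesis .
  qed
  then have main: "\<forall>f\<in>borel_measurable S. \<forall>E\<in>Omega. (\<forall>i<N. k < i \<longrightarrow> \<delta> \<le> E i \<and> E i \<le> R) \<longrightarrow>
      ennreal c' * box_int R k (Suc (Suc n)) f E
      \<le> (\<integral>\<^sup>+x. (jump ^^ Suc n) f (E(k := x)) * indicator {R..b + 2*R} x \<partial>lborel)" by blast
  show ?case
    unfolding k_def[symmetric]
  proof (rule exI[of _ c'], rule conjI[OF c'], rule exI[of _ "b + 2*R"], rule conjI[OF _ main])
    show "2 * R \<le> b + 2 * R" using b R by simp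
  qed
qed

text \<open>One update by the left bath gives site 0 a density on \<open>[R, b]\<close>, with
  \<open>b\<close> as long as the sweep requires; the \<open>N - 1\<close> bonds do the rest,
  \<open>N\<close> jumps in all.\<close>

lemma minorization_box:
  assumes delta: "0 < \<delta>" "\<delta> \<le> R"
  obtains \<epsilon> \<nu> where "\<epsilon> > 0" "functional_of_mass S \<epsilon> \<nu>"
    "\<And>E f. E \<in> Omega \<Longrightarrow> \<forall>i<N. \<delta> \<le> E i \<and> E i \<le> R \<Longrightarrow> f \<in> borel_measurable S \<Longrightarrow> \<nu> f \<le> (jump ^^ N) f E"
proof -
  have R: "R > 0" using delta by simp
  have N1: "N - 1 < N" "N - 1 - (N - 1) = 0" "Suc (N - 1) = N" using N by auto
  obtain c b where c: "c > 0" and b: "b \<ge> 2 * R" and sw: "\<And>f E. f \<in> borel_measurable S \<Longrightarrow> E \<in> Omega \<Longrightarrow>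
      (\<forall>i<N. 0 < i \<longrightarrow> \<delta> \<le> E i \<and> E i \<le> R) \<Longrightarrow> ennreal c * box_int R 0 N f E
      \<le> (\<integral>\<^sup>+x. (jump ^^ (N - 1)) f (E(0 := x)) * indicator {R..b} x \<partial>lborel)"
    using sweep[OF delta N1(1)] unfolding N1(2,3) by blast
  define d where "d = exp (- (b + 2) / TL) / TL / (R + b + 2)"
  have d: "d > 0" using TL R b by (simp add: d_def)
  define w where "w = min K (sqrt (min TL \<delta>)) / lam"
  have w: "w > 0" using K TL delta lam_pos by (simp add: w_def)
  \<comment> \<open>An arbitrary base point of the space, used only to write the full box integral
    without reference to \<open>E\<close>.\<close>
  define E0 :: "nat \<Rightarrow> real" where "E0 = (\<lambda>i\<in>{..<N}. 0)"
  have E0: "E0 \<in> space S" by (auto simp: E0_def state_space_def space_PiM)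
  show ?thesis
  proof (rule that)
    show "w * d * c * R ^ N > 0" using w d c R by simp
    show "functional_of_mass S (w * d * c * R ^ N) (\<lambda>f. ennreal (w * d * c) * box_int R 0 N f E0)"
      by (rule box_functional[OF E0 R]) (use w d c in simp)
    fix E and f :: "(nat \<Rightarrow> real) \<Rightarrow> ennreal" assume E: "E \<in> Omega" and Ei: "\<forall>i<N. \<delta> \<le> E i \<and> E i \<le> R" and f: "f \<in> borel_measurable S"
    define g where "g = (jump ^^ (N - 1)) f"
    have g: "g \<in> borel_measurable S" unfolding g_def using f by (rule iterate_meas)
    have ES: "E \<in> space S" using E by (rule Omega_space)
    have e: "0 < E 0" "\<delta> \<le> E 0" "E 0 \<le> R" using Ei delta N Omega_pos[OF E, of 0] by auto
    have "box_int R 0 N f E0 = box_int R 0 N f E"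
      using ES E0 by (intro box_int_indep) (auto simp: state_space_def space_PiM PiE_def extensional_def)
    then have "ennreal (w * d * c) * box_int R 0 N f E0 = ennreal w * (ennreal d * (ennreal c * box_int R 0 N f E))"
      using w d c by (simp add: ennreal_mult mult.assoc)
    also have "\<dots> \<le> ennreal w * (ennreal d * (\<integral>\<^sup>+x. g (E(0 := x)) * indicator {R..b} x \<partial>lborel))"
      unfolding g_def using Ei by (intro mult_left_mono sw[OF f E]) auto
    also have "\<dots> \<le> ennreal w * bath_avg 0 TL g E"
    proof (rule mult_left_mono)
      show "ennreal d * (\<integral>\<^sup>+x. g (E(0 := x)) * indicator {R..b} x \<partial>lborel) \<le> bath_avg 0 TL g E"
        unfolding d_def bath_avg_def bath_upd_def
        using bath_smoothing[OF _ e(1,3) TL, of "\<lambda>y. g (E(0 := y))" b] upd_slice_measurable[OF g _ ES, of 0] N b R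
        by simp
    qed simp
    also have "\<dots> \<le> ennreal (w_left E) * bath_avg 0 TL g E"
    proof (intro mult_right_mono ennreal_leI)
      have "min K (sqrt (min TL \<delta>)) \<le> rate K TL (E 0)"
        unfolding rate_def using e by (intro min.mono real_sqrt_le_mono) auto
      then show "w \<le> w_left E" using lam_pos by (simp add: w_def divide_right_mono)
    qed simp
    also have "\<dots> \<le> jump g E" by (rule jump_ge_left[OF E])
    also have "jump g E = (jump ^^ N) f E"
      unfolding g_def using N1(3) by (metis comp_apply funpow.simps(2))
    finally show "ennreal (w * d * c) * box_int R 0 N f E0 \<le> (jump ^^ N) f E" .
  qed
qed

end

section \<open>Transfer to the real-valued semigroup\<close>

lemma (in prob_space) nn_integral_shift:
  fixes f :: "'a \<Rightarrow> real"
  assumes f: "f \<in> borel_measurable M" and B: "AE x in M. \<bar>f x\<bar> \<le> B"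
  shows "(\<integral>\<^sup>+x. ennreal (f x + B) \<partial>M) = ennreal ((\<integral>x. f x \<partial>M) + B)" "\<bar>\<integral>x. f x \<partial>M\<bar> \<le> B"
proof -
  have i: "integrable M f" by (rule integrable_const_bound[OF _ f, of B]) (use B in auto)
  have "(\<integral>\<^sup>+x. ennreal (f x + B) \<partial>M) = ennreal (\<integral>x. f x + B \<partial>M)"
    using i B by (intro nn_integral_eq_integral) auto
  also have "(\<integral>x. f x + B \<partial>M) = (\<integral>x. f x \<partial>M) + B" using i prob_space by simp
  finally show "(\<integral>\<^sup>+x. ennreal (f x + B) \<partial>M) = ennreal ((\<integral>x. f x \<partial>M) + B)" .
  have "(\<integral>x. f x \<partial>M) \<le> B" using B by (intro integral_le_const i) auto
  moreover have "- B \<le> (\<integral>x. f x \<partial>M)" using B by (intro integral_ge_const i) auto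
  ultimately show "\<bar>\<integral>x. f x \<partial>M\<bar> \<le> B" by simp
qed

text \<open>As \<open>\<beta> \<le> 2\<close>, \<open>(s / (n + 1)) powr \<beta>\<close> is at most
  \<open>1 + (s / (n + 1))^2\<close>, and multiplying a Poisson weight by
  \<open>s^2 / ((n + 1) * (n + 2))\<close> shifts it by two places. The total is at most
  \<open>1 + 2\<close>, the 2 coming from \<open>n + 2 \<le> 2 * (n + 1)\<close>.\<close>

lemma poisson_powr_bound:
  fixes s \<beta> :: real
  assumes s: "s > 0" and b: "0 \<le> \<beta>" "\<beta> \<le> 2"
  shows "summable (\<lambda>n. exp (- s) * s ^ n / fact n * (real n + 1) powr (- \<beta>))"
    "(\<Sum>n. exp (- s) * s ^ n / fact n * (real n + 1) powr (- \<beta>)) \<le> 3 * s powr (- \<beta>)"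
proof -
  define p where "p n = exp (- s) * s ^ n / fact n" for n
  have p0: "p n \<ge> 0" for n using s by (simp add: p_def)
  have "(\<lambda>n. exp (- s) * (s ^ n /\<^sub>R fact n)) sums (exp (- s) * exp s)"
    by (intro sums_mult exp_converges)
  then have p1: "p sums 1"
    by (simp add: p_def[abs_def] divide_inverse mult.commute mult.left_commute flip: exp_add)
  have p2: "(\<lambda>n. p (n + 2)) sums (1 - (\<Sum>i<2. p i))" unfolding sums_iff_shift using p1 by simp
  have sum2: "(\<Sum>i<2. p i) \<ge> 0" using p0 by (intro sum_nonneg) auto
  have pointwise: "p n * (real n + 1) powr (- \<beta>) \<le> s powr (- \<beta>) * (p n + 2 * p (n + 2))" for n
  proof -
    define y where "y = (s / (real n + 1)) ^ 2"
    have y: "y > 0" using s by (simp add: y_def)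
    have sn: "s / (real n + 1) > 0" using s by simp
    have "(s / (real n + 1)) powr \<beta> = y powr (\<beta> / 2)"
    proof -
      have "y = (s / (real n + 1)) powr 2" using sn by (simp add: y_def powr_numeral)
      then show ?thesis by (simp only: powr_powr) simp
    qed
    also have "\<dots> \<le> 1 + \<beta> / 2 * (y - 1)" by (rule powr_le_tangent) (use b y in auto)
    also have "\<dots> \<le> 1 + y" 
    proof -
      have "\<beta> / 2 * y \<le> 1 * y" using b y by (intro mult_right_mono) auto
      then show ?thesis using b by (simp add: algebra_simps)
    qed
    finally have 1: "(s / (real n + 1)) powr \<beta> \<le> 1 + y" .
    have "(real n + 1) powr (- \<beta>) = s powr (- \<beta>) * (s / (real n + 1)) powr \<beta>"
      using s by (simp add: powr_divide powr_minus field_simps)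
    also have "\<dots> \<le> s powr (- \<beta>) * (1 + y)" using 1 by (intro mult_left_mono) auto
    finally have "p n * (real n + 1) powr (- \<beta>) \<le> p n * (s powr (- \<beta>) * (1 + y))"
      using p0 by (rule mult_left_mono)
    also have "\<dots> = s powr (- \<beta>) * (p n + p n * y)" by (simp add: algebra_simps)
    also have "\<dots> \<le> s powr (- \<beta>) * (p n + 2 * p (n + 2))"
    proof (intro mult_left_mono add_left_mono)
      have "p (n + 2) = p n * (s ^ 2 / ((real n + 1) * (real n + 2)))"
        by (simp add: p_def field_simps power2_eq_square)
      moreover have "y \<le> 2 * (s ^ 2 / ((real n + 1) * (real n + 2)))"
      proof -
        have "(real n + 1) * (real n + 2) \<le> 2 * (real n + 1) ^ 2" by (simp add: power2_eq_square algebra_simps)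
        then have "s ^ 2 / (2 * (real n + 1) ^ 2) \<le> s ^ 2 / ((real n + 1) * (real n + 2))"
          by (intro divide_left_mono) auto
        then show ?thesis by (simp add: y_def power_divide)
      qed
      then have "p n * y \<le> p n * (2 * (s ^ 2 / ((real n + 1) * (real n + 2))))"
        using p0 by (intro mult_left_mono) auto
      ultimately show "p n * y \<le> 2 * p (n + 2)" by (simp add: ac_simps)
    qed auto
    finally show ?thesis .
  qed
  have S: "(\<lambda>n. s powr (- \<beta>) * (p n + 2 * p (n + 2))) sums (s powr (- \<beta>) * (1 + 2 * (1 - (\<Sum>i<2. p i))))"
    by (intro sums_mult sums_add p1 p2)
  have sm: "summable (\<lambda>n. p n * (real n + 1) powr (- \<beta>))"
    by (rule summable_comparison_test'[OF sums_summable[OF S], of 0]) (use pointwise p0 in \<open>simp add: abs_mult\<close>)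
  then show "summable (\<lambda>n. exp (- s) * s ^ n / fact n * (real n + 1) powr (- \<beta>))" by (simp add: p_def)
  have "(\<Sum>n. p n * (real n + 1) powr (- \<beta>)) \<le> s powr (- \<beta>) * (1 + 2 * (1 - (\<Sum>i<2. p i)))"
    using suminf_le[OF pointwise sm sums_summable[OF S]] sums_unique[OF S] by simp
  also have "\<dots> \<le> s powr (- \<beta>) * 3" using sum2 by (intro mult_left_mono) auto
  finally show "(\<Sum>n. exp (- s) * s ^ n / fact n * (real n + 1) powr (- \<beta>)) \<le> 3 * s powr (- \<beta>)"
    by (simp add: p_def mult.commute)
qed

section \<open>Comparison of the real-valued jump operator with \<open>jump\<close>\<close>

context energy_exchange
begin

abbreviation "J \<equiv> jump_op N K TL TR"

definition bond_int :: "nat \<Rightarrow> ((nat \<Rightarrow> real) \<Rightarrow> real) \<Rightarrow> (nat \<Rightarrow> real) \<Rightarrow> real" where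
  "bond_int i g E = (\<integral>p. g (bond_upd i p E) \<partial>unif01)"

definition bath_int :: "nat \<Rightarrow> real \<Rightarrow> ((nat \<Rightarrow> real) \<Rightarrow> real) \<Rightarrow> (nat \<Rightarrow> real) \<Rightarrow> real" where
  "bath_int j T g E = (\<integral>p. (\<integral>x. g (bath_upd j p x E) \<partial>expo T) \<partial>unif01)"

lemma jump_op_eq:
  "J g E = (\<Sum>i<N - 1. w_bond i E * bond_int i g E) + w_left E * bath_int 0 TL g E
     + w_right E * bath_int (N - 1) TR g E + w_stay E * g E"
proof -
  have "generator N K TL TR g E = (\<Sum>i<N - 1. rate K (E i) (E (Suc i)) * bond_int i g E)
     + rate K TL (E 0) * bath_int 0 TL g E + rate K (E (N - 1)) TR * bath_int (N - 1) TR g E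
     - total_rate N K TL TR E * g E"
    unfolding generator_def total_rate_def bond_int_def bath_int_def bond_upd_def bath_upd_def
    by (simp add: right_diff_distrib distrib_right sum_subtractf sum_distrib_right)
  then have "J g E = g E + ((\<Sum>i<N - 1. rate K (E i) (E (Suc i)) * bond_int i g E)
     + rate K TL (E 0) * bath_int 0 TL g E + rate K (E (N - 1)) TR * bath_int (N - 1) TR g E
     - total_rate N K TL TR E * g E) / lam"
    by (simp add: jump_op_def)
  also have "\<dots> = (\<Sum>i<N - 1. w_bond i E * bond_int i g E) + w_left E * bath_int 0 TL g E
     + w_right E * bath_int (N - 1) TR g E + w_stay E * g E"
    by (simp add: add_divide_distrib diff_divide_distrib sum_divide_distrib left_diff_distrib)
  finally show ?thesis .
qed

lemma bond_int_meas:
  assumes [measurable]: "g \<in> borel_measurable S" and i: "Suc i < N"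
  shows "bond_int i g \<in> borel_measurable S"
proof -
  interpret sigma_finite_measure unif01 by (rule sigma_finite_unif01)
  have "(\<lambda>(E, p). g (bond_upd i p E)) \<in> borel_measurable (S \<Otimes>\<^sub>M unif01)"
    unfolding case_prod_beta using i
    by (intro measurable_compose[OF _ assms(1)] measurable_bond_upd) (auto cong: measurable_cong_sets)
  then show ?thesis unfolding bond_int_def[abs_def] by (rule borel_measurable_lebesgue_integral)
qed

lemma bath_joint_meas:
  fixes g :: "(nat \<Rightarrow> real) \<Rightarrow> real"
  assumes "g \<in> borel_measurable S" "j < N" "T > 0"
  shows "(\<lambda>(E, p). \<integral>x. g (bath_upd j p x E) \<partial>expo T) \<in> borel_measurable (S \<Otimes>\<^sub>M unif01)"
proof -
  interpret sigma_finite_measure "expo T" using prob_space_expo[OF assms(3)] by (simp add: prob_space_imp_sigma_finite)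
  have "(\<lambda>(z, x). g (bath_upd j (snd z) x (fst z))) \<in> borel_measurable ((S \<Otimes>\<^sub>M unif01) \<Otimes>\<^sub>M expo T)"
    unfolding case_prod_beta using assms(2)
    by (intro measurable_compose[OF _ assms(1)] measurable_bath_upd) (auto cong: measurable_cong_sets)
  then have "(\<lambda>z. \<integral>x. g (bath_upd j (snd z) x (fst z)) \<partial>expo T) \<in> borel_measurable (S \<Otimes>\<^sub>M unif01)"
    by (rule borel_measurable_lebesgue_integral)
  then show ?thesis by (simp add: case_prod_beta)
qed

lemma bath_int_meas:
  assumes "g \<in> borel_measurable S" "j < N" "T > 0"
  shows "bath_int j T g \<in> borel_measurable S"
proof -
  interpret sigma_finite_measure unif01 by (rule sigma_finite_unif01)
  show ?thesis unfolding bath_int_def[abs_def]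
    by (rule borel_measurable_lebesgue_integral[OF bath_joint_meas[OF assms]])
qed

lemma jump_op_meas:
  assumes g[measurable]: "g \<in> borel_measurable S"
  shows "J g \<in> borel_measurable S"
proof -
  have [measurable]: "(\<lambda>E. \<Sum>i<N - 1. w_bond i E * bond_int i g E) \<in> borel_measurable S"
    using bond_int_meas[OF g] by (intro borel_measurable_sum borel_measurable_times measurable_weights) auto
  have [measurable]: "bath_int 0 TL g \<in> borel_measurable S" "bath_int (N - 1) TR g \<in> borel_measurable S"
    using TL TR by (auto intro: bath_int_meas[OF g])
  show ?thesis unfolding jump_op_eq[abs_def] by measurable
qed

lemma bond_avg_shift:
  assumes E: "E \<in> Omega" and i: "Suc i < N" and g: "g \<in> borel_measurable S"
    and gB: "\<And>y. y \<in> Omega \<Longrightarrow> \<bar>g y\<bar> \<le> B \<and> h y = ennreal (g y + B)"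
  shows "bond_avg i h E = ennreal (bond_int i g E + B)" "\<bar>bond_int i g E\<bar> \<le> B"
proof -
  interpret prob_space unif01 by (rule prob_space_unif01)
  have m: "(\<lambda>p. g (bond_upd i p E)) \<in> borel_measurable unif01"
    using i Omega_space[OF E] by (intro measurable_compose[OF _ g] measurable_bond_upd) (auto cong: measurable_cong_sets)
  have ae: "AE p in unif01. \<bar>g (bond_upd i p E)\<bar> \<le> B"
    by (rule AE_mp[OF AE_unif01 AE_I2]) (use gB bond_upd_Omega[OF E i] in auto)
  have "bond_avg i h E = (\<integral>\<^sup>+p. ennreal (g (bond_upd i p E) + B) \<partial>unif01)"
    unfolding bond_avg_def
    by (intro nn_integral_cong_AE AE_mp[OF AE_unif01 AE_I2]) (use gB bond_upd_Omega[OF E i] in auto)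
  then show "bond_avg i h E = ennreal (bond_int i g E + B)" "\<bar>bond_int i g E\<bar> \<le> B"
    unfolding bond_int_def using nn_integral_shift[OF m ae] by auto
qed

lemma bath_avg_shift:
  assumes E: "E \<in> Omega" and j: "j < N" and T: "T > 0" and g: "g \<in> borel_measurable S"
    and gB: "\<And>y. y \<in> Omega \<Longrightarrow> \<bar>g y\<bar> \<le> B \<and> h y = ennreal (g y + B)"
  shows "bath_avg j T h E = ennreal (bath_int j T g E + B)" "\<bar>bath_int j T g E\<bar> \<le> B"
proof -
  interpret u: prob_space unif01 by (rule prob_space_unif01)
  interpret x: prob_space "expo T" by (rule prob_space_expo[OF T])
  define G where "G p = (\<integral>x. g (bath_upd j p x E) \<partial>expo T)" for p
  have m: "(\<lambda>x. g (bath_upd j p x E)) \<in> borel_measurable (expo T)" for p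
    using j Omega_space[OF E] by (intro measurable_compose[OF _ g] measurable_bath_upd) (auto cong: measurable_cong_sets)
  have mG: "G \<in> borel_measurable unif01"
    unfolding G_def using measurable_Pair2[OF bath_joint_meas[OF g j T] Omega_space[OF E]] by simp
  have inner: "(\<integral>\<^sup>+x. h (bath_upd j p x E) \<partial>expo T) = ennreal (G p + B)" "\<bar>G p\<bar> \<le> B" if p: "0 < p" for p
  proof -
    have ae: "AE x in expo T. \<bar>g (bath_upd j p x E)\<bar> \<le> B"
      by (rule AE_mp[OF AE_expo[OF T] AE_I2]) (use gB bath_upd_Omega[OF E j p] in auto)
    have "(\<integral>\<^sup>+x. h (bath_upd j p x E) \<partial>expo T) = (\<integral>\<^sup>+x. ennreal (g (bath_upd j p x E) + B) \<partial>expo T)"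
      by (intro nn_integral_cong_AE AE_mp[OF AE_expo[OF T] AE_I2]) (use gB bath_upd_Omega[OF E j p] in auto)
    then show "(\<integral>\<^sup>+x. h (bath_upd j p x E) \<partial>expo T) = ennreal (G p + B)" "\<bar>G p\<bar> \<le> B"
      unfolding G_def using x.nn_integral_shift[OF m ae] by auto
  qed
  have ae: "AE p in unif01. \<bar>G p\<bar> \<le> B"
    by (rule AE_mp[OF AE_unif01 AE_I2]) (use inner in auto)
  have "bath_avg j T h E = (\<integral>\<^sup>+p. ennreal (G p + B) \<partial>unif01)"
    unfolding bath_avg_def
    by (intro nn_integral_cong_AE AE_mp[OF AE_unif01 AE_I2]) (use inner in auto)
  then show "bath_avg j T h E = ennreal (bath_int j T g E + B)" "\<bar>bath_int j T g E\<bar> \<le> B"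
    unfolding bath_int_def G_def[symmetric] using u.nn_integral_shift[OF mG ae] by auto
qed

text \<open>Adding \<open>B\<close> makes a function bounded by \<open>B\<close> nonnegative, so that \<^term>\<open>J\<close> can be compared with the
  extended nonnegative operator \<^term>\<open>jump\<close>.\<close>

lemma jump_op_shift:
  assumes E: "E \<in> Omega" and g: "g \<in> borel_measurable S" and B: "B \<ge> 0"
    and gB: "\<And>y. y \<in> Omega \<Longrightarrow> \<bar>g y\<bar> \<le> B \<and> h y = ennreal (g y + B)"
  shows "jump h E = ennreal (J g E + B)" "\<bar>J g E\<bar> \<le> B"
proof -
  have N': "0 < N" "N - 1 < N" using N by auto
  note bond = bond_avg_shift[OF E _ g gB]
  note wn = w_nonneg[OF E] w_stay_nonneg[of E]
  define a where "a i = bond_int i g E" for i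
  define aL where "aL = bath_int 0 TL g E"
  define aR where "aR = bath_int (N - 1) TR g E"
  have a: "\<bar>a i\<bar> \<le> B" if "i < N - 1" for i using bond(2)[of i] that by (simp add: a_def)
  have left: "bath_avg 0 TL h E = ennreal (aL + B)" "\<bar>aL\<bar> \<le> B"
    unfolding aL_def
    by (rule bath_avg_shift(1)[OF E N'(1) TL g], erule gB) (rule bath_avg_shift(2)[OF E N'(1) TL g], erule gB)
  have right: "bath_avg (N - 1) TR h E = ennreal (aR + B)" "\<bar>aR\<bar> \<le> B"
    unfolding aR_def
    by (rule bath_avg_shift(1)[OF E N'(2) TR g], erule gB) (rule bath_avg_shift(2)[OF E N'(2) TR g], erule gB)
  note aLR = left(2) right(2)
  have g0: "\<bar>g E\<bar> \<le> B" using gB[OF E] by simp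
  have eq: "J g E + c = (\<Sum>i<N - 1. w_bond i E * (a i + c)) + w_left E * (aL + c) + w_right E * (aR + c) + w_stay E * (g E + c)" for c
  proof -
    have "c = ((\<Sum>i<N - 1. w_bond i E) + w_left E + w_right E + w_stay E) * c" unfolding w_sum by simp
    then have "J g E + c = J g E + ((\<Sum>i<N - 1. w_bond i E) + w_left E + w_right E + w_stay E) * c" by simp
    also have "\<dots> = (\<Sum>i<N - 1. w_bond i E * (a i + c)) + w_left E * (aL + c) + w_right E * (aR + c) + w_stay E * (g E + c)"
      unfolding jump_op_eq a_def[symmetric] aL_def[symmetric] aR_def[symmetric] distrib_left distrib_right sum.distrib sum_distrib_right
      by (simp only: add.assoc add.commute add.left_commute)
    finally show ?thesis .
  qed
  have nn: "0 \<le> (\<Sum>i<N - 1. w_bond i E * (a i + B))" "0 \<le> w_left E * (aL + B)" "0 \<le> w_right E * (aR + B)" "0 \<le> w_stay E * (g E + B)"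
    using a aLR g0 by (intro sum_nonneg mult_nonneg_nonneg wn; force)+
  have "jump h E = (\<Sum>i<N - 1. ennreal (w_bond i E) * ennreal (a i + B)) + ennreal (w_left E) * ennreal (aL + B)
      + ennreal (w_right E) * ennreal (aR + B) + ennreal (w_stay E) * ennreal (g E + B)"
  proof -
    have "(\<Sum>i<N - 1. ennreal (w_bond i E) * bond_avg i h E) = (\<Sum>i<N - 1. ennreal (w_bond i E) * ennreal (a i + B))"
      by (intro sum.cong refl) (simp add: bond(1) a_def)
    moreover have "h E = ennreal (g E + B)" using gB[OF E] by simp
    ultimately show ?thesis unfolding jump_def if_P[OF E] left(1) right(1) by (simp only:)
  qed
  also have "\<dots> = ennreal (\<Sum>i<N - 1. w_bond i E * (a i + B)) + ennreal (w_left E * (aL + B))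
      + ennreal (w_right E * (aR + B)) + ennreal (w_stay E * (g E + B))"
  proof -
    have "(\<Sum>i<N - 1. ennreal (w_bond i E) * ennreal (a i + B)) = (\<Sum>i<N - 1. ennreal (w_bond i E * (a i + B)))"
      by (intro sum.cong refl ennreal_mult'[symmetric] wn(1)) simp
    also have "\<dots> = ennreal (\<Sum>i<N - 1. w_bond i E * (a i + B))"
      using a by (intro sum_ennreal mult_nonneg_nonneg wn(1); force)
    finally show ?thesis using wn by (simp only: ennreal_mult')
  qed
  also have "\<dots> = ennreal (J g E + B)"
    unfolding eq using nn by (simp only: ennreal_plus add_nonneg_nonneg)
  finally show "jump h E = ennreal (J g E + B)" .
  have "J g E + B \<ge> 0" unfolding eq using nn by (intro add_nonneg_nonneg)
  moreover have "J g E + (- B) \<le> 0"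
  proof -
    have "(\<Sum>i<N - 1. w_bond i E * (a i + (- B))) \<le> 0"
      using a by (intro sum_nonpos mult_nonneg_nonpos wn(1); force)
    moreover have "w_left E * (aL + (- B)) \<le> 0" "w_right E * (aR + (- B)) \<le> 0" "w_stay E * (g E + (- B)) \<le> 0"
      using aLR g0 by (intro mult_nonneg_nonpos wn; force)+
    ultimately show ?thesis unfolding eq by linarith
  qed
  ultimately show "\<bar>J g E\<bar> \<le> B" by simp
qed

lemma iterate_jump_op_meas: "\<zeta> \<in> borel_measurable S \<Longrightarrow> (J ^^ n) \<zeta> \<in> borel_measurable S"
  by (induction n) (auto intro: jump_op_meas)

lemma iterate_jump_op:
  assumes z: "\<zeta> \<in> borel_measurable S" "\<And>E. \<bar>\<zeta> E\<bar> \<le> B" and E: "E \<in> Omega"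
  shows "(jump ^^ n) (\<lambda>E. ennreal (\<zeta> E + B)) E = ennreal ((J ^^ n) \<zeta> E + B)" "\<bar>(J ^^ n) \<zeta> E\<bar> \<le> B"
proof -
  have B: "B \<ge> 0" using order_trans[OF abs_ge_zero z(2)] .
  have "\<bar>(J ^^ n) \<zeta> E\<bar> \<le> B \<and> (jump ^^ n) (\<lambda>E. ennreal (\<zeta> E + B)) E = ennreal ((J ^^ n) \<zeta> E + B)"
    using E
  proof (induction n arbitrary: E)
    case (Suc n)
    show ?case
      using jump_op_shift[OF Suc.prems iterate_jump_op_meas[OF z(1), of n] B Suc.IH] by simp
  qed (use z in auto)
  then show "(jump ^^ n) (\<lambda>E. ennreal (\<zeta> E + B)) E = ennreal ((J ^^ n) \<zeta> E + B)" "\<bar>(J ^^ n) \<zeta> E\<bar> \<le> B" by auto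
qed

end

section \<open>Contraction of the jump chain\<close>

context block_powers
begin

text \<open>The loss \<open>l\<close> is kept for the first jump only, where it is evaluated at the
  starting point; each of the other \<open>N - 1\<close> jumps adds at most
  \<open>b\<close>.\<close>

lemma iterate_V_bound:
  fixes V l :: "(nat \<Rightarrow> real) \<Rightarrow> real" and b :: real
  assumes m: "(\<lambda>E. if E \<in> Omega then ennreal (V E) else \<top>) \<in> borel_measurable S"
    and b: "b \<ge> 0" and V: "\<And>E. E \<in> Omega \<Longrightarrow> 0 \<le> V E"
    and drift: "\<And>E. E \<in> Omega \<Longrightarrow> jump (\<lambda>E. if E \<in> Omega then ennreal (V E) else \<top>) E \<le> ennreal (V E - l E + b)"
    and l: "\<And>E. E \<in> Omega \<Longrightarrow> 0 \<le> l E" "\<And>E. E \<in> Omega \<Longrightarrow> 0 \<le> V E - l E + b" and E: "E \<in> Omega"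
  shows "(jump ^^ N) (\<lambda>E. if E \<in> Omega then ennreal (V E) else \<top>) E \<le> ennreal (V E - l E + N * b)"
proof -
  define v where "v = (\<lambda>E. if E \<in> Omega then ennreal (V E) else \<top>)"
  have v[measurable]: "v \<in> borel_measurable S" using m by (simp add: v_def)
  have step: "jump v E \<le> v E + ennreal b" for E
  proof (cases "E \<in> Omega")
    case True
    have "ennreal (V E - l E + b) \<le> ennreal (V E + b)" using l(1)[OF True] by (intro ennreal_leI) simp
    then show ?thesis using drift[OF True] True b V[OF True] order_trans by (fastforce simp: v_def)
  qed (simp add: v_def)
  have it: "(jump ^^ n) v E \<le> v E + ennreal (n * b)" if "E \<in> space S" for n E
    using that
  proof (induction n)
    case (Suc n)
    interpret n: markov_operator S "jump ^^ n" by (rule iterate)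
    have "(jump ^^ Suc n) v E = (jump ^^ n) (jump v) E" by (simp add: funpow_swap1)
    also have "\<dots> \<le> (jump ^^ n) (\<lambda>y. v y + ennreal b) E" by (rule n.mono) (use step Suc.prems in auto)
    also have "\<dots> = (jump ^^ n) v E + ennreal b" using Suc.prems by (simp add: n.add n.const)
    also have "\<dots> \<le> (v E + ennreal (n * b)) + ennreal b" using Suc by (intro add_right_mono) auto
    also have "\<dots> = v E + ennreal (Suc n * b)" using b by (simp add: add.assoc distrib_right flip: ennreal_plus)
    finally show ?case .
  qed simp
  have ES: "E \<in> space S" using E by (rule Omega_space)
  obtain n where n: "N = Suc n" using N by (cases N) auto
  have "(jump ^^ N) v E = jump ((jump ^^ n) v) E" by (simp add: n)
  also have "\<dots> \<le> jump (\<lambda>y. v y + ennreal (n * b)) E" by (rule mono) (use it ES in auto)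
  also have "\<dots> = jump v E + ennreal (n * b)" using ES by (simp add: add const)
  also have "\<dots> \<le> ennreal (V E - l E + b) + ennreal (n * b)" using drift[OF E] by (simp add: v_def add_right_mono)
  also have "\<dots> = ennreal (V E - l E + N * b)" using l(2)[OF E] b by (simp add: n algebra_simps flip: ennreal_plus)
  finally show ?thesis unfolding v_def .
qed

text \<open>The abstract theorem is applied to \<open>jump ^^ N\<close>. The \<open>n mod N\<close>
  jumps left over are moved into the test function, which stays bounded by 1, and the change of time
  scale costs the factor \<open>N powr (2 * q)\<close>.\<close>

lemma jump_contraction:
  obtains c C where "\<And>m. c m \<ge> 1" "C \<ge> 0"
    "\<And>n z x y. z \<in> borel_measurable S \<Longrightarrow> (\<And>x. x \<in> space S \<Longrightarrow> z x \<le> 1) \<Longrightarrow> x \<in> Omega \<Longrightarrow> y \<in> Omega \<Longrightarrow>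
      (jump ^^ n) z x \<le> (jump ^^ n) z y
        + ennreal (C * (1 + V_fun c x + W N x + V_fun c y + W N y) * (real n + 1) powr (- (2 * q)))"
proof -
  obtain c a b where c1: "\<And>m. c m \<ge> 1" and a: "a > 0" and b: "b \<ge> 0" and
    drift: "\<And>E. E \<in> Omega \<Longrightarrow> jump (\<lambda>E. if E \<in> Omega then ennreal (V_fun c E) else \<top>) E
        \<le> ennreal (V_fun c E - a * V_fun c E powr (1 - 1/(2*q)) + b)"
    using V_drift by blast
  define v where "v = (\<lambda>E. if E \<in> Omega then ennreal (V_fun c E) else \<top>)"
  have v[measurable]: "v \<in> borel_measurable S" using V_fun_meas[of c] unfolding v_def by measurable
  have V1: "V_fun c E \<ge> 1" if "E \<in> Omega" for E
    using order_trans[OF powr_ge_zero V_fun_ge_site[of c 0 E, OF c1 N_less(1)]] by simp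
  \<comment> \<open>\<open>ennreal\<close> of a negative number is 0, whereas
    \<open>jump v E \<ge> 1\<close> because \<open>v \<ge> 1\<close>; so the bound in the drift
    cannot be negative.\<close>
  have nonneg: "0 \<le> V_fun c E - a * V_fun c E powr (1 - 1/(2*q)) + b" if E: "E \<in> Omega" for E
  proof -
    have "1 = jump (\<lambda>_. 1) E" using one[OF Omega_space[OF E]] by simp
    also have "\<dots> \<le> jump v E" by (rule jump_mono[OF _ E]) (use V1 in \<open>simp add: v_def\<close>)
    also have "\<dots> \<le> ennreal (V_fun c E - a * V_fun c E powr (1 - 1/(2*q)) + b)"
      unfolding v_def by (rule drift[OF E])
    finally show ?thesis using ennreal_neg by (cases "0 \<le> V_fun c E - a * V_fun c E powr (1 - 1/(2*q)) + b") auto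
  qed
  have site: "\<exists>\<delta>>0. \<forall>E\<in>Omega. V_fun c E \<le> R \<longrightarrow> (\<forall>i<N. \<delta> \<le> E i)" for R
  proof (intro exI conjI ballI impI allI)
    define r where "r = max R 1"
    have r: "r > 0" by (simp add: r_def)
    show "r powr (- 1/q) > 0" using r by simp
    fix E i assume E: "E \<in> Omega" "V_fun c E \<le> R" "i < N"
    have Ei: "E i > 0" using Omega_pos[OF E(1,3)] .
    have "E i powr (- q) \<le> r" using V_fun_ge_site[of c i E, OF c1 E(3)] E(2) by (simp add: r_def)
    then have "r powr (- 1/q) \<le> (E i powr (- q)) powr (- 1/q)"
      using Ei q by (intro powr_mono2') auto
    also have "\<dots> = E i" using Ei q by (simp add: powr_powr)
    finally show "r powr (- 1/q) \<le> E i" .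
  qed
  interpret it: markov_operator S "jump ^^ N" by (rule iterate)
  interpret sg: subgeometric_drift S "jump ^^ N" Omega "V_fun c" "W N" "2 * q" a "N * b" "N * ((TL + TR) / 2)"
  proof unfold_locales
    show "Omega \<subseteq> space S" using Omega_space by auto
    show "(\<lambda>x. if x \<in> Omega then ennreal (V_fun c x) else \<top>) \<in> borel_measurable S" using v by (simp add: v_def)
    show "(\<lambda>x. ennreal (W N x)) \<in> borel_measurable S" using W_meas by measurable
    show "V_fun c x \<ge> 1" if "x \<in> Omega" for x by (rule V1[OF that])
    show "0 \<le> W N x" if "x \<in> Omega" for x by (rule W_nonneg[OF that])
    show "1 < 2 * q" "0 < a" "0 \<le> N * b" "0 \<le> N * ((TL + TR) / 2)" using q a b TL TR by auto
    show "(jump ^^ N) (\<lambda>x. if x \<in> Omega then ennreal (V_fun c x) else \<top>) x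
      \<le> ennreal (V_fun c x - a * V_fun c x powr (1 - 1/(2*q)) + N * b)" if "x \<in> Omega" for x
    proof (rule iterate_V_bound[where l = "\<lambda>x. a * V_fun c x powr (1 - 1/(2*q))", OF v[unfolded v_def] b])
      show "0 \<le> V_fun c E" if "E \<in> Omega" for E using V1[OF that] by simp
    qed (use drift nonneg a that in auto)
    show "(jump ^^ N) (\<lambda>x. ennreal (W N x)) x \<le> ennreal (W N x + N * ((TL + TR) / 2))" if "x \<in> Omega" for x
      using W_growth[OF that] by (simp add: W_inf_def[abs_def])
    show "\<exists>\<rho>>0. \<rho> \<le> 1 \<and> (\<forall>x\<in>Omega. V_fun c x \<le> R \<longrightarrow>
       (jump ^^ N) (\<lambda>x. ennreal (W N x)) x \<le> ennreal ((1 - \<rho>) * W N x + N * ((TL + TR) / 2)))" for R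
    proof -
      obtain \<delta> where d: "\<delta> > 0" "\<And>E. E \<in> Omega \<Longrightarrow> V_fun c E \<le> R \<Longrightarrow> \<forall>i<N. \<delta> \<le> E i" using site[of R] by blast
      show ?thesis
        by (rule W_contraction[OF d(1)]) (use d(2) in \<open>auto simp: W_inf_def[abs_def]\<close>)
    qed
    show "\<exists>\<epsilon>>0. \<exists>\<nu>. functional_of_mass S \<epsilon> \<nu> \<and>
      (\<forall>x\<in>Omega. V_fun c x \<le> R \<longrightarrow> W N x \<le> R \<longrightarrow> (\<forall>f\<in>borel_measurable S. \<nu> f \<le> (jump ^^ N) f x))" for R
    proof -
      obtain \<delta> where d: "\<delta> > 0" "\<And>E. E \<in> Omega \<Longrightarrow> V_fun c E \<le> R \<Longrightarrow> \<forall>i<N. \<delta> \<le> E i" using site[of R] by blast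
      obtain \<epsilon> \<nu> where nu: "\<epsilon> > 0" "functional_of_mass S \<epsilon> \<nu>"
        "\<And>E f. E \<in> Omega \<Longrightarrow> \<forall>i<N. \<delta> \<le> E i \<and> E i \<le> max \<delta> R \<Longrightarrow> f \<in> borel_measurable S \<Longrightarrow> \<nu> f \<le> (jump ^^ N) f E"
        using minorization_box[OF d(1), of "max \<delta> R"] by auto
      have "\<nu> f \<le> (jump ^^ N) f E" if E: "E \<in> Omega" "V_fun c E \<le> R" "W N E \<le> R" and f: "f \<in> borel_measurable S" for E f
      proof (rule nu(3)[OF E(1) _ f])
        show "\<forall>i<N. \<delta> \<le> E i \<and> E i \<le> max \<delta> R"
          using d(2)[OF E(1,2)] W_ge_site[OF E(1)] E(3) by (auto simp: le_max_iff_disj intro: order_trans)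
      qed
      then show ?thesis using nu(1,2) by blast
    qed
  qed
  obtain C where C: "C \<ge> 0" and con: "\<And>n z x y. z \<in> borel_measurable S \<Longrightarrow> (\<And>x. x \<in> space S \<Longrightarrow> z x \<le> 1) \<Longrightarrow>
      x \<in> Omega \<Longrightarrow> y \<in> Omega \<Longrightarrow> ((jump ^^ N) ^^ n) z x \<le> ((jump ^^ N) ^^ n) z y
        + ennreal (C * (1 + V_fun c x + W N x + V_fun c y + W N y) * (real n + 1) powr (- (2 * q)))"
    using sg.polynomial_contraction by blast
  show ?thesis
  proof (rule that[of c "C * N powr (2 * q)"])
    show "0 \<le> C * N powr (2 * q)" using C by simp
    fix n :: nat and z :: "(nat \<Rightarrow> real) \<Rightarrow> ennreal" and x y
    assume z: "z \<in> borel_measurable S" "\<And>x. x \<in> space S \<Longrightarrow> z x \<le> 1" and x: "x \<in> Omega" and y: "y \<in> Omega"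
    define k where "k = n div N"
    define r where "r = n mod N"
    interpret r: markov_operator S "jump ^^ r" by (rule iterate)
    have n: "n = N * k + r" by (simp add: k_def r_def)
    have J: "(jump ^^ n) z = ((jump ^^ N) ^^ k) ((jump ^^ r) z)"
      unfolding n funpow_add funpow_mult by simp
    have z1: "(jump ^^ r) z u \<le> 1" if "u \<in> space S" for u
      using r.mono[of z "\<lambda>_. 1" u] r.one[OF that] that z by simp
    define D where "D = 1 + V_fun c x + W N x + V_fun c y + W N y"
    have D: "D \<ge> 0" using V1[OF x] V1[OF y] W_nonneg[OF x] W_nonneg[OF y] by (simp add: D_def)
    have "(jump ^^ n) z x \<le> (jump ^^ n) z y + ennreal (C * D * (real k + 1) powr (- (2 * q)))"
      unfolding J D_def by (rule con[OF r.meas[OF z(1)] z1 x y])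
    also have "ennreal (C * D * (real k + 1) powr (- (2 * q))) \<le> ennreal (C * N powr (2 * q) * D * (real n + 1) powr (- (2 * q)))"
    proof (rule ennreal_leI)
      have "r < N" using N by (simp add: r_def)
      then have "n + 1 \<le> N * (k + 1)" by (simp add: n)
      then have "real (n + 1) \<le> real (N * (k + 1))" by (simp only: of_nat_le_iff)
      then have nk: "(real n + 1) / N \<le> real k + 1" using N by (simp add: field_simps)
      have "(real k + 1) powr (- (2 * q)) \<le> ((real n + 1) / N) powr (- (2 * q))"
        using nk N q by (intro powr_mono2') auto
      also have "\<dots> = N powr (2 * q) * (real n + 1) powr (- (2 * q))"
        using N by (simp add: powr_divide powr_minus field_simps)
      finally have "C * D * (real k + 1) powr (- (2 * q)) \<le> C * D * (N powr (2 * q) * (real n + 1) powr (- (2 * q)))"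
        using C D by (intro mult_left_mono) auto
      then show "C * D * (real k + 1) powr (- (2 * q)) \<le> C * N powr (2 * q) * D * (real n + 1) powr (- (2 * q))"
        by (simp add: ac_simps)
    qed
    finally show "(jump ^^ n) z x \<le> (jump ^^ n) z y
        + ennreal (C * N powr (2 * q) * (1 + V_fun c x + W N x + V_fun c y + W N y) * (real n + 1) powr (- (2 * q)))"
      by (simp add: D_def add_left_mono)
  qed (rule c1)
qed

text \<open>A function bounded by \<open>B\<close> is rescaled to
  \<open>(\<zeta> + B) / (2 * B)\<close>, with values in \<open>[0, 1]\<close>. Exchanging the two
  points gives the absolute value.\<close>

lemma jump_op_contraction:
  obtains c C where "\<And>m. c m \<ge> 1" "C \<ge> 0"
    "\<And>n \<zeta> B x y. \<zeta> \<in> borel_measurable S \<Longrightarrow> (\<And>E. \<bar>\<zeta> E\<bar> \<le> B) \<Longrightarrow> x \<in> Omega \<Longrightarrow> y \<in> Omega \<Longrightarrow>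
      \<bar>(J ^^ n) \<zeta> x - (J ^^ n) \<zeta> y\<bar> \<le> C * B * (1 + V_fun c x + W N x + V_fun c y + W N y) * (real n + 1) powr (- (2 * q))"
proof -
  obtain c C where c1: "\<And>m. c m \<ge> 1" and C: "C \<ge> 0" and
    con: "\<And>n z x y. z \<in> borel_measurable S \<Longrightarrow> (\<And>x. x \<in> space S \<Longrightarrow> z x \<le> 1) \<Longrightarrow> x \<in> Omega \<Longrightarrow> y \<in> Omega \<Longrightarrow>
      (jump ^^ n) z x \<le> (jump ^^ n) z y
        + ennreal (C * (1 + V_fun c x + W N x + V_fun c y + W N y) * (real n + 1) powr (- (2 * q)))"
    using jump_contraction by blast
  show ?thesis
  proof (rule that[of c "2 * C"])
    fix n :: nat and \<zeta> :: "(nat \<Rightarrow> real) \<Rightarrow> real" and B x y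
    assume z: "\<zeta> \<in> borel_measurable S" "\<And>E. \<bar>\<zeta> E\<bar> \<le> B" and x: "x \<in> Omega" and y: "y \<in> Omega"
    have B0: "B \<ge> 0" using order_trans[OF abs_ge_zero z(2)] .
    define d where "d u w = (1 + V_fun c u + W N u + V_fun c w + W N w)" for u w
    have le: "(J ^^ n) \<zeta> u - (J ^^ n) \<zeta> w \<le> 2 * C * B * d u w * (real n + 1) powr (- (2 * q))"
      if u: "u \<in> Omega" and w: "w \<in> Omega" for u w
    proof (cases "B = 0")
      case True
      then have "(J ^^ n) \<zeta> u = 0" "(J ^^ n) \<zeta> w = 0"
        using iterate_jump_op(2)[OF z u, of n] iterate_jump_op(2)[OF z w, of n] by auto
      then show ?thesis using True by simp
    next
      case False
      then have B: "B > 0" using B0 by simp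
      have zm: "(\<lambda>E. ennreal (\<zeta> E + B)) \<in> borel_measurable S" using z(1) by measurable
      interpret n: markov_operator S "jump ^^ n" by (rule iterate)
      define z' where "z' E = ennreal (1 / (2 * B)) * ennreal (\<zeta> E + B)" for E
      have z'm: "z' \<in> borel_measurable S" unfolding z'_def using zm by measurable
      have z'1: "z' E \<le> 1" for E
      proof -
        have "z' E = ennreal (1 / (2 * B) * (\<zeta> E + B))" unfolding z'_def using B by (intro ennreal_mult'[symmetric]) auto
        also have "\<dots> \<le> ennreal 1" using z(2)[of E] B by (intro ennreal_leI) (simp add: field_simps)
        finally show ?thesis by simp
      qed
      have Jz: "(jump ^^ n) z' E = ennreal (((J ^^ n) \<zeta> E + B) / (2 * B))" "((J ^^ n) \<zeta> E + B) / (2 * B) \<ge> 0" if E: "E \<in> Omega" for E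
      proof -
        have "(jump ^^ n) z' E = ennreal (1 / (2 * B)) * ennreal ((J ^^ n) \<zeta> E + B)"
          unfolding z'_def n.cmult[OF zm Omega_space[OF E]] iterate_jump_op(1)[OF z E] ..
        also have "\<dots> = ennreal (1 / (2 * B) * ((J ^^ n) \<zeta> E + B))" using B by (intro ennreal_mult'[symmetric]) auto
        finally show "(jump ^^ n) z' E = ennreal (((J ^^ n) \<zeta> E + B) / (2 * B))" by simp
        show "((J ^^ n) \<zeta> E + B) / (2 * B) \<ge> 0" using iterate_jump_op(2)[OF z E, of n] B by simp
      qed
      define R where "R = C * d u w * (real n + 1) powr (- (2 * q))"
      have "V_fun c E \<ge> 0" if "E \<in> Omega" for E
        using order_trans[OF powr_ge_zero V_fun_ge_site[of c 0 E, OF c1 N_less(1)]] by simp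
      then have R: "R \<ge> 0"
        using C u w W_nonneg[OF u] W_nonneg[OF w] by (simp add: R_def d_def)
      have "ennreal (((J ^^ n) \<zeta> u + B) / (2 * B)) \<le> ennreal (((J ^^ n) \<zeta> w + B) / (2 * B)) + ennreal R"
        using con[OF z'm z'1 u w, of n] unfolding Jz(1)[OF u] Jz(1)[OF w] R_def d_def by simp
      then have "((J ^^ n) \<zeta> u + B) / (2 * B) \<le> ((J ^^ n) \<zeta> w + B) / (2 * B) + R"
        using Jz(2)[OF u] Jz(2)[OF w] R by (simp flip: ennreal_plus)
      also have "((J ^^ n) \<zeta> w + B) / (2 * B) + R = ((J ^^ n) \<zeta> w + B + 2 * B * R) / (2 * B)"
        using B by (simp add: add_divide_distrib)
      finally have "(J ^^ n) \<zeta> u + B \<le> (J ^^ n) \<zeta> w + B + 2 * B * R" using B by (simp only: divide_le_cancel)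
      then show ?thesis by (simp add: R_def ac_simps)
    qed
    have "d y x = d x y" by (simp add: d_def)
    then show "\<bar>(J ^^ n) \<zeta> x - (J ^^ n) \<zeta> y\<bar> \<le> 2 * C * B * (1 + V_fun c x + W N x + V_fun c y + W N y) * (real n + 1) powr (- (2 * q))"
      using le[OF x y] le[OF y x] unfolding d_def[symmetric] by (simp add: abs_le_iff)
  qed (use c1 C in auto)
qed

section \<open>From the jump chain to the continuous-time semigroup\<close>

abbreviation "P t \<equiv> Pt N K TL TR t"

lemma Pt_meas: "\<zeta> \<in> borel_measurable S \<Longrightarrow> P t \<zeta> \<in> borel_measurable S"
  unfolding Pt_def[abs_def]
  by (intro borel_measurable_suminf borel_measurable_times borel_measurable_const iterate_jump_op_meas)

lemma Pt_summable:
  assumes z: "\<zeta> \<in> borel_measurable S" "\<And>E. \<bar>\<zeta> E\<bar> \<le> B" and E: "E \<in> Omega" and t: "t > 0"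
  shows "summable (\<lambda>n. exp (- lam * t) * (lam * t) ^ n / fact n * (J ^^ n) \<zeta> E)" "\<bar>P t \<zeta> E\<bar> \<le> 3 * B"
proof -
  define s where "s = lam * t"
  have s: "s > 0" using lam_pos t by (simp add: s_def)
  have B0: "B \<ge> 0" using order_trans[OF abs_ge_zero z(2)] .
  \<comment> \<open>The Poisson weights sum to 1; the constant 3 comes from reusing
    \<open>poisson_powr_bound\<close> with exponent 0 and is good enough for boundedness.\<close>
  have sm0: "summable (\<lambda>n. exp (- s) * s ^ n / fact n)" and le0: "(\<Sum>n. exp (- s) * s ^ n / fact n) \<le> 3"
    using poisson_powr_bound[OF s, of 0] s by simp_all
  have bd: "norm (exp (- s) * s ^ n / fact n * (J ^^ n) \<zeta> E) \<le> exp (- s) * s ^ n / fact n * B" for n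
    using iterate_jump_op(2)[OF z E, of n] s by (simp add: abs_mult mult_left_mono divide_right_mono)
  have sa: "summable (\<lambda>n. norm (exp (- s) * s ^ n / fact n * (J ^^ n) \<zeta> E))"
    by (rule summable_comparison_test'[OF summable_mult2[OF sm0, of B], of 0]) (use bd in simp)
  then show "summable (\<lambda>n. exp (- lam * t) * (lam * t) ^ n / fact n * (J ^^ n) \<zeta> E)"
    using summable_norm_cancel[OF sa] by (simp add: s_def)
  have "\<bar>P t \<zeta> E\<bar> \<le> (\<Sum>n. norm (exp (- s) * s ^ n / fact n * (J ^^ n) \<zeta> E))"
    using summable_norm[OF sa] by (simp add: Pt_def s_def)
  also have "\<dots> \<le> (\<Sum>n. exp (- s) * s ^ n / fact n * B)"
    by (rule suminf_le[OF bd sa summable_mult2[OF sm0]])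
  also have "\<dots> = (\<Sum>n. exp (- s) * s ^ n / fact n) * B" by (rule suminf_mult2[OF sm0, symmetric])
  also have "\<dots> \<le> 3 * B" using le0 B0 by (rule mult_right_mono)
  finally show "\<bar>P t \<zeta> E\<bar> \<le> 3 * B" .
qed

text \<open>\<open>Pt\<close> averages the jump chain over a Poisson number of jumps with mean
  \<open>lam * t\<close>, which carries the rate in \<open>n\<close> over to \<open>t\<close>
  because \<open>2 * q \<le> 2\<close>.\<close>

lemma Pt_contraction:
  obtains c C where "\<And>m. c m \<ge> 1" "C \<ge> 0"
    "\<And>t \<zeta> B x y. \<zeta> \<in> borel_measurable S \<Longrightarrow> (\<And>E. \<bar>\<zeta> E\<bar> \<le> B) \<Longrightarrow> x \<in> Omega \<Longrightarrow> y \<in> Omega \<Longrightarrow> t > 0 \<Longrightarrow>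
      \<bar>P t \<zeta> x - P t \<zeta> y\<bar> \<le> C * B * (1 + V_fun c x + W N x + V_fun c y + W N y) * t powr (- (2 * q))"
proof -
  obtain c C where c1: "\<And>m. c m \<ge> 1" and C: "C \<ge> 0" and
    con: "\<And>n \<zeta> B x y. \<zeta> \<in> borel_measurable S \<Longrightarrow> (\<And>E. \<bar>\<zeta> E\<bar> \<le> B) \<Longrightarrow> x \<in> Omega \<Longrightarrow> y \<in> Omega \<Longrightarrow>
      \<bar>(J ^^ n) \<zeta> x - (J ^^ n) \<zeta> y\<bar> \<le> C * B * (1 + V_fun c x + W N x + V_fun c y + W N y) * (real n + 1) powr (- (2 * q))"
    using jump_op_contraction by blast
  show ?thesis
  proof (rule that[of c "3 * C * lam powr (- (2 * q))"])
    fix t :: real and \<zeta> :: "(nat \<Rightarrow> real) \<Rightarrow> real" and B x y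
    assume z: "\<zeta> \<in> borel_measurable S" "\<And>E. \<bar>\<zeta> E\<bar> \<le> B" and x: "x \<in> Omega" and y: "y \<in> Omega" and t: "t > 0"
    define s where "s = lam * t"
    have s: "s > 0" using lam_pos t by (simp add: s_def)
    have B0: "B \<ge> 0" using order_trans[OF abs_ge_zero z(2)] .
    define D where "D = C * B * (1 + V_fun c x + W N x + V_fun c y + W N y)"
    have "V_fun c E \<ge> 0" for E
      using order_trans[OF powr_ge_zero V_fun_ge_site[of c 0 E, OF c1 N_less(1)]] by simp
    then have D: "D \<ge> 0" using C B0 W_nonneg[OF x] W_nonneg[OF y] by (simp add: D_def)
    define p where "p n = exp (- s) * s ^ n / fact n" for n
    have p0: "p n \<ge> 0" for n using s by (simp add: p_def)
    have sx: "summable (\<lambda>n. p n * (J ^^ n) \<zeta> x)" and sy: "summable (\<lambda>n. p n * (J ^^ n) \<zeta> y)"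
      using Pt_summable(1)[OF z x t] Pt_summable(1)[OF z y t] by (simp_all add: p_def s_def)
    have sm: "summable (\<lambda>n. p n * (real n + 1) powr (- (2 * q)))"
      and le: "(\<Sum>n. p n * (real n + 1) powr (- (2 * q))) \<le> 3 * s powr (- (2 * q))"
      unfolding p_def using poisson_powr_bound[OF s, of "2 * q"] q by auto
    have bd: "norm (p n * (J ^^ n) \<zeta> x - p n * (J ^^ n) \<zeta> y) \<le> D * (p n * (real n + 1) powr (- (2 * q)))" for n
    proof -
      have "norm (p n * (J ^^ n) \<zeta> x - p n * (J ^^ n) \<zeta> y) = p n * \<bar>(J ^^ n) \<zeta> x - (J ^^ n) \<zeta> y\<bar>"
        using p0[of n] by (simp add: abs_mult flip: right_diff_distrib)
      also have "\<dots> \<le> p n * (D * (real n + 1) powr (- (2 * q)))"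
        using con[OF z x y, of n] p0[of n] unfolding D_def by (intro mult_left_mono) auto
      finally show ?thesis by (simp add: ac_simps)
    qed
    have sD: "summable (\<lambda>n. D * (p n * (real n + 1) powr (- (2 * q))))" by (rule summable_mult[OF sm])
    have sa: "summable (\<lambda>n. norm (p n * (J ^^ n) \<zeta> x - p n * (J ^^ n) \<zeta> y))"
      by (rule summable_comparison_test'[OF sD, of 0]) (use bd in simp)
    have "P t \<zeta> x - P t \<zeta> y = (\<Sum>n. p n * (J ^^ n) \<zeta> x - p n * (J ^^ n) \<zeta> y)"
      using suminf_diff[OF sx sy] by (simp add: Pt_def p_def s_def)
    then have "\<bar>P t \<zeta> x - P t \<zeta> y\<bar> \<le> (\<Sum>n. norm (p n * (J ^^ n) \<zeta> x - p n * (J ^^ n) \<zeta> y))"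
      using summable_norm[OF sa] by simp
    also have "\<dots> \<le> (\<Sum>n. D * (p n * (real n + 1) powr (- (2 * q))))" by (rule suminf_le[OF bd sa sD])
    also have "\<dots> = D * (\<Sum>n. p n * (real n + 1) powr (- (2 * q)))" by (rule suminf_mult[OF sm])
    also have "\<dots> \<le> D * (3 * s powr (- (2 * q)))" using le D by (rule mult_left_mono)
    also have "\<dots> = 3 * C * lam powr (- (2 * q)) * B * (1 + V_fun c x + W N x + V_fun c y + W N y) * t powr (- (2 * q))"
      by (simp add: D_def s_def powr_mult)
    finally show "\<bar>P t \<zeta> x - P t \<zeta> y\<bar> \<le> 3 * C * lam powr (- (2 * q)) * B * (1 + V_fun c x + W N x + V_fun c y + W N y) * t powr (- (2 * q))" .
  qed (use c1 C in auto)
qed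

section \<open>Measures in \<open>Mclass\<close> and their correlations\<close>

lemma Mclass_meas:
  assumes "\<mu> \<in> Mclass N (1 - q)"
  shows "(\<lambda>E. ennreal (W N E) + V N (1 - q) E) \<in> borel_measurable \<mu>"
proof -
  have sets: "sets \<mu> = sets S" using assms by (simp add: Mclass_def)
  have "(\<lambda>E. V N (1 - q) E) \<in> borel_measurable S"
    unfolding V_def negpow_def
  proof (intro borel_measurable_sum)
    fix m i assume "m \<in> {1..N}" "i \<in> {0..N - m}"
    then have im: "i + m \<le> N" by auto
    have [measurable]: "(\<lambda>E. \<Sum>j<m. E (i + j)) \<in> borel_measurable S"
      using block_meas[OF im] by (simp add: block_sum_def)
    show "(\<lambda>E. if 0 < (\<Sum>j<m. E (i + j)) then ennreal ((\<Sum>j<m. E (i + j)) powr (a_coef N m * (1 - q) - 1)) else \<infinity>) \<in> borel_measurable S"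
      by measurable
  qed
  then have "(\<lambda>E. ennreal (W N E) + V N (1 - q) E) \<in> borel_measurable S" using W_meas by measurable
  then show ?thesis using sets by (simp cong: measurable_cong_sets)
qed

text \<open>The blocks of length 1 in \<open>V\<close> have \<open>a_coef N 1 = 1\<close>, so for
  \<open>\<eta> = 1 - q\<close> their exponent is exactly \<open>- q\<close>. Where an energy
  vanishes, \<open>negpow\<close> is infinite, so integrability excludes such states almost
  everywhere.\<close>

lemma Mclass_Omega:
  assumes "\<mu> \<in> Mclass N (1 - q)"
  shows "AE E in \<mu>. E \<in> Omega" "AE E in \<mu>. (\<Sum>i<N. ennreal (E i powr (- q))) \<le> V N (1 - q) E"
    "(\<integral>\<^sup>+E. ennreal (W N E) + V N (1 - q) E \<partial>\<mu>) < \<infinity>"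
proof -
  have sets: "sets \<mu> = sets S" and fin: "(\<integral>\<^sup>+E. ennreal (W N E) + V N (1 - q) E \<partial>\<mu>) < \<infinity>"
    using assms by (auto simp: Mclass_def)
  show "(\<integral>\<^sup>+E. ennreal (W N E) + V N (1 - q) E \<partial>\<mu>) < \<infinity>" by (rule fin)
  have sp: "space \<mu> = space S" using sets_eq_imp_space_eq[OF sets] .
  have ge: "(\<Sum>i<N. negpow (E i) (- q)) \<le> V N (1 - q) E" for E
  proof -
    have "(\<Sum>i<N. negpow (E i) (- q)) = (\<Sum>i\<in>{0..N - 1}. negpow (\<Sum>j<1. E (i + j)) (a_coef N 1 * (1 - q) - 1))"
      using N by (intro sum.cong) (auto simp: a_coef_def)
    also have "\<dots> \<le> V N (1 - q) E"
      unfolding V_def by (rule member_le_sum[where i = 1]) (use N in auto)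
    finally show ?thesis .
  qed
  show "AE E in \<mu>. (\<Sum>i<N. ennreal (E i powr (- q))) \<le> V N (1 - q) E"
  proof (rule AE_I2)
    fix E
    have "(\<Sum>i<N. ennreal (E i powr (- q))) \<le> (\<Sum>i<N. negpow (E i) (- q))"
      by (intro sum_mono) (auto simp: negpow_def)
    then show "(\<Sum>i<N. ennreal (E i powr (- q))) \<le> V N (1 - q) E" using ge by (rule order_trans)
  qed
  note Vm = Mclass_meas[OF assms]
  have "AE E in \<mu>. ennreal (W N E) + V N (1 - q) E \<noteq> \<infinity>"
    by (rule nn_integral_PInf_AE[OF Vm]) (use fin in auto)
  then show "AE E in \<mu>. E \<in> Omega"
  proof (rule AE_mp[OF _ AE_I2], intro impI)
    fix E assume E: "E \<in> space \<mu>" and V: "ennreal (W N E) + V N (1 - q) E \<noteq> \<infinity>"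
    have "E i > 0" if i: "i < N" for i
    proof (rule ccontr)
      assume "\<not> E i > 0"
      then have "negpow (E i) (- q) = \<infinity>" by (simp add: negpow_def)
      moreover have "negpow (E i) (- q) \<le> V N (1 - q) E"
        by (rule order_trans[OF _ ge], rule member_le_sum) (use i in auto)
      ultimately have "V N (1 - q) E = \<infinity>" by (simp add: top_unique)
      then show False using V by simp
    qed
    then show "E \<in> Omega" using E sp by (simp add: Omega_def)
  qed
qed

text \<open>A block carries at least the energy of its first site, so its negative power is at most
  that of the site. This links \<open>V_fun\<close> to the integrability condition on
  \<open>\<mu>\<close>.\<close>

lemma V_fun_le_sites:
  assumes c: "\<And>m. c m \<ge> 1"
  shows "\<exists>A\<ge>1. \<forall>E\<in>Omega. V_fun c E \<le> 1 + A * (\<Sum>i<N. E i powr (- q))"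
proof -
  define A where "A = 1 + (\<Sum>(i, m)\<in>blocks. c m)"
  have c0: "c m \<ge> 0" for m using c[of m] by simp
  have A: "A \<ge> 1" unfolding A_def using c0 by (auto intro!: sum_nonneg)
  show ?thesis
  proof (intro exI[of _ A] conjI A ballI)
    fix E assume E: "E \<in> Omega"
    define Z where "Z = (\<Sum>i<N. E i powr (- q))"
    have Z: "Z \<ge> 0" unfolding Z_def by (intro sum_nonneg) auto
    have "(\<Sum>(i, m)\<in>blocks. c m * block_sum i m E powr (- q)) \<le> (\<Sum>(i, m)\<in>blocks. c m * Z)"
    proof (intro sum_mono, clarify)
      fix i m assume "(i, m) \<in> blocks"
      then have im: "i + m \<le> N" "1 \<le> m" "i < N" by (auto simp: blocks_def)
      have "block_sum i m E powr (- q) \<le> E i powr (- q)"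
        using block_ge_site[OF E im(1), of i] im Omega_pos[OF E im(3)] q by (intro powr_mono2') auto
      also have "\<dots> \<le> Z" unfolding Z_def by (rule member_le_sum) (use im in auto)
      finally show "c m * block_sum i m E powr (- q) \<le> c m * Z" using c0 by (rule mult_left_mono)
    qed
    also have "\<dots> = (\<Sum>(i, m)\<in>blocks. c m) * Z" by (simp add: sum_distrib_right case_prod_beta)
    also have "\<dots> \<le> A * Z" using Z by (intro mult_right_mono) (auto simp: A_def)
    finally show "V_fun c E \<le> 1 + A * (\<Sum>i<N. E i powr (- q))" by (simp add: V_fun_def Z_def)
  qed
qed

text \<open>With \<open>m\<close> the mean of \<open>P t \<zeta>\<close>, the correlation is the
  integral of \<open>\<xi>\<close> against \<open>P t \<zeta> - m\<close>, and
  \<open>P t \<zeta> x - m\<close> averages \<open>P t \<zeta> x - P t \<zeta> y\<close> over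
  \<open>y\<close>. Integrating the contraction bound in both variables uses only first moments of
  \<open>V_fun\<close> and \<open>W\<close>.\<close>

lemma correlation_bound:
  assumes mu: "\<mu> \<in> Mclass N (1 - q)" and xi: "\<xi> \<in> Linf N" and zeta: "\<zeta> \<in> Linf N"
  shows "\<exists>C. \<forall>t>0. \<bar>(\<integral>E. P t \<zeta> E * \<xi> E \<partial>\<mu>) - (\<integral>E. P t \<zeta> E \<partial>\<mu>) * (\<integral>E. \<xi> E \<partial>\<mu>)\<bar> \<le> C * t powr (- (2 * q))"
proof -
  obtain c C where c1: "\<And>m. c m \<ge> 1" and C: "C \<ge> 0" and
    con: "\<And>t \<zeta> B x y. \<zeta> \<in> borel_measurable S \<Longrightarrow> (\<And>E. \<bar>\<zeta> E\<bar> \<le> B) \<Longrightarrow> x \<in> Omega \<Longrightarrow> y \<in> Omega \<Longrightarrow> t > 0 \<Longrightarrow>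
      \<bar>P t \<zeta> x - P t \<zeta> y\<bar> \<le> C * B * (1 + V_fun c x + W N x + V_fun c y + W N y) * t powr (- (2 * q))"
    using Pt_contraction by blast
  have sets[measurable_cong]: "sets \<mu> = sets S" and pr: "prob_space \<mu>" using mu by (auto simp: Mclass_def)
  interpret prob_space \<mu> by (rule pr)
  note AEO = Mclass_Omega(1)[OF mu]
  obtain Bx where xm: "\<xi> \<in> borel_measurable S" and Bx: "\<And>E. \<bar>\<xi> E\<bar> \<le> Bx" using xi by (auto simp: Linf_def)
  obtain B where zm: "\<zeta> \<in> borel_measurable S" and B: "\<And>E. \<bar>\<zeta> E\<bar> \<le> B" using zeta by (auto simp: Linf_def)
  have Bx0: "Bx \<ge> 0" using order_trans[OF abs_ge_zero Bx] .
  have B0: "B \<ge> 0" using order_trans[OF abs_ge_zero B] .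
  define U where "U E = 1 + V_fun c E + W N E" for E
  have U0: "U E \<ge> 0" if "E \<in> Omega" for E
    using order_trans[OF powr_ge_zero V_fun_ge_site[of c 0 E, OF c1 N_less(1)]] W_nonneg[OF that] by (simp add: U_def)
  have Um[measurable]: "U \<in> borel_measurable S" unfolding U_def using V_fun_meas[of c] W_meas by measurable
  obtain A where A: "A \<ge> 1" "\<And>E. E \<in> Omega \<Longrightarrow> V_fun c E \<le> 1 + A * (\<Sum>i<N. E i powr (- q))"
    using V_fun_le_sites[of c, OF c1] by blast
  have Uint: "integrable \<mu> U"
  proof (rule integrableI_bounded)
    have "(\<integral>\<^sup>+E. ennreal (norm (U E)) \<partial>\<mu>) \<le> (\<integral>\<^sup>+E. 2 + ennreal A * (ennreal (W N E) + V N (1 - q) E) \<partial>\<mu>)"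
    proof (rule nn_integral_mono_AE, rule AE_mp[OF AEO AE_mp[OF Mclass_Omega(2)[OF mu] AE_I2]], intro impI)
      fix E assume E: "E \<in> Omega" and V: "(\<Sum>i<N. ennreal (E i powr (- q))) \<le> V N (1 - q) E"
      have "norm (U E) \<le> 2 + A * (W N E + (\<Sum>i<N. E i powr (- q)))"
        using A(2)[OF E] U0[OF E] mult_right_mono[OF A(1) W_nonneg[OF E]] by (simp add: U_def distrib_left)
      then have "ennreal (norm (U E)) \<le> ennreal (2 + A * (W N E + (\<Sum>i<N. E i powr (- q))))" by (rule ennreal_leI)
      also have "\<dots> = 2 + ennreal A * (ennreal (W N E) + (\<Sum>i<N. ennreal (E i powr (- q))))"
        using A(1) W_nonneg[OF E] by (simp add: sum_ennreal sum_nonneg ennreal_mult)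
      also have "\<dots> \<le> 2 + ennreal A * (ennreal (W N E) + V N (1 - q) E)"
        using V by (intro add_mono mult_left_mono order_refl) auto
      finally show "ennreal (norm (U E)) \<le> 2 + ennreal A * (ennreal (W N E) + V N (1 - q) E)" .
    qed
    also have "\<dots> \<le> 2 + ennreal A * (\<integral>\<^sup>+E. ennreal (W N E) + V N (1 - q) E \<partial>\<mu>)"
      using Mclass_meas[OF mu] emeasure_space_1 by (simp add: nn_integral_add nn_integral_cmult)
    also have "\<dots> < \<infinity>" using Mclass_Omega(3)[OF mu] by (simp add: ennreal_mult_less_top)
    finally show "(\<integral>\<^sup>+E. ennreal (norm (U E)) \<partial>\<mu>) < \<infinity>" .
  qed measurable
  define IU where "IU = (\<integral>E. U E \<partial>\<mu>)"
  have IU0: "IU \<ge> 0" unfolding IU_def by (rule integral_nonneg_AE) (use AEO U0 in \<open>auto intro: AE_mp\<close>)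
  have xint: "integrable \<mu> \<xi>"
    by (rule integrable_const_bound[of _ Bx]) (use Bx xm in \<open>auto cong: measurable_cong_sets\<close>)
  have bound: "\<bar>(\<integral>E. P t \<zeta> E * \<xi> E \<partial>\<mu>) - (\<integral>E. P t \<zeta> E \<partial>\<mu>) * (\<integral>E. \<xi> E \<partial>\<mu>)\<bar>
      \<le> (2 * Bx * (C * B) * IU) * t powr (- (2 * q))" if t: "t > 0" for t
  proof -
    define k where "k = C * B * t powr (- (2 * q))"
    have k: "k \<ge> 0" using C B0 by (simp add: k_def)
    have Pm: "P t \<zeta> \<in> borel_measurable \<mu>" using Pt_meas[OF zm] by measurable
    have Pint: "integrable \<mu> (P t \<zeta>)"
      by (rule integrable_const_bound[of _ "3 * B"])
         (use AEO Pt_summable(2)[OF zm B _ t] Pm in \<open>auto intro: AE_mp\<close>)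
    define m where "m = (\<integral>E. P t \<zeta> E \<partial>\<mu>)"
    have dist: "\<bar>P t \<zeta> x - m\<bar> \<le> k * (U x + IU)" if x: "x \<in> Omega" for x
    proof -
      have eq: "P t \<zeta> x - m = (\<integral>y. P t \<zeta> x - P t \<zeta> y \<partial>\<mu>)" using Pint prob_space by (simp add: m_def)
      have "\<bar>P t \<zeta> x - m\<bar> \<le> (\<integral>y. \<bar>P t \<zeta> x - P t \<zeta> y\<bar> \<partial>\<mu>)"
        unfolding eq by (rule integral_abs_bound)
      also have "\<dots> \<le> (\<integral>y. k * U x + k * U y \<partial>\<mu>)"
      proof (rule integral_mono_AE)
        show "integrable \<mu> (\<lambda>y. \<bar>P t \<zeta> x - P t \<zeta> y\<bar>)"
          by (intro integrable_abs Bochner_Integration.integrable_diff integrable_const Pint)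
        show "integrable \<mu> (\<lambda>y. k * U x + k * U y)"
          by (intro Bochner_Integration.integrable_add integrable_const integrable_mult_right Uint)
        show "AE y in \<mu>. \<bar>P t \<zeta> x - P t \<zeta> y\<bar> \<le> k * U x + k * U y"
        proof (rule AE_mp[OF AEO AE_I2], intro impI)
          fix y assume y: "y \<in> Omega"
          have "\<bar>P t \<zeta> x - P t \<zeta> y\<bar> \<le> k * (1 + V_fun c x + W N x + V_fun c y + W N y)"
            using con[OF zm B x y t] by (simp add: k_def ac_simps)
          also have "\<dots> \<le> k * (U x + U y)" using k by (intro mult_left_mono) (auto simp: U_def)
          finally show "\<bar>P t \<zeta> x - P t \<zeta> y\<bar> \<le> k * U x + k * U y" by (simp add: distrib_left)
        qed
      qed
      also have "\<dots> = k * (U x + IU)" using Uint prob_space by (simp add: IU_def distrib_left)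
      finally show ?thesis .
    qed
    have Pxi: "integrable \<mu> (\<lambda>E. P t \<zeta> E * \<xi> E)"
    proof (rule integrable_const_bound[of _ "3 * B * Bx"])
      show "AE E in \<mu>. norm (P t \<zeta> E * \<xi> E) \<le> 3 * B * Bx"
        by (rule AE_mp[OF AEO AE_I2])
           (use Pt_summable(2)[OF zm B _ t] Bx B0 in \<open>auto simp: abs_mult intro!: mult_mono\<close>)
      show "(\<lambda>E. P t \<zeta> E * \<xi> E) \<in> borel_measurable \<mu>" using Pm xm by measurable
    qed
    have eq: "(\<integral>E. P t \<zeta> E * \<xi> E \<partial>\<mu>) - m * (\<integral>E. \<xi> E \<partial>\<mu>) = (\<integral>E. P t \<zeta> E * \<xi> E - m * \<xi> E \<partial>\<mu>)"
      using Pxi xint by simp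
    have "\<bar>(\<integral>E. P t \<zeta> E * \<xi> E \<partial>\<mu>) - m * (\<integral>E. \<xi> E \<partial>\<mu>)\<bar> \<le> (\<integral>E. \<bar>P t \<zeta> E * \<xi> E - m * \<xi> E\<bar> \<partial>\<mu>)"
      unfolding eq by (rule integral_abs_bound)
    also have "\<dots> \<le> (\<integral>E. Bx * k * U E + Bx * k * IU \<partial>\<mu>)"
    proof (rule integral_mono_AE)
      show "integrable \<mu> (\<lambda>E. \<bar>P t \<zeta> E * \<xi> E - m * \<xi> E\<bar>)"
        by (intro integrable_abs Bochner_Integration.integrable_diff integrable_mult_right Pxi xint)
      show "integrable \<mu> (\<lambda>E. Bx * k * U E + Bx * k * IU)"
        by (intro Bochner_Integration.integrable_add integrable_const integrable_mult_right Uint)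
      show "AE E in \<mu>. \<bar>P t \<zeta> E * \<xi> E - m * \<xi> E\<bar> \<le> Bx * k * U E + Bx * k * IU"
      proof (rule AE_mp[OF AEO AE_I2], intro impI)
        fix E assume E: "E \<in> Omega"
        have "\<bar>P t \<zeta> E * \<xi> E - m * \<xi> E\<bar> = \<bar>\<xi> E\<bar> * \<bar>P t \<zeta> E - m\<bar>"
          by (simp add: abs_mult[symmetric] algebra_simps)
        also have "\<dots> \<le> Bx * (k * (U E + IU))" using Bx[of E] dist[OF E] Bx0 by (intro mult_mono) auto
        finally show "\<bar>P t \<zeta> E * \<xi> E - m * \<xi> E\<bar> \<le> Bx * k * U E + Bx * k * IU" by (simp add: algebra_simps)
      qed
    qed
    also have "\<dots> = 2 * Bx * k * IU" using Uint prob_space by (simp add: IU_def)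
    finally show ?thesis by (simp add: m_def k_def ac_simps)
  qed
  then show ?thesis by blast
qed

end

theorem theorem3:
  fixes N :: nat and TL TR :: real
  assumes "N \<ge> 1" and "TL > 0" and "TR > 0"
  shows "\<exists>K0. \<forall>K \<ge> K0. \<forall>\<gamma> > 0. \<exists>\<eta>. 0 < \<eta> \<and> \<eta> < 1 \<and>
           (\<forall>\<mu> \<in> Mclass N \<eta>. \<forall>\<xi> \<in> Linf N. \<forall>\<zeta> \<in> Linf N.
              (\<lambda>t. \<bar>(\<integral>E. Pt N K TL TR t \<zeta> E * \<xi> E \<partial>\<mu>)
                     - (\<integral>E. Pt N K TL TR t \<zeta> E \<partial>\<mu>) * (\<integral>E. \<xi> E \<partial>\<mu>)\<bar>)
              \<in> O[at_top](\<lambda>t. t powr (- (2 - \<gamma>))))"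
proof (rule exI[of _ "1::real"], intro allI impI)
  fix K \<gamma> :: real assume K: "1 \<le> K" and g: "0 < \<gamma>"
  \<comment> \<open>The rate \<open>2 * q\<close> has to reach \<open>2 - \<gamma>\<close> with
    \<open>q < 1\<close>; the value 3/4 keeps \<open>q\<close> above 1/2 when
    \<open>\<gamma>\<close> is large.\<close>
  define q where "q = max ((2 - \<gamma>) / 2) (3 / 4)"
  have "(2 - \<gamma>) / 2 \<le> q" "1/2 < q" "q < 1" using g by (auto simp: q_def)
  then have qs: "1/2 < q" "q < 1" "2 - \<gamma> \<le> 2 * q" by auto
  interpret block_powers N K TL TR q
    by unfold_locales (use assms K qs in auto)
  have "(\<lambda>t. \<bar>(\<integral>E. Pt N K TL TR t \<zeta> E * \<xi> E \<partial>\<mu>) - (\<integral>E. Pt N K TL TR t \<zeta> E \<partial>\<mu>) * (\<integral>E. \<xi> E \<partial>\<mu>)\<bar>)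
        \<in> O[at_top](\<lambda>t. t powr (- (2 - \<gamma>)))"
    if mu: "\<mu> \<in> Mclass N (1 - q)" and xi: "\<xi> \<in> Linf N" and zeta: "\<zeta> \<in> Linf N" for \<mu> \<xi> \<zeta>
  proof -
    obtain C where C: "\<And>t. t > 0 \<Longrightarrow> \<bar>(\<integral>E. Pt N K TL TR t \<zeta> E * \<xi> E \<partial>\<mu>)
        - (\<integral>E. Pt N K TL TR t \<zeta> E \<partial>\<mu>) * (\<integral>E. \<xi> E \<partial>\<mu>)\<bar> \<le> C * t powr (- (2 * q))"
      using correlation_bound[OF mu xi zeta] by blast
    show ?thesis
    proof (rule bigoI[where c = "\<bar>C\<bar>"], rule eventually_at_top_linorderI[of 1])
      fix t :: real assume t: "1 \<le> t"
      have "C * t powr (- (2 * q)) \<le> \<bar>C\<bar> * t powr (- (2 - \<gamma>))"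
      proof -
        have "- (2 * q) \<le> - (2 - \<gamma>)" using qs(3) by linarith
        then have "t powr (- (2 * q)) \<le> t powr (- (2 - \<gamma>))" using t by (rule powr_mono)
        then show ?thesis by (intro mult_mono) auto
      qed
      then show "norm \<bar>(\<integral>E. Pt N K TL TR t \<zeta> E * \<xi> E \<partial>\<mu>) - (\<integral>E. Pt N K TL TR t \<zeta> E \<partial>\<mu>) * (\<integral>E. \<xi> E \<partial>\<mu>)\<bar>
          \<le> \<bar>C\<bar> * norm (t powr (- (2 - \<gamma>)))"
        using C[of t] t by simp
    qed
  qed
  then show "\<exists>\<eta>. 0 < \<eta> \<and> \<eta> < 1 \<and>
           (\<forall>\<mu> \<in> Mclass N \<eta>. \<forall>\<xi> \<in> Linf N. \<forall>\<zeta> \<in> Linf N.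
              (\<lambda>t. \<bar>(\<integral>E. Pt N K TL TR t \<zeta> E * \<xi> E \<partial>\<mu>)
                     - (\<integral>E. Pt N K TL TR t \<zeta> E \<partial>\<mu>) * (\<integral>E. \<xi> E \<partial>\<mu>)\<bar>)
              \<in> O[at_top](\<lambda>t. t powr (- (2 - \<gamma>))))"
    using qs by (intro exI[of _ "1 - q"]) auto
qed

end
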